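(* Fix $N\ge1$ and let $g\in SO(N)$ be Haar-distributed. Then for every $K\ge1$, \[\mathbb{P}\big[|gT\cap\mathbb{Z}^N|\ge K\big]\lesssim K^{-N},\] uniformly over all convex subsets $T\subset\mathbb{R}^N$ with $|T|\lesssim1$, where implied constants depend only on $N$.
   Context: $|T|$ denotes Lebesgue measure and $|gT\cap\mathbb{Z}^N|$ the number of integer points in the rotated set $gT$. *)

theory Defs
  imports "HOL-Probability.Probability"
begin

definition SO :: "(real^'n^'n) set" where
  "SO = {g. orthogonal_matrix g \<and> det g = 1}"

text \<open>Haar probability measure on SO(N): a probability measure on the Borel sets of the
  matrix space, concentrated on SO(N), and invariant under left translation by SO(N).
  By uniqueness of Haar measure this determines the measure.\<close>
definition haar_SO :: "(real^'n^'n) measure \<Rightarrow> bool" where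
  "haar_SO M \<longleftrightarrow> prob_space M \<and> sets M = sets borel \<and> SO \<in> sets M \<and>
     emeasure M SO = 1 \<and>
     (\<forall>h\<in>SO. \<forall>A\<in>sets M. emeasure M ((\<lambda>g. h ** g) -` A) = emeasure M A)"

definition int_lattice :: "(real^'n) set" where
  "int_lattice = {x. \<forall>i. x $ i \<in> \<int>}"

text \<open>"|gT \<inter> Z^N| \<ge> K": the rotated set contains at least K lattice points
  (also covers the case of infinitely many lattice points).\<close>
definition many_lattice_pts :: "real^'n^'n \<Rightarrow> (real^'n) set \<Rightarrow> real \<Rightarrow> bool" where
  "many_lattice_pts g T K \<longleftrightarrow>
     (\<exists>S. S \<subseteq> ((\<lambda>v. g *v v) ` T) \<inter> int_lattice \<and> finite S \<and> K \<le> real (card S))"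

end

theory Submission
  imports Defs
begin

text \<open>
  Differences of points of \<open>T\<close> lie in a rotated coordinate box whose sides \<open>a\<close> have product \<open>O(1)\<close>,
  so it suffices to bound the probability that \<open>g\<close> maps many integer vectors into such a box. Let \<open>U\<close> be the
  bi-\<open>SO\<close>-invariant set of matrices that distort norms by at most a factor 2. Every \<open>n \<in> U\<close> factors as
  \<open>n = p q\<close> with \<open>q \<in> SO\<close> and \<open>p\<close> triangular; ordering the sides suitably, \<open>p\<close> maps the box into a multiple of
  itself. Hence averaging over \<open>g\<close> can be replaced by averaging over \<open>n \<in> U\<close> with respect to Lebesgue
  measure, where left multiplication by \<open>diag(1/a)\<close> is harmless and turns the box into a cube.

  What remains is the Lebesgue measure of the matrices \<open>Y\<close> in a set meeting every \<open>GL\<^sub>N(\<int>)\<close>-orbit boundedly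
  often, whose lattice \<open>Y \<int>\<^sup>N\<close> has at least \<open>K\<close> points in a cube. Passing to a reduced basis with Gram-Schmidt
  lengths \<open>r\<^sub>0, r\<^sub>1, \<dots>\<close>, many points force \<open>r\<^sub>0 \<cdots> r\<^sub>k\<^sub>-\<^sub>1 = O(1/K)\<close> for some \<open>k\<close>, and integrating out the
  basis vectors from the last to the first shows that such reduced bases have measure \<open>O(K\<^sup>-\<^sup>N)\<close>.
\<close>

text \<open>The hypothesis \<open>haar_SO\<close> supplies nothing but left invariance,
  \<open>diag(1/a)\<close> does not preserve \<open>SO\<close>, and the sides \<open>a\<close> may
  be arbitrarily disparate: only their product is controlled. Thickening \<open>SO\<close> to a set
  of positive Lebesgue measure meets all of this. On matrix space \<open>diag(1/a)\<close> merely
  scales the measure by a power of the product of the sides, and the overlap in the passage to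
  reduced bases is counted by integer matrices with entries at most 4 in absolute value, whatever
  \<open>a\<close> is. The exponent N arises as follows. Let \<delta>, of order 1/K, bound the
  covolume of the first k basis vectors. Integrating these k vectors against the weight
  covolume^-(N-k) gives a multiple of \<delta>^k, and since the covolume is at most \<delta>,
  inserting that weight costs \<delta>^(N-k). The other N-k vectors contribute a constant, because
  the full covolume is bounded in terms of the product of the sides. Thus every k yields the same
  power \<delta>^N.\<close>

section \<open>Gram-Schmidt orthogonalisation\<close>

text \<open>If \<open>gs x j = 0\<close>, division by zero makes the corresponding summand vanish.\<close>

function gs :: "(nat \<Rightarrow> 'a::real_inner) \<Rightarrow> nat \<Rightarrow> 'a" where
  "gs x i = x i - (\<Sum>j<i. (x i \<bullet> gs x j / (gs x j \<bullet> gs x j)) *\<^sub>R gs x j)"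
  by pat_completeness auto
termination by (relation "Wellfounded.measure snd") auto

declare gs.simps [simp del]

text \<open>The orthogonal projection off the span of the first \<open>k\<close> vectors. It is
  separated from \<open>gs\<close> because later the prefix stays fixed while \<open>w\<close>
  varies: over lattice vectors when a minimum is sought, over a convex body, or as an integration
  variable.\<close>

definition gs_perp :: "(nat \<Rightarrow> 'a::real_inner) \<Rightarrow> nat \<Rightarrow> 'a \<Rightarrow> 'a" where
  "gs_perp x k w = w - (\<Sum>j<k. (w \<bullet> gs x j / (gs x j \<bullet> gs x j)) *\<^sub>R gs x j)"

lemma gs_eq_perp: "gs x i = gs_perp x i (x i)"
  unfolding gs_perp_def by (subst gs.simps) simp

lemma gs_orth_less: "j < i \<Longrightarrow> gs x i \<bullet> gs x j = 0"
proof (induction i arbitrary: j rule: less_induct)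
  case (less i)
  have orth: "gs x l \<bullet> gs x j = 0" if "l < i" "l \<noteq> j" for l
    using less.IH[of l j] less.IH[of j l] less.prems that
    by (cases l j rule: linorder_cases) (auto simp: inner_commute)
  have "gs x i \<bullet> gs x j = x i \<bullet> gs x j - (\<Sum>l<i. x i \<bullet> gs x l / (gs x l \<bullet> gs x l) * (gs x l \<bullet> gs x j))"
    by (subst gs.simps) (simp add: inner_diff_left inner_sum_left)
  also have "(\<Sum>l<i. x i \<bullet> gs x l / (gs x l \<bullet> gs x l) * (gs x l \<bullet> gs x j))
     = (\<Sum>l<i. if l = j then x i \<bullet> gs x j else 0)"
    by (rule sum.cong) (auto simp: orth)
  also have "\<dots> = x i \<bullet> gs x j" using less.prems by simp
  finally show ?case by simp
qed

lemma gs_orth: "i \<noteq> j \<Longrightarrow> gs x i \<bullet> gs x j = 0"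
  by (metis gs_orth_less inner_commute linorder_neqE_nat)

lemma gs_perp_orth: "j < k \<Longrightarrow> gs_perp x k w \<bullet> gs x j = 0"
proof -
  assume j: "j < k"
  have "(\<Sum>l<k. w \<bullet> gs x l / (gs x l \<bullet> gs x l) * (gs x l \<bullet> gs x j))
     = (\<Sum>l<k. if l = j then w \<bullet> gs x j else 0)"
    by (rule sum.cong) (auto simp: gs_orth)
  also have "\<dots> = w \<bullet> gs x j" using j by simp
  finally show ?thesis by (simp add: gs_perp_def inner_diff_left inner_sum_left)
qed

lemma linear_gs_perp: "linear (gs_perp x k)"
  by (rule linearI)
    (simp_all add: gs_perp_def inner_add_left add_divide_distrib scaleR_add_left sum.distrib
      scaleR_diff_right scaleR_sum_right)

lemma gs_perp_decomp: "w = gs_perp x k w + (\<Sum>j<k. (w \<bullet> gs x j / (gs x j \<bullet> gs x j)) *\<^sub>R gs x j)"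
  by (simp add: gs_perp_def)

lemma gs_perp_gs:
  "gs_perp x k (gs x i) = (if i < k then 0 else gs x i)"
proof -
  have "(\<Sum>j<k. (gs x i \<bullet> gs x j / (gs x j \<bullet> gs x j)) *\<^sub>R gs x j) = (\<Sum>j<k. if j = i then gs x i else 0)"
    by (rule sum.cong) (auto simp: gs_orth)
  then show ?thesis by (simp add: gs_perp_def)
qed

lemma gs_in_span: "j < k \<Longrightarrow> gs x j \<in> span (x ` {..<k})"
proof (induction j rule: less_induct)
  case (less j)
  show ?case
    by (subst gs.simps, intro span_diff span_sum span_scale) (use less in \<open>auto intro: span_base\<close>)
qed

lemma span_gs: "span (gs x ` {..<k}) = span (x ` {..<k})"
proof (rule subset_antisym; rule span_minimal[OF _ subspace_span])
  show "gs x ` {..<k} \<subseteq> span (x ` {..<k})" using gs_in_span by auto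
  show "x ` {..<k} \<subseteq> span (gs x ` {..<k})"
  proof (rule image_subsetI)
    fix j assume j: "j \<in> {..<k}"
    have "gs x j + (\<Sum>l<j. (x j \<bullet> gs x l / (gs x l \<bullet> gs x l)) *\<^sub>R gs x l) \<in> span (gs x ` {..<k})"
      using j by (intro span_add span_sum span_scale span_base) auto
    then show "x j \<in> span (gs x ` {..<k})" by (simp add: gs.simps[of x j])
  qed
qed

lemma gs_perp_eq_0_iff: "gs_perp x k w = 0 \<longleftrightarrow> w \<in> span (x ` {..<k})"
proof
  assume "gs_perp x k w = 0"
  then have "w = (\<Sum>j<k. (w \<bullet> gs x j / (gs x j \<bullet> gs x j)) *\<^sub>R gs x j)"
    using gs_perp_decomp[of w x k] by simp
  also have "\<dots> \<in> span (gs x ` {..<k})" by (intro span_sum span_scale span_base) auto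
  finally show "w \<in> span (x ` {..<k})" by (simp add: span_gs)
next
  assume "w \<in> span (x ` {..<k})"
  then have "w \<in> span (gs x ` {..<k})" by (simp add: span_gs)
  then show "gs_perp x k w = 0"
    by (rule linear_eq_0_on_span[OF linear_gs_perp, rotated]) (auto simp: gs_perp_gs)
qed

lemma gs_eq_0_iff: "gs x k = 0 \<longleftrightarrow> x k \<in> span (x ` {..<k})"
  by (simp add: gs_eq_perp gs_perp_eq_0_iff)

lemma gs_cong: "(\<And>j. j \<le> i \<Longrightarrow> x j = y j) \<Longrightarrow> gs x i = gs y i"
proof (induction i rule: less_induct)
  case (less i)
  have "gs x j = gs y j" if "j < i" for j using less that by auto
  then show ?case using less.prems[of i] by (subst (1 2) gs.simps) simp
qed

lemma gs_perp_cong: "(\<And>j. j < k \<Longrightarrow> x j = y j) \<Longrightarrow> gs_perp x k w = gs_perp y k w"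
  unfolding gs_perp_def by (intro arg_cong2[of _ _ _ _ "(-)"] refl sum.cong) (simp add: gs_cong[of _ x y])

lemma gs_fun_upd: "gs (x(k := w)) k = gs_perp x k w"
  using gs_perp_cong[of k "x(k := w)" x w] by (simp add: gs_eq_perp)

lemma gs_fun_upd_less: "i < k \<Longrightarrow> gs (x(k := w)) i = gs x i"
  by (rule gs_cong) auto

lemma gs_perp_inner_self: "gs_perp x k w \<bullet> w = (norm (gs_perp x k w))\<^sup>2"
proof -
  have "gs_perp x k w \<bullet> w = gs_perp x k w \<bullet> (gs_perp x k w + (\<Sum>j<k. (w \<bullet> gs x j / (gs x j \<bullet> gs x j)) *\<^sub>R gs x j))"
    using gs_perp_decomp[of w x k] by simp
  also have "\<dots> = gs_perp x k w \<bullet> gs_perp x k w"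
    by (simp add: inner_add_right inner_sum_right gs_perp_orth)
  finally show ?thesis by (simp add: power2_norm_eq_inner)
qed

lemma norm_gs_perp_le: "norm (gs_perp x k w) \<le> norm w"
proof -
  have "(norm (gs_perp x k w))\<^sup>2 \<le> norm (gs_perp x k w) * norm w"
    using norm_cauchy_schwarz[of "gs_perp x k w" w] by (simp add: gs_perp_inner_self)
  then show ?thesis by (cases "norm (gs_perp x k w) = 0") (auto simp: power2_eq_square)
qed

lemma norm_gs_le: "norm (gs x k) \<le> norm (x k)"
  by (simp add: gs_eq_perp norm_gs_perp_le)

lemma inner_gs_self: "x k \<bullet> gs x k = (norm (gs x k))\<^sup>2"
  using gs_perp_inner_self[of x k "x k"] by (simp add: gs_eq_perp inner_commute)

lemma gs_perp_Suc: "gs_perp x k w = gs_perp x (Suc k) w + (w \<bullet> gs x k / (gs x k \<bullet> gs x k)) *\<^sub>R gs x k"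
  by (simp add: gs_perp_def)

lemma norm_gs_perp_antimono: "norm (gs_perp x (Suc k) w) \<le> norm (gs_perp x k w)"
proof -
  let ?v = "gs_perp x (Suc k) w"
  have v: "gs_perp x (Suc k) ?v = ?v" by (simp add: gs_perp_def[of x "Suc k" ?v] gs_perp_orth)
  have "gs_perp x (Suc k) (gs_perp x k w) = gs_perp x (Suc k) ?v"
    unfolding gs_perp_Suc[of x k w]
    by (simp add: linear_add[OF linear_gs_perp] linear_scale[OF linear_gs_perp] gs_perp_gs)
  then show ?thesis using v by (metis norm_gs_perp_le)
qed

lemma span_image_lessThan_neq_UNIV:
  fixes x :: "nat \<Rightarrow> 'a::euclidean_space"
  assumes "k < DIM('a)"
  shows "span (x ` {..<k}) \<noteq> UNIV"
proof -
  have "dim (x ` {..<k}) \<le> k"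
    by (metis card_image_le card_lessThan dim_le_card' finite_imageI finite_lessThan le_trans)
  then show ?thesis using assms by (metis dim_UNIV dim_span not_less)
qed

text \<open>Fewer than \<open>DIM('a)\<close> vectors span a proper subspace, so a vector outside it
  can be appended. This completes a partial orthogonal system to a frame in which volumes of boxes
  can be computed.\<close>

lemma ex_gs_extension:
  fixes x :: "nat \<Rightarrow> 'a::euclidean_space"
  assumes "k \<le> DIM('a)" "\<And>i. i < k \<Longrightarrow> gs x i \<noteq> 0"
  shows "\<exists>y. (\<forall>i<k. y i = x i) \<and> (\<forall>i<DIM('a). gs y i \<noteq> 0)"
  using assms
proof (induction "DIM('a) - k" arbitrary: x k)
  case 0
  then show ?case by (intro exI[of _ x]) auto
next
  case (Suc d)
  have "span (x ` {..<k}) \<noteq> UNIV" using Suc(2) by (intro span_image_lessThan_neq_UNIV) linarith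
  then obtain w where w: "w \<notin> span (x ` {..<k})" by auto
  have "gs (x(k := w)) i \<noteq> 0" if "i < Suc k" for i
    using that w Suc.prems(2)[of i] by (cases "i = k") (auto simp: gs_fun_upd gs_perp_eq_0_iff gs_fun_upd_less)
  moreover have "d = DIM('a) - Suc k" "Suc k \<le> DIM('a)" using Suc(2) by linarith+
  ultimately obtain y where "\<forall>i<Suc k. y i = (x(k := w)) i" "\<forall>i<DIM('a). gs y i \<noteq> 0"
    using Suc(1)[of "Suc k" "x(k:=w)"] by blast
  then show ?case by (intro exI[of _ y]) auto
qed

section \<open>Lebesgue measure on matrices\<close>

text \<open>The coordinate type carries no order, so an enumeration of it is fixed.\<close>

definition idx :: "'n::finite \<Rightarrow> nat" where "idx = to_nat_on UNIV"

definition colmat :: "(nat \<Rightarrow> real^'n) \<Rightarrow> real^'n^'n" where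
  "colmat x = (\<chi> r c. x (idx c) $ r)"

definition rowmat :: "(nat \<Rightarrow> real^'n) \<Rightarrow> real^'n^'n" where
  "rowmat x = (\<chi> r. x (idx r))"

lemma bij_betw_idx: "bij_betw (idx :: 'n::finite \<Rightarrow> nat) UNIV {..<CARD('n)}"
  unfolding idx_def by (rule to_nat_on_finite) simp

lemma idx_less: "idx (i::'n::finite) < CARD('n)"
  using bij_betw_idx[where 'n='n] by (auto simp: bij_betw_def)

lemma idx_inject [simp]: "idx i = idx j \<longleftrightarrow> i = j"
  using bij_betw_idx by (auto simp: bij_betw_def inj_def)

lemma idx_surj: "k < CARD('n) \<Longrightarrow> \<exists>i::'n::finite. idx i = k"
  using bij_betw_idx[where 'n='n] by (auto simp: bij_betw_def image_def set_eq_iff) (metis)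

lemma all_idx: "(\<forall>i<CARD('n). P i) \<longleftrightarrow> (\<forall>c::'n::finite. P (idx c))"
  using idx_less idx_surj by metis

lemma prod_idx: "(\<Prod>i\<in>(UNIV::'n::finite set). f (idx i)) = (\<Prod>i<CARD('n). f i)"
  using prod.reindex_bij_betw[OF bij_betw_idx[where 'n='n], of f] .

lemma sum_idx: "(\<Sum>i\<in>(UNIV::'n::finite set). f (idx i)) = (\<Sum>i<CARD('n). f i)"
  using sum.reindex_bij_betw[OF bij_betw_idx[where 'n='n], of f] .

lemma transpose_rowmat: "transpose (rowmat x) = colmat x"
  by (simp add: rowmat_def colmat_def transpose_def)

lemma row_rowmat: "row i (rowmat x) = x (idx i)"
  by (simp add: rowmat_def row_def vec_eq_iff)

text \<open>Each row differs from its orthogonalisation by an element of the span of the earlier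
  rows, so the determinant does not change; the Gram matrix of the orthogonalised rows is
  diagonal.\<close>

lemma det_rowmat:
  fixes x :: "nat \<Rightarrow> real^'n"
  shows "\<bar>det (rowmat x)\<bar> = (\<Prod>i<CARD('n). norm (gs x i))"
proof -
  \<comment> \<open>The replacement runs from the last row to the first: when row \<open>k\<close>
    changes, the rows of smaller index are still the original ones and span the correction.\<close>
  define y where "y k i = (if i < k then x i else gs x i)" for k i
  have step: "det (rowmat (y (Suc k))) = det (rowmat (y k))" if k: "k < CARD('n)" for k
  proof -
    obtain c :: 'n where c: "idx c = k" using idx_surj[OF k] by auto
    let ?A = "rowmat (y (Suc k))"
    define s where "s = (\<Sum>l<k. (x k \<bullet> gs x l / (gs x l \<bullet> gs x l)) *\<^sub>R gs x l)"
    have "x ` {..<k} \<subseteq> {row j ?A |j. j \<noteq> c}"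
    proof (rule image_subsetI)
      fix l assume l: "l \<in> {..<k}"
      then obtain j :: 'n where j: "idx j = l" using idx_surj[of l, where 'n='n] k by fastforce
      with l c show "x l \<in> {row j ?A |j. j \<noteq> c}" by (auto simp: row_rowmat y_def intro!: exI[of _ j])
    qed
    moreover have "s \<in> span (x ` {..<k})"
      unfolding s_def by (intro span_sum span_scale gs_in_span) auto
    ultimately have "- s \<in> span {row j ?A |j. j \<noteq> c}" using span_mono span_neg by blast
    then have "det (\<chi> k. if k = c then row c ?A + (- s) else row k ?A) = det ?A"
      by (intro det_row_span) (simp add: span_vec_eq)
    moreover have "(\<chi> k. if k = c then row c ?A + (- s) else row k ?A) = rowmat (y k)"
    proof -
      have "gs x k = x k - s" by (subst gs.simps) (simp add: s_def)
      moreover have "y (Suc k) (idx j) = y k (idx j)" if "j \<noteq> c" for j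
        using that c by (auto simp: y_def less_Suc_eq)
      moreover have "rowmat z $ j = z (idx j)" for z :: "nat \<Rightarrow> real^'n" and j
        by (simp add: rowmat_def)
      ultimately show ?thesis
        by (subst vec_eq_iff) (simp add: row_rowmat c y_def[of "Suc k" k] y_def[of k k])
    qed
    ultimately show ?thesis by simp
  qed
  have "det (rowmat (y k)) = det (rowmat (y 0))" if "k \<le> CARD('n)" for k
    using that by (induction k) (auto simp: step)
  moreover have "rowmat (y CARD('n)) = rowmat x" by (simp add: rowmat_def y_def idx_less)
  moreover have "rowmat (y 0) = rowmat (gs x)" by (simp add: rowmat_def y_def)
  ultimately have 1: "det (rowmat x) = det (rowmat (gs x))" by (metis order_refl)
  let ?G = "rowmat (gs x)"
  have "(?G ** transpose ?G) $ i $ j = gs x (idx i) \<bullet> gs x (idx j)" for i j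
    by (simp add: matrix_matrix_mult_def transpose_def rowmat_def inner_vec_def)
  then have G: "(?G ** transpose ?G) $ i $ j = (if i = j then (norm (gs x (idx i)))\<^sup>2 else 0)" for i j
    by (simp add: gs_orth power2_norm_eq_inner)
  have "det (?G ** transpose ?G) = (\<Prod>i\<in>(UNIV::'n set). (norm (gs x (idx i)))\<^sup>2)"
    by (subst det_diagonal) (simp_all add: G)
  also have "\<dots> = (\<Prod>i<CARD('n). norm (gs x i))\<^sup>2"
    by (simp add: prod_idx[of "\<lambda>i. (norm (gs x i))\<^sup>2"] prod_power_distrib)
  finally have "(det ?G)\<^sup>2 = (\<Prod>i<CARD('n). norm (gs x i))\<^sup>2"
    by (simp add: det_mul det_transpose power2_eq_square)
  then have "\<bar>det ?G\<bar> = \<bar>\<Prod>i<CARD('n). norm (gs x i)\<bar>" by (simp add: power2_eq_iff abs_eq_iff)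
  then show ?thesis by (simp add: 1 prod_nonneg)
qed

lemma det_colmat:
  fixes x :: "nat \<Rightarrow> real^'n"
  shows "\<bar>det (colmat x)\<bar> = (\<Prod>i<CARD('n). norm (gs x i))"
  by (metis det_rowmat transpose_rowmat det_transpose)

lemma prod_Basis_vec: "(\<Prod>b\<in>(Basis :: ('a::euclidean_space^'m) set). f b) = (\<Prod>i\<in>UNIV. \<Prod>b\<in>Basis. f (axis i b))"
proof -
  have "(Basis :: ('a^'m) set) = (\<Union>i\<in>UNIV. axis i ` Basis)" by (auto simp: Basis_vec_def)
  also have "prod f \<dots> = (\<Prod>i\<in>UNIV. prod f (axis i ` Basis))"
    by (rule prod.UNION_disjoint) (auto simp: axis_eq_axis nonzero_Basis)
  also have "\<dots> = (\<Prod>i\<in>UNIV. \<Prod>b\<in>Basis. f (axis i b))"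
    by (subst prod.reindex) (auto simp: inj_on_def axis_eq_axis)
  finally show ?thesis .
qed

lemma prod_Basis_matrix:
  fixes V :: "real^'n^'m"
  shows "(\<Prod>b\<in>Basis. V \<bullet> b) = (\<Prod>i\<in>UNIV. \<Prod>j\<in>UNIV. V $ i $ j)"
  by (simp add: prod_Basis_vec inner_axis)

lemma mem_box_matrix:
  fixes X :: "real^'n^'m"
  shows "X \<in> box l u \<longleftrightarrow> (\<forall>i j. l $ i $ j < X $ i $ j \<and> X $ i $ j < u $ i $ j)"
  by (simp add: mem_box Basis_vec_def inner_axis)

lemma measurable_matrixI:
  fixes f :: "'b \<Rightarrow> real^'n^'m"
  assumes "\<And>i j. (\<lambda>x. f x $ i $ j) \<in> borel_measurable M"
  shows "f \<in> borel_measurable M"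
  by (subst borel_measurable_euclidean_space) (auto simp: Basis_vec_def inner_axis assms)

lemma measurable_vecI:
  fixes f :: "'b \<Rightarrow> real^'n"
  assumes "\<And>i. (\<lambda>x. f x $ i) \<in> borel_measurable M"
  shows "f \<in> borel_measurable M"
  by (subst borel_measurable_euclidean_space) (auto simp: Basis_vec_def inner_axis assms)

lemma measurable_nth_vec [measurable]: "(\<lambda>x::'a::euclidean_space^'n. x $ i) \<in> borel_measurable borel"
  by (intro borel_measurable_continuous_onI continuous_intros)

abbreviation PN :: "(nat \<Rightarrow> real^'n) measure" where
  "PN \<equiv> PiM {..<CARD('n)} (\<lambda>_. lborel)"

lemma measurable_PN_component:
  fixes c r :: "'n::finite"
  shows "(\<lambda>x. x (idx c) $ r) \<in> borel_measurable (PN :: (nat \<Rightarrow> real^'n) measure)"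
proof -
  have "(\<lambda>x. x (idx (c::'n))) \<in> (PN :: (nat \<Rightarrow> real^'n) measure) \<rightarrow>\<^sub>M lborel"
    by (rule measurable_component_singleton) (simp add: idx_less)
  then have "(\<lambda>x. x (idx (c::'n))) \<in> (PN :: (nat \<Rightarrow> real^'n) measure) \<rightarrow>\<^sub>M borel" by simp
  from measurable_compose[OF this measurable_nth_vec] show ?thesis .
qed

lemma measurable_colmat [measurable]: "colmat \<in> borel_measurable PN"
  by (rule measurable_matrixI) (simp add: colmat_def measurable_PN_component)

lemma measurable_rowmat [measurable]: "rowmat \<in> borel_measurable PN"
  by (rule measurable_matrixI) (simp add: rowmat_def measurable_PN_component)

interpretation PNS: product_sigma_finite "\<lambda>_::nat. lborel :: (real^'n) measure"
  by standard

lemma emeasure_PN_box: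
  fixes l u :: "nat \<Rightarrow> real^'n"
  assumes "\<And>i j. i < CARD('n) \<Longrightarrow> l i $ j \<le> u i $ j"
  shows "emeasure PN (Pi\<^sub>E {..<CARD('n)} (\<lambda>i. box (l i) (u i))) = (\<Prod>i<CARD('n). \<Prod>j\<in>UNIV. u i $ j - l i $ j)"
proof -
  have "emeasure lborel (box (l i) (u i)) = ennreal (\<Prod>j\<in>UNIV. u i $ j - l i $ j)" if "i < CARD('n)" for i
  proof -
    have "emeasure lborel (box (l i) (u i)) = ennreal (\<Prod>b\<in>Basis. (u i - l i) \<bullet> b)"
      by (rule emeasure_lborel_box) (use assms[OF that] in \<open>auto simp: Basis_vec_def inner_axis\<close>)
    also have "(\<Prod>b\<in>Basis. (u i - l i) \<bullet> b) = (\<Prod>j\<in>UNIV. u i $ j - l i $ j)"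
      by (simp add: prod_Basis_vec inner_axis)
    finally show ?thesis .
  qed
  then show ?thesis
    by (subst PNS.emeasure_PiM) (auto simp: assms intro!: prod_ennreal prod_nonneg)
qed

text \<open>Lebesgue measure is determined by its values on boxes. Both this description and the one
  by columns are needed: right multiplication acts on each row separately, left multiplication on
  each column, and the columns are also the lattice basis vectors that get integrated out.\<close>

lemma lborel_rowmat: "(lborel :: (real^'n^'n) measure) = distr PN borel rowmat"
proof (rule lborel_eqI)
  fix l u :: "real^'n^'n"
  assume lu: "\<And>b. b \<in> Basis \<Longrightarrow> l \<bullet> b \<le> u \<bullet> b"
  have lu': "l $ i $ j \<le> u $ i $ j" for i j
    using lu[of "axis i (axis j 1)"] by (simp add: inner_axis)
  define ix where "ix = inv_into UNIV (idx :: 'n \<Rightarrow> nat)"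
  have ix: "ix (idx i) = i" for i by (simp add: ix_def inj_def inv_f_f)
  have "rowmat -` box l u \<inter> space PN = Pi\<^sub>E {..<CARD('n)} (\<lambda>i. box (l $ ix i) (u $ ix i))"
    by (rule set_eqI) (simp add: space_PiM PiE_iff mem_box_matrix mem_box_cart rowmat_def ix Ball_def all_idx conj_commute)
  then have "emeasure (distr PN borel rowmat) (box l u) = (\<Prod>i<CARD('n). \<Prod>j\<in>UNIV. u $ ix i $ j - l $ ix i $ j)"
    by (simp add: emeasure_distr emeasure_PN_box lu')
  also have "(\<Prod>i<CARD('n). \<Prod>j\<in>UNIV. u $ ix i $ j - l $ ix i $ j) = (\<Prod>b\<in>Basis. (u - l) \<bullet> b)"
    by (simp add: prod_Basis_matrix prod_idx[symmetric] ix)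
  finally show "emeasure (distr PN borel rowmat) (box l u) = ennreal (\<Prod>b\<in>Basis. (u - l) \<bullet> b)" .
qed simp

lemma lborel_colmat: "(lborel :: (real^'n^'n) measure) = distr PN borel colmat"
proof (rule lborel_eqI)
  fix l u :: "real^'n^'n"
  assume lu: "\<And>b. b \<in> Basis \<Longrightarrow> l \<bullet> b \<le> u \<bullet> b"
  have lu': "l $ i $ j \<le> u $ i $ j" for i j
    using lu[of "axis i (axis j 1)"] by (simp add: inner_axis)
  define ix where "ix = inv_into UNIV (idx :: 'n \<Rightarrow> nat)"
  have ix: "ix (idx i) = i" for i by (simp add: ix_def inj_def inv_f_f)
  have "colmat -` box l u \<inter> space PN = Pi\<^sub>E {..<CARD('n)} (\<lambda>i. box (transpose l $ ix i) (transpose u $ ix i))"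
    by (rule set_eqI) (simp add: space_PiM PiE_iff mem_box_matrix mem_box_cart colmat_def ix transpose_def Ball_def all_idx conj_commute, blast)
  then have "emeasure (distr PN borel colmat) (box l u) = (\<Prod>i<CARD('n). \<Prod>j\<in>UNIV. u $ j $ ix i - l $ j $ ix i)"
    by (simp add: emeasure_distr emeasure_PN_box lu' transpose_def)
  also have "(\<Prod>i<CARD('n). \<Prod>j\<in>UNIV. u $ j $ ix i - l $ j $ ix i) = (\<Prod>b\<in>Basis. (u - l) \<bullet> b)"
    by (simp add: prod_Basis_matrix prod_idx[symmetric] ix) (rule prod.swap)
  finally show "emeasure (distr PN borel colmat) (box l u) = ennreal (\<Prod>b\<in>Basis. (u - l) \<bullet> b)" .
qed simp

section \<open>Linear changes of variables for vectors and matrices\<close>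

lemma measurable_vec_lambda_PiM: "vec_lambda \<in> borel_measurable (PiM UNIV (\<lambda>_::'n::finite. lborel :: real measure))"
  by (rule measurable_vecI) simp

interpretation PVS: product_sigma_finite "\<lambda>_::'n::finite. lborel :: real measure"
  by standard

lemma lborel_vec: "(lborel :: (real^'n) measure) = distr (PiM UNIV (\<lambda>_. lborel)) borel vec_lambda"
proof (rule lborel_eqI)
  fix l u :: "real^'n"
  assume lu: "\<And>b. b \<in> Basis \<Longrightarrow> l \<bullet> b \<le> u \<bullet> b"
  have lu': "l $ i \<le> u $ i" for i
    using lu[of "axis i 1"] by (simp add: inner_axis)
  have "vec_lambda -` box l u \<inter> space (PiM UNIV (\<lambda>_::'n. lborel)) = Pi\<^sub>E UNIV (\<lambda>i. {l $ i<..<u $ i})"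
    by (auto simp: space_PiM PiE_iff mem_box_cart)
  then have "emeasure (distr (PiM UNIV (\<lambda>_::'n. lborel)) borel vec_lambda) (box l u) = (\<Prod>i\<in>UNIV. ennreal (u $ i - l $ i))"
    by (simp add: emeasure_distr measurable_vec_lambda_PiM PVS.emeasure_PiM lu')
  also have "\<dots> = ennreal (\<Prod>b\<in>Basis. (u - l) \<bullet> b)"
    by (simp add: prod_Basis_vec inner_axis prod_ennreal lu')
  finally show "emeasure (distr (PiM UNIV (\<lambda>_. lborel)) borel vec_lambda) (box l u) = ennreal (\<Prod>b\<in>Basis. (u - l) \<bullet> b)" .
qed simp

text \<open>With coordinate \<open>m\<close> integrated innermost, coordinate \<open>n\<close> is
  constant there and the shear becomes a translation of the real line.\<close>

lemma emeasure_lborel_shear: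
  fixes m n :: "'n::finite" and A :: "(real^'n) set"
  assumes mn: "m \<noteq> n" and A: "A \<in> sets borel"
  shows "emeasure lborel ((\<lambda>x. \<chi> i. if i = m then x$m + x$n else x$i) -` A) = emeasure lborel A"
proof -
  let ?f = "\<lambda>x::real^'n. (\<chi> i. if i = m then x$m + x$n else x$i) :: real^'n"
  let ?P = "PiM UNIV (\<lambda>_::'n. lborel :: real measure)"
  have f: "?f \<in> borel_measurable borel" by (rule measurable_vecI) simp
  have fA: "?f -` A \<in> sets borel" using measurable_sets[OF f A] by simp
  have I: "insert m (UNIV - {m}) = (UNIV :: 'n set)" by auto
  have *: "emeasure lborel B = (\<integral>\<^sup>+x. \<integral>\<^sup>+t. indicator B (vec_lambda (x(m := t))) \<partial>lborel \<partial>PiM (UNIV - {m}) (\<lambda>_. lborel))"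
    if B: "B \<in> sets borel" for B :: "(real^'n) set"
  proof -
    have "emeasure lborel B = (\<integral>\<^sup>+x. indicator B x \<partial>(lborel :: (real^'n) measure))" using B by simp
    also have "\<dots> = (\<integral>\<^sup>+x. indicator B (vec_lambda x) \<partial>?P)"
      using B by (subst lborel_vec, subst nn_integral_distr[OF measurable_vec_lambda_PiM]) simp_all
    also have "\<dots> = (\<integral>\<^sup>+x. \<integral>\<^sup>+t. indicator B (vec_lambda (x(m := t))) \<partial>lborel \<partial>PiM (UNIV - {m}) (\<lambda>_. lborel))"
      using PVS.product_nn_integral_insert[of "UNIV - {m}" m "\<lambda>x. indicator B (vec_lambda x)"]
        measurable_compose[OF measurable_vec_lambda_PiM borel_measurable_indicator[OF B]]
      by (simp add: I)
    finally show ?thesis .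
  qed
  have "(\<integral>\<^sup>+t. indicator (?f -` A) (vec_lambda (x(m := t))) \<partial>lborel) = (\<integral>\<^sup>+t. indicator A (vec_lambda (x(m := t))) \<partial>lborel)"
    for x :: "'n \<Rightarrow> real"
  proof -
    have "vec_lambda \<circ> (\<lambda>t. x(m := t)) \<in> borel_measurable (borel :: real measure)"
      by (rule measurable_vecI) simp
    from measurable_compose[OF this borel_measurable_indicator[OF A]]
    have "(\<integral>\<^sup>+t. indicator A (vec_lambda (x(m := t))) \<partial>lborel) = (\<integral>\<^sup>+t. indicator A (vec_lambda (x(m := x n + t))) \<partial>lborel)"
      using nn_integral_real_affine[of "\<lambda>t. indicator A (vec_lambda (x(m := t)))" 1 "x n"] by simp
    moreover have "?f (vec_lambda (x(m := t))) = vec_lambda (x(m := x n + t))" for t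
      using mn by (simp add: vec_eq_iff)
    ultimately show ?thesis by (simp add: indicator_def)
  qed
  then show ?thesis by (simp only: *[OF fA] *[OF A])
qed

lemma measurable_matrix_vector_mult [measurable]: "(\<lambda>x. (B::real^'n^'m) *v x) \<in> borel_measurable borel"
  by (intro borel_measurable_continuous_onI linear_continuous_on
      linear_conv_bounded_linear[THEN iffD1] matrix_vector_mul_linear)

lemma emeasure_lborel_permute:
  fixes A :: "(real^'n) set"
  assumes p: "p permutes UNIV" and A: "A \<in> sets borel"
  shows "emeasure lborel ((\<lambda>x. \<chi> i. x $ p i) -` A) = emeasure lborel A"
proof -
  let ?f = "\<lambda>x::real^'n. (\<chi> i. x $ p i) :: real^'n"
  have f: "?f \<in> borel_measurable borel" by (rule measurable_vecI) simp
  have bij: "bij p" using p by (rule permutes_bij)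
  have "lborel = distr lborel borel ?f"
  proof (rule lborel_eqI)
    fix l u :: "real^'n" assume lu: "\<And>b. b \<in> Basis \<Longrightarrow> l \<bullet> b \<le> u \<bullet> b"
    have lu': "l $ i \<le> u $ i" for i using lu[of "axis i 1"] by (simp add: inner_axis)
    let ?q = "inv p"
    have q: "p (?q i) = i" "?q (p i) = i" for i using bij by (simp_all add: bij_is_inj bij_is_surj surj_f_inv_f)
    have "?f -` box l u = box (\<chi> i. l $ ?q i) (\<chi> i. u $ ?q i)"
      by (auto simp: mem_box_cart) (metis q)+
    then have "emeasure (distr lborel borel ?f) (box l u) = ennreal (\<Prod>b\<in>Basis. ((\<chi> i. u $ ?q i) - (\<chi> i. l $ ?q i)) \<bullet> b)"
      using f by (simp add: emeasure_distr) (rule emeasure_lborel_box, auto simp: Basis_vec_def inner_axis lu')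
    also have "(\<Prod>b\<in>Basis. ((\<chi> i. u $ ?q i) - (\<chi> i. l $ ?q i)) \<bullet> b) = (\<Prod>i\<in>UNIV. u $ ?q i - l $ ?q i)"
      by (simp add: prod_Basis_vec inner_axis)
    also have "\<dots> = (\<Prod>i\<in>UNIV. u $ i - l $ i)"
      using prod.permute[OF permutes_inv[OF p], of "\<lambda>i. u $ i - l $ i"] by (simp add: o_def)
    also have "\<dots> = (\<Prod>b\<in>Basis. (u - l) \<bullet> b)" by (simp add: prod_Basis_vec inner_axis)
    finally show "emeasure (distr lborel borel ?f) (box l u) = ennreal (\<Prod>b\<in>Basis. (u - l) \<bullet> b)" .
  qed simp
  then have "emeasure lborel A = emeasure (distr lborel borel ?f) A" by simp
  also have "\<dots> = emeasure lborel (?f -` A)" using f A by (subst emeasure_distr) simp_all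
  finally show ?thesis by simp
qed

text \<open>Induction over a factorisation into diagonal matrices, transpositions and shears.
  Preimages are used because their Borel measurability is immediate, and the determinant stands as a
  factor so that nothing is divided in \<open>ennreal\<close>.\<close>

lemma emeasure_lborel_matrix_vimage:
  fixes B :: "real^'n^'n" and A :: "(real^'n) set"
  assumes B: "det B \<noteq> 0" and A: "A \<in> sets borel"
  shows "emeasure lborel ((\<lambda>x. B *v x) -` A) * ennreal \<bar>det B\<bar> = emeasure lborel A"
  using assms
proof (induction B arbitrary: A rule: induct_matrix_elementary_alt)
  case mult: (1 B C)
  have m: "(\<lambda>x. B *v x) -` A \<in> sets borel"
    using measurable_sets[OF measurable_matrix_vector_mult[of B] mult.prems(2)] by simp
  have "(\<lambda>x. (B ** C) *v x) -` A = (\<lambda>x. C *v x) -` ((\<lambda>x. B *v x) -` A)"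
    by (auto simp: matrix_vector_mul_assoc)
  then have "emeasure lborel ((\<lambda>x. (B ** C) *v x) -` A) * ennreal \<bar>det (B ** C)\<bar>
     = (emeasure lborel ((\<lambda>x. C *v x) -` ((\<lambda>x. B *v x) -` A)) * ennreal \<bar>det C\<bar>) * ennreal \<bar>det B\<bar>"
    by (simp add: det_mul abs_mult ennreal_mult mult_ac)
  also have "\<dots> = emeasure lborel A"
    using mult.prems m by (simp add: det_mul mult.IH)
  finally show ?case .
next
  case zero_row: (2 B i)
  then show ?case by (simp add: det_zero_row row_def)
next
  case diagonal: (3 B)
  have d: "det B = (\<Prod>i\<in>UNIV. B $ i $ i)" using diagonal(1) by (rule det_diagonal)
  then have nz: "B $ i $ i \<noteq> 0" for i using diagonal(2) by auto
  define C where "C b = b \<bullet> (B *v b)" for b :: "real^'n"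
  have Bx: "B *v x = (\<chi> i. B $ i $ i * x $ i)" for x
  proof (subst vec_eq_iff, rule allI)
    fix i
    have "(B *v x) $ i = (\<Sum>j\<in>UNIV. if j = i then B $ i $ i * x $ i else 0)"
      unfolding matrix_vector_mult_def vec_lambda_beta by (rule sum.cong) (auto simp: diagonal(1))
    then show "(B *v x) $ i = (\<chi> i. B $ i $ i * x $ i) $ i" by simp
  qed
  have c: "C (axis i 1) = B $ i $ i" for i by (simp add: C_def Bx inner_axis')
  have T: "B *v x = 0 + (\<Sum>j\<in>Basis. (C j * (x \<bullet> j)) *\<^sub>R j)" for x
  proof (rule euclidean_eqI)
    fix b :: "real^'n" assume b: "b \<in> Basis"
    then obtain i where i: "b = axis i 1" by (auto simp: Basis_vec_def)
    show "(B *v x) \<bullet> b = (0 + (\<Sum>j\<in>Basis. (C j * (x \<bullet> j)) *\<^sub>R j)) \<bullet> b"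
      using b by (simp add: inner_sum_left_Basis i c) (simp add: Bx inner_axis)
  qed
  have lb: "lborel = density (distr lborel borel (\<lambda>x. B *v x)) (\<lambda>_. (\<Prod>j\<in>Basis. \<bar>C j\<bar>))"
    unfolding T by (rule lborel_affine_euclidean[where c = C and t = 0]) (use nz in \<open>auto simp: Basis_vec_def c\<close>)
  have p: "(\<Prod>j\<in>Basis. \<bar>C j\<bar>) = \<bar>det B\<bar>"
    by (simp add: d abs_prod prod_Basis_vec c)
  have "emeasure lborel A = emeasure (density (distr lborel borel (\<lambda>x. B *v x)) (\<lambda>_. (\<Prod>j\<in>Basis. \<bar>C j\<bar>))) A"
    using lb by simp
  also have "\<dots> = emeasure lborel ((\<lambda>x. B *v x) -` A) * ennreal \<bar>det B\<bar>"
    using diagonal(3) by (simp add: p emeasure_density nn_integral_cmult_indicator emeasure_distr) (simp add: mult.commute)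
  finally show ?case by simp
next
  case swap1: (4 m n)
  let ?p = "Transposition.transpose m n"
  let ?B = "\<chi> i j. (mat 1 :: real^'n^'n) $ i $ ?p j"
  have p: "?p permutes UNIV" by (rule permutes_swap_id) auto
  have "?B *v x = (\<chi> i. x $ ?p i)" for x :: "real^'n"
  proof (subst vec_eq_iff, rule allI)
    fix i
    have "(?B *v x) $ i = (\<Sum>j\<in>UNIV. if j = ?p i then x $ ?p i else 0)"
      unfolding matrix_vector_mult_def vec_lambda_beta by (rule sum.cong) (auto simp: mat_def)
    then show "(?B *v x) $ i = (\<chi> i. x $ ?p i) $ i" by simp
  qed
  moreover have "\<bar>det ?B\<bar> = 1"
    using det_permute_columns[OF p, of "mat 1 :: real^'n^'n"] by (simp add: sign_def)
  ultimately show ?case using emeasure_lborel_permute[OF p swap1(3)] by simp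
next
  case idplus: (5 m n)
  let ?B = "(\<chi> i j. of_bool (i = m \<and> j = n \<or> i = j)) :: real^'n^'n"
  have "?B *v x = (\<chi> i. if i = m then x$m + x$n else x$i)" for x :: "real^'n"
  proof (subst vec_eq_iff, rule allI)
    fix i
    have "(?B *v x) $ i = (\<Sum>j\<in>UNIV. (if j = i then x $ i else 0) + (if j = n then (if i = m then x $ n else 0) else 0))"
      unfolding matrix_vector_mult_def vec_lambda_beta using idplus(1) by (intro sum.cong) auto
    then show "(?B *v x) $ i = (\<chi> i. if i = m then x$m + x$n else x$i) $ i"
      by (simp add: sum.distrib)
  qed
  moreover have "det ?B = 1"
  proof -
    have "?B = (\<chi> k. if k = m then row m (mat 1) + 1 *s row n (mat 1) else row k (mat 1))"
      using idplus(1) by (auto simp: vec_eq_iff row_def mat_def)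
    then show ?thesis using det_row_operation[OF idplus(1), of "mat 1 :: real^'n^'n" 1] by simp
  qed
  ultimately show ?case using emeasure_lborel_shear[OF idplus(1,3)] by simp
qed

lemma emeasure_PN_matrix_vimage:
  fixes B :: "real^'n^'n" and F :: "(nat \<Rightarrow> real^'n) set"
  assumes B: "det B \<noteq> 0" and F: "F \<in> sets PN"
  shows "emeasure PN ((\<lambda>x. \<lambda>i\<in>{..<CARD('n)}. B *v x i) -` F \<inter> space PN) * ennreal (\<bar>det B\<bar> ^ CARD('n)) = emeasure PN F"
proof -
  let ?N = "CARD('n)"
  let ?f = "\<lambda>x. \<lambda>i\<in>{..<?N}. B *v x i"
  have f [measurable]: "?f \<in> PN \<rightarrow>\<^sub>M PN"
  proof (rule measurable_restrict)
    fix i assume "i \<in> {..<?N}"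
    then have "(\<lambda>x. x i) \<in> (PN :: (nat \<Rightarrow> real^'n) measure) \<rightarrow>\<^sub>M borel"
      using measurable_component_singleton[of i "{..<?N}" "\<lambda>_. lborel"] by simp
    from measurable_compose[OF this measurable_matrix_vector_mult[of B]]
    show "(\<lambda>x. B *v x i) \<in> (PN :: (nat \<Rightarrow> real^'n) measure) \<rightarrow>\<^sub>M lborel" by simp
  qed
  define P where "P = scale_measure (ennreal (\<bar>det B\<bar> ^ ?N)) (distr PN PN ?f)"
  have P: "emeasure P S = ennreal (\<bar>det B\<bar> ^ ?N) * emeasure PN (?f -` S \<inter> space PN)" if "S \<in> sets PN" for S
    using that by (simp add: P_def emeasure_distr)
  have "P = PN"
  proof (rule PNS.PiM_eqI)
    fix A :: "nat \<Rightarrow> (real^'n) set" assume A: "\<And>i. i \<in> {..<?N} \<Longrightarrow> A i \<in> sets lborel"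
    have "?f -` Pi\<^sub>E {..<?N} A \<inter> space PN = Pi\<^sub>E {..<?N} (\<lambda>i. (\<lambda>x. B *v x) -` A i)"
      by (auto simp: space_PiM PiE_iff)
    moreover have "(\<lambda>x. B *v x) -` A i \<in> sets lborel" if "i \<in> {..<?N}" for i
      using measurable_sets[OF measurable_matrix_vector_mult[of B], of "A i"] A[OF that] by simp
    ultimately have "emeasure P (Pi\<^sub>E {..<?N} A) = ennreal (\<bar>det B\<bar> ^ ?N) * (\<Prod>i<?N. emeasure lborel ((\<lambda>x. B *v x) -` A i))"
      using A PNS.emeasure_PiM[of "{..<?N}" "\<lambda>i. (\<lambda>x. B *v x) -` A i"]
      by (subst P) (auto intro!: sets_PiM_I_finite)
    also have "\<dots> = (\<Prod>i<?N. ennreal \<bar>det B\<bar> * emeasure lborel ((\<lambda>x. B *v x) -` A i))"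
      by (simp add: prod.distrib ennreal_power)
    also have "\<dots> = (\<Prod>i<?N. emeasure lborel (A i))"
      using A by (intro prod.cong refl, subst emeasure_lborel_matrix_vimage[OF B, symmetric]) (auto simp: mult.commute)
    finally show "emeasure P (Pi\<^sub>E {..<?N} A) = (\<Prod>i\<in>{..<?N}. emeasure lborel (A i))" .
  qed (simp_all add: P_def)
  then show ?thesis using P[OF F] by (simp add: mult.commute)
qed

lemma measurable_matrix_mult_right [measurable]: "(\<lambda>X. X ** (B::real^'n^'n)) \<in> borel_measurable borel"
  by (rule measurable_matrixI) (simp add: matrix_matrix_mult_def)

lemma measurable_matrix_mult_left [measurable]: "(\<lambda>X. (B::real^'n^'n) ** X) \<in> borel_measurable borel"
  by (rule measurable_matrixI) (simp add: matrix_matrix_mult_def)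

text \<open>Common core of left and right multiplication: \<open>\<phi>\<close> assembles a matrix
  from its rows or columns, and \<open>\<rho>\<close> is what applying \<open>B\<close> to each of
  these vectors becomes on matrices. The N vectors account for the N-th power of the
  determinant.\<close>

lemma emeasure_lborel_PN_linear:
  fixes B :: "real^'n^'n" and F :: "(real^'n^'n) set" and \<phi> :: "(nat \<Rightarrow> real^'n) \<Rightarrow> real^'n^'n"
  assumes lb: "lborel = distr PN borel \<phi>" and \<phi>: "\<phi> \<in> borel_measurable PN" and \<rho>: "\<rho> \<in> borel_measurable borel"
    and lin: "\<And>x. \<phi> (\<lambda>i\<in>{..<CARD('n)}. B *v x i) = \<rho> (\<phi> x)"
    and B: "det B \<noteq> 0" and F: "F \<in> sets borel"
  shows "emeasure lborel (\<rho> -` F) * ennreal (\<bar>det B\<bar> ^ CARD('n)) = emeasure lborel F"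
proof -
  let ?f = "\<lambda>x. \<lambda>i\<in>{..<CARD('n)}. B *v x i"
  have e: "emeasure lborel G = emeasure PN (\<phi> -` G \<inter> space PN)" if "G \<in> sets borel" for G
    using that \<phi> by (subst lb) (simp add: emeasure_distr)
  have v: "\<rho> -` F \<in> sets borel" using measurable_sets[OF \<rho> F] by simp
  have "\<phi> -` (\<rho> -` F) \<inter> space PN = ?f -` (\<phi> -` F \<inter> space PN) \<inter> space PN"
    using lin by (auto simp: space_PiM)
  then show ?thesis
    using emeasure_PN_matrix_vimage[OF B measurable_sets[OF \<phi> F]] by (simp add: e[OF v] e[OF F])
qed

lemma emeasure_lborel_matrix_mult_right:
  fixes B :: "real^'n^'n" and F :: "(real^'n^'n) set"
  assumes "det B \<noteq> 0" and "F \<in> sets borel"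
  shows "emeasure lborel ((\<lambda>X. X ** B) -` F) * ennreal (\<bar>det B\<bar> ^ CARD('n)) = emeasure lborel F"
proof -
  have "rowmat (\<lambda>i\<in>{..<CARD('n)}. transpose B *v x i) = rowmat x ** B" for x
    by (simp add: vec_eq_iff rowmat_def matrix_matrix_mult_def matrix_vector_mult_def transpose_def idx_less mult.commute)
  from emeasure_lborel_PN_linear[OF lborel_rowmat measurable_rowmat measurable_matrix_mult_right this] assms
  show ?thesis by (simp add: det_transpose)
qed

lemma emeasure_lborel_matrix_mult_left:
  fixes B :: "real^'n^'n" and F :: "(real^'n^'n) set"
  assumes "det B \<noteq> 0" and "F \<in> sets borel"
  shows "emeasure lborel ((\<lambda>X. B ** X) -` F) * ennreal (\<bar>det B\<bar> ^ CARD('n)) = emeasure lborel F"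
proof -
  have "colmat (\<lambda>i\<in>{..<CARD('n)}. B *v x i) = B ** colmat x" for x
    by (simp add: vec_eq_iff colmat_def matrix_matrix_mult_def matrix_vector_mult_def idx_less)
  from emeasure_lborel_PN_linear[OF lborel_colmat measurable_colmat measurable_matrix_mult_left this assms]
  show ?thesis .
qed

section \<open>Invariance of Haar measure under inversion\<close>

lemma SO_transpose: "g \<in> SO \<Longrightarrow> transpose g \<in> SO"
  by (simp add: SO_def orthogonal_matrix_transpose)

lemma haar_SO_AE: "haar_SO M \<Longrightarrow> AE g in M. g \<in> SO"
  unfolding haar_SO_def by (intro prob_space.AE_prob_1) (auto simp: measure_def)

lemma measurable_transpose_mult:
  "(\<lambda>p. transpose (fst p) ** snd p :: real^'n^'n) \<in> borel_measurable (borel \<Otimes>\<^sub>M borel)"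
  by (rule measurable_matrixI) (simp add: matrix_matrix_mult_def transpose_def)

lemma measurable_transpose: "(transpose :: real^'n^'n \<Rightarrow> real^'n^'n) \<in> borel_measurable borel"
  by (rule measurable_matrixI) (simp add: transpose_def)

text \<open>Evaluate the double integral of the indicator of \<open>A\<close> at
  \<open>transpose h ** g\<close> in both orders. For fixed \<open>h\<close>, left invariance in
  \<open>g\<close> gives the measure of \<open>A\<close>; for fixed \<open>g\<close>, left
  invariance in \<open>h\<close> gives that of the preimage under transposition. It is needed
  because the points of \<open>g T\<close> are tested by applying the inverse of \<open>g\<close>,
  whereas the later argument multiplies on the left.\<close>

lemma haar_SO_transpose:
  fixes M :: "(real^'n^'n) measure"
  assumes M: "haar_SO M" and A: "A \<in> sets borel"
  shows "emeasure M (transpose -` A) = emeasure M A"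
proof -
  interpret M: prob_space M using M by (simp add: haar_SO_def)
  interpret MM: pair_sigma_finite M M ..
  have sets [measurable_cong]: "sets M = sets borel" using M by (simp add: haar_SO_def)
  have inv: "emeasure M ((\<lambda>g. h ** g) -` B) = emeasure M B" if "h \<in> SO" "B \<in> sets borel" for h B
    using M that sets by (simp add: haar_SO_def)
  have tA: "transpose -` A \<in> sets borel" using measurable_sets[OF measurable_transpose A] by simp
  have sp: "space M = UNIV" using sets_eq_imp_space_eq[OF sets] by simp
  have Q: "(\<lambda>p. indicator A (transpose (fst p) ** snd p) :: ennreal) \<in> borel_measurable (M \<Otimes>\<^sub>M M)"
    using measurable_transpose_mult A
    by (intro measurable_compose[OF _ borel_measurable_indicator[OF A]])
       (simp add: measurable_cong_sets[OF sets_pair_measure_cong[OF sets sets] refl])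
  have AE: "AE g in M. g \<in> SO" by (rule haar_SO_AE[OF M])
  have "emeasure M A = (\<integral>\<^sup>+h. emeasure M A \<partial>M)" by (simp add: M.emeasure_space_1)
  also have "\<dots> = (\<integral>\<^sup>+h. \<integral>\<^sup>+g. indicator A (transpose h ** g) \<partial>M \<partial>M)"
  proof (rule nn_integral_cong_AE, use AE in eventually_elim)
    fix h :: "real^'n^'n" assume h: "h \<in> SO"
    have m: "(\<lambda>g. transpose h ** g) -` A \<in> sets M"
      using measurable_sets[OF measurable_matrix_mult_left[of "transpose h"] A] sets by simp
    have "(\<integral>\<^sup>+g. indicator A (transpose h ** g) \<partial>M) = (\<integral>\<^sup>+g. indicator ((\<lambda>g. transpose h ** g) -` A) g \<partial>M)"
      by (simp add: indicator_def)
    also have "\<dots> = emeasure M A" using m inv[OF SO_transpose[OF h] A] by simp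
    finally show "emeasure M A = (\<integral>\<^sup>+g. indicator A (transpose h ** g) \<partial>M)" by simp
  qed
  also have "\<dots> = (\<integral>\<^sup>+g. \<integral>\<^sup>+h. indicator A (transpose h ** g) \<partial>M \<partial>M)"
    using MM.Fubini'[of "\<lambda>h g. indicator A (transpose h ** g)"] Q by (simp add: split_beta')
  also have "\<dots> = (\<integral>\<^sup>+g. emeasure M (transpose -` A) \<partial>M)"
  proof (rule nn_integral_cong_AE, use AE in eventually_elim)
    fix g :: "real^'n^'n" assume g: "g \<in> SO"
    have m: "(\<lambda>h. transpose g ** h) -` (transpose -` A) \<in> sets M"
      using measurable_sets[OF measurable_matrix_mult_left[of "transpose g"] tA] sets by simp
    have "(\<integral>\<^sup>+h. indicator A (transpose h ** g) \<partial>M) = (\<integral>\<^sup>+h. indicator ((\<lambda>h. transpose g ** h) -` (transpose -` A)) h \<partial>M)"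
      by (simp add: indicator_def matrix_transpose_mul)
    also have "\<dots> = emeasure M (transpose -` A)" using m inv[OF SO_transpose[OF g] tA] by simp
    finally show "(\<integral>\<^sup>+h. indicator A (transpose h ** g) \<partial>M) = emeasure M (transpose -` A)" by simp
  qed
  also have "\<dots> = emeasure M (transpose -` A)" by (simp add: M.emeasure_space_1)
  finally show ?thesis by simp
qed

section \<open>The measure of the set of reduced bases\<close>

lemma orthogonal_matrix_rowmat:
  fixes u :: "nat \<Rightarrow> real^'n"
  assumes "\<And>i. i < CARD('n) \<Longrightarrow> norm (u i) = 1"
    and "\<And>i j. i < CARD('n) \<Longrightarrow> j < CARD('n) \<Longrightarrow> i \<noteq> j \<Longrightarrow> u i \<bullet> u j = 0"
  shows "orthogonal_matrix (rowmat u)"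
  by (simp add: orthogonal_matrix_orthonormal_rows row_rowmat assms idx_less orthogonal_def)

lemma rowmat_mult_vec: "(rowmat u *v y) $ c = u (idx c) \<bullet> y"
  by (simp add: rowmat_def matrix_vector_mult_def inner_vec_def)

lemma emeasure_rotated_box:
  fixes u :: "nat \<Rightarrow> real^'n" and s :: "nat \<Rightarrow> real"
  assumes u: "\<And>i. i < CARD('n) \<Longrightarrow> norm (u i) = 1"
    "\<And>i j. i < CARD('n) \<Longrightarrow> j < CARD('n) \<Longrightarrow> i \<noteq> j \<Longrightarrow> u i \<bullet> u j = 0"
    and s: "\<And>i. i < CARD('n) \<Longrightarrow> 0 \<le> s i"
  shows "emeasure lborel {y. \<forall>i<CARD('n). \<bar>u i \<bullet> y\<bar> \<le> s i} = ennreal (2 ^ CARD('n) * (\<Prod>i<CARD('n). s i))"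
proof -
  let ?Q = "rowmat u" and ?b = "(\<chi> c. s (idx c)) :: real^'n"
  have "orthogonal_matrix ?Q" by (rule orthogonal_matrix_rowmat) (use u in auto)
  then have "\<bar>det ?Q\<bar> = 1" using det_orthogonal_matrix by force
  then have "emeasure lborel ((\<lambda>y. ?Q *v y) -` cbox (- ?b) ?b) = emeasure lborel (cbox (- ?b) ?b)"
    using emeasure_lborel_matrix_vimage[of ?Q "cbox (- ?b) ?b"] by auto
  moreover have "(\<lambda>y. ?Q *v y) -` cbox (- ?b) ?b = {y. \<forall>i<CARD('n). \<bar>u i \<bullet> y\<bar> \<le> s i}"
    by (auto simp: mem_box_cart rowmat_mult_vec all_idx abs_le_iff minus_le_iff)
  moreover have "emeasure lborel (cbox (- ?b) ?b) = ennreal (\<Prod>b\<in>Basis. (?b - (- ?b)) \<bullet> b)"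
    by (rule emeasure_lborel_cbox) (auto simp: Basis_vec_def inner_axis s idx_less)
  moreover have "(\<Prod>b\<in>Basis. (?b - (- ?b)) \<bullet> b) = 2 ^ CARD('n) * (\<Prod>i<CARD('n). s i)"
    by (simp add: prod_Basis_vec inner_axis prod.distrib prod_idx)
  ultimately show ?thesis by simp
qed

text \<open>The m-dimensional volume of the parallelepiped spanned by the first \<open>m\<close>
  vectors, i.e. the covolume of the lattice they generate when they are independent.\<close>

definition gprod :: "(nat \<Rightarrow> 'a::real_inner) \<Rightarrow> nat \<Rightarrow> real" where
  "gprod x m = (\<Prod>j<m. norm (gs x j))"

lemma gprod_Suc: "gprod x (Suc m) = gprod x m * norm (gs x m)"
  by (simp add: gprod_def)

lemma gprod_nonneg: "0 \<le> gprod x m" by (simp add: gprod_def prod_nonneg)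

lemma gprod_pos: "(\<And>j. j < m \<Longrightarrow> gs x j \<noteq> 0) \<Longrightarrow> 0 < gprod x m" by (auto simp: gprod_def intro!: prod_pos)

lemma gprod_cong: "(\<And>j. j < m \<Longrightarrow> x j = y j) \<Longrightarrow> gprod x m = gprod y m"
  unfolding gprod_def by (intro prod.cong refl arg_cong[of _ _ norm] gs_cong) auto

text \<open>In an orthonormal frame extending the normalised vectors \<open>gs x j\<close>, the set
  lies in a box: half-side \<open>norm (gs x j)\<close> in the first \<open>i\<close> directions,
  half-side \<open>R\<close> in the remaining ones. The ball of radius \<open>R\<close> is simply
  replaced by its enclosing cube.\<close>

lemma emeasure_gs_slab:
  fixes x :: "nat \<Rightarrow> real^'n"
  assumes x: "\<And>j. j < i \<Longrightarrow> gs x j \<noteq> 0" and i: "i \<le> CARD('n)" and R: "0 \<le> R"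
  shows "emeasure lborel {y. (\<forall>j<i. \<bar>y \<bullet> gs x j\<bar> \<le> (norm (gs x j))\<^sup>2) \<and> norm (gs_perp x i y) \<le> R}
    \<le> ennreal (2 ^ CARD('n) * gprod x i * R ^ (CARD('n) - i))"
proof -
  let ?N = "CARD('n)"
  obtain z where z: "\<And>j. j < i \<Longrightarrow> z j = x j" and z0: "\<And>j. j < ?N \<Longrightarrow> gs z j \<noteq> 0"
    using ex_gs_extension[of i x] x i by auto
  have gz: "gs z j = gs x j" if "j < i" for j using z that by (intro gs_cong) auto
  have pz: "gs_perp z i y = gs_perp x i y" for y using z by (intro gs_perp_cong) auto
  define u where "u j = gs z j /\<^sub>R norm (gs z j)" for j
  define s where "s j = (if j < i then norm (gs x j) else R)" for j
  have u1: "norm (u j) = 1" if "j < ?N" for j using z0[OF that] by (simp add: u_def)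
  have u2: "u j \<bullet> u l = 0" if "j < ?N" "l < ?N" "j \<noteq> l" for j l using gs_orth[OF that(3), of z] by (simp add: u_def)
  have "{y. (\<forall>j<i. \<bar>y \<bullet> gs x j\<bar> \<le> (norm (gs x j))\<^sup>2) \<and> norm (gs_perp x i y) \<le> R}
     \<subseteq> {y. \<forall>j<?N. \<bar>u j \<bullet> y\<bar> \<le> s j}"
  proof (clarify)
    fix y j assume y: "\<forall>j<i. \<bar>y \<bullet> gs x j\<bar> \<le> (norm (gs x j))\<^sup>2" "norm (gs_perp x i y) \<le> R" and j: "j < ?N"
    show "\<bar>u j \<bullet> y\<bar> \<le> s j"
    proof (cases "j < i")
      case True
      then have "\<bar>u j \<bullet> y\<bar> = \<bar>y \<bullet> gs x j\<bar> / norm (gs x j)"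
        by (simp add: u_def gz inner_commute abs_mult divide_inverse mult.commute)
      also have "\<dots> \<le> norm (gs x j)" using y(1) True x[OF True] by (simp add: divide_le_eq power2_eq_square)
      finally show ?thesis using True by (simp add: s_def)
    next
      case False
      have "y \<bullet> gs z j = gs_perp z i y \<bullet> gs z j + (\<Sum>l<i. (y \<bullet> gs z l / (gs z l \<bullet> gs z l)) *\<^sub>R gs z l) \<bullet> gs z j"
        unfolding inner_add_left[symmetric] gs_perp_decomp[symmetric] ..
      also have "(\<Sum>l<i. (y \<bullet> gs z l / (gs z l \<bullet> gs z l)) *\<^sub>R gs z l) \<bullet> gs z j = 0"
        using False by (auto simp: inner_sum_left gs_orth intro!: sum.neutral)
      finally have "u j \<bullet> y = u j \<bullet> gs_perp x i y" by (simp add: u_def pz inner_commute)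
      also have "\<bar>\<dots>\<bar> \<le> norm (u j) * norm (gs_perp x i y)" by (rule Cauchy_Schwarz_ineq2)
      also have "\<dots> \<le> R" using u1[OF j] y(2) by simp
      finally show ?thesis using False by (simp add: s_def)
    qed
  qed
  then have "emeasure lborel {y. (\<forall>j<i. \<bar>y \<bullet> gs x j\<bar> \<le> (norm (gs x j))\<^sup>2) \<and> norm (gs_perp x i y) \<le> R}
     \<le> emeasure lborel {y. \<forall>j<?N. \<bar>u j \<bullet> y\<bar> \<le> s j}"
    by (intro emeasure_mono) auto
  also have "\<dots> = ennreal (2 ^ ?N * (\<Prod>j<?N. s j))"
    using R by (intro emeasure_rotated_box u1 u2) (auto simp: s_def)
  also have "(\<Prod>j<?N. s j) = (\<Prod>j<i. s j) * (\<Prod>j\<in>{i..<?N}. s j)"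
    using i by (subst prod.union_disjoint[symmetric]) (auto simp: ivl_disj_un)
  also have "(\<Prod>j<i. s j) = gprod x i" by (simp add: gprod_def s_def)
  also have "(\<Prod>j\<in>{i..<?N}. s j) = R ^ (?N - i)" by (simp add: s_def)
  finally show ?thesis by (simp add: mult.assoc)
qed

text \<open>Dyadic decomposition. Where \<rho> lies between R/2^(j+1) and R/2^j, the integrand is at
  most \<open>c j\<close>, and the measure there is at most that of the sublevel set
  \<open>T j\<close>. The resulting terms decay like 2^-(j(m-s)), and \<open>s < m\<close> makes
  this at most 2^-j. The constant collects 2^s from the ratio of a shell and 2 from the geometric
  series.\<close>

lemma nn_integral_inverse_power_le:
  fixes \<rho> :: "'b \<Rightarrow> real"
  assumes \<rho>: "\<rho> \<in> borel_measurable M" and S: "S \<in> sets M"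
    and bound: "\<And>t. 0 \<le> t \<Longrightarrow> emeasure M {y \<in> S. \<rho> y \<le> t} \<le> ennreal (A * t ^ m)"
    and A: "0 \<le> A" and R: "0 < R" and sm: "s < m"
  shows "(\<integral>\<^sup>+y. ennreal (inverse (\<rho> y ^ s)) * indicator {y \<in> S. 0 < \<rho> y \<and> \<rho> y \<le> R} y \<partial>M)
     \<le> ennreal (2 ^ Suc s * A * R ^ (m - s))"
proof -
  define T where "T j = {y \<in> S. \<rho> y \<le> R / 2 ^ j}" for j :: nat
  have T: "T j \<in> sets M" for j
  proof -
    have "T j = S \<inter> {y \<in> space M. \<rho> y \<le> R / 2 ^ j}" using sets.sets_into_space[OF S] by (auto simp: T_def)
    then show ?thesis using \<rho> S by simp
  qed
  define c where "c j = (2 ^ Suc j / R) ^ s" for j :: nat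
  have pw: "ennreal (inverse (\<rho> y ^ s)) * indicator {y \<in> S. 0 < \<rho> y \<and> \<rho> y \<le> R} y
     \<le> (\<Sum>j. ennreal (c j) * indicator (T j) y)" for y
  proof (cases "y \<in> S \<and> 0 < \<rho> y \<and> \<rho> y \<le> R")
    case True
    have "\<exists>j. R / 2 ^ Suc j < \<rho> y"
    proof -
      obtain j where "R / \<rho> y < 2 ^ j" using real_arch_pow[of 2 "R / \<rho> y"] by auto
      then have "R < 2 ^ j * \<rho> y" using True by (simp add: divide_less_eq)
      moreover have "0 < 2 ^ j * \<rho> y" using True by simp
      ultimately have "R / 2 ^ Suc j < \<rho> y" by (simp add: field_simps)
      then show ?thesis ..
    qed
    define j where "j = (LEAST j. R / 2 ^ Suc j < \<rho> y)"
    have j1: "R / 2 ^ Suc j < \<rho> y" unfolding j_def using \<open>\<exists>j. _\<close> by (rule LeastI_ex)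
    have j2: "\<rho> y \<le> R / 2 ^ j"
    proof (cases j)
      case 0 then show ?thesis using True by simp
    next
      case (Suc l)
      then have "\<not> R / 2 ^ Suc l < \<rho> y" using not_less_Least[of l "\<lambda>j. R / 2 ^ Suc j < \<rho> y"] by (simp add: j_def)
      then show ?thesis using Suc by simp
    qed
    have "inverse (\<rho> y) \<le> 2 ^ Suc j / R"
      using j1 True R by (simp add: field_simps)
    then have "inverse (\<rho> y ^ s) \<le> c j"
      unfolding c_def power_inverse[symmetric] using True by (intro power_mono) auto
    then have "ennreal (inverse (\<rho> y ^ s)) * indicator {y \<in> S. 0 < \<rho> y \<and> \<rho> y \<le> R} y \<le> ennreal (c j) * indicator (T j) y"
      using True j2 by (simp add: T_def ennreal_leI)
    also have "\<dots> \<le> (\<Sum>j. ennreal (c j) * indicator (T j) y)"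
    proof -
      define f where "f j = ennreal (c j) * indicator (T j) y" for j
      have "f j \<le> suminf f" using sum_le_suminf[OF summableI, of "{j}" f] by simp
      then show ?thesis by (simp add: f_def[abs_def])
    qed
    finally show ?thesis .
  qed auto
  have cA: "ennreal (c j) * emeasure M (T j) \<le> ennreal (2 ^ s * A * R ^ (m - s) * (1/2) ^ j)" for j
  proof -
    have "ennreal (c j) * emeasure M (T j) \<le> ennreal (c j) * ennreal (A * (R / 2 ^ j) ^ m)"
      unfolding T_def using R by (intro mult_left_mono bound) auto
    also have "\<dots> = ennreal (c j * (A * (R / 2 ^ j) ^ m))" using R A by (simp add: c_def ennreal_mult)
    also have "c j * (A * (R / 2 ^ j) ^ m) = 2 ^ s * A * R ^ (m - s) * ((1/2) ^ j) ^ (m - s)"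
    proof -
      have e1: "(R / 2 ^ j) ^ m = (R / 2 ^ j) ^ s * (R / 2 ^ j) ^ (m - s)" using sm by (simp add: power_add[symmetric])
      have e2: "c j * (R / 2 ^ j) ^ s = 2 ^ s"
        unfolding c_def power_mult_distrib[symmetric] using R by simp
      have "R / 2 ^ j = R * (1/2) ^ j" by (simp add: power_one_over)
      then have e3: "(R / 2 ^ j) ^ (m - s) = R ^ (m - s) * ((1/2) ^ j) ^ (m - s)" by (simp only: power_mult_distrib)
      have "c j * (A * (R / 2 ^ j) ^ m) = (c j * (R / 2 ^ j) ^ s) * (A * (R / 2 ^ j) ^ (m - s))"
        by (simp only: e1 mult_ac)
      then show ?thesis by (simp only: e2 e3 mult_ac)
    qed
    also have "\<dots> \<le> 2 ^ s * A * R ^ (m - s) * (1/2) ^ j"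
    proof -
      have "((1/2::real) ^ j) ^ (m - s) \<le> ((1/2) ^ j) ^ 1" using sm by (intro power_decreasing) (auto simp: power_le_one)
      then show ?thesis using A R by (intro mult_left_mono) auto
    qed
    finally show ?thesis by (simp add: ennreal_leI)
  qed
  have "(\<integral>\<^sup>+y. ennreal (inverse (\<rho> y ^ s)) * indicator {y \<in> S. 0 < \<rho> y \<and> \<rho> y \<le> R} y \<partial>M)
     \<le> (\<integral>\<^sup>+y. (\<Sum>j. ennreal (c j) * indicator (T j) y) \<partial>M)"
    by (intro nn_integral_mono pw)
  also have "\<dots> = (\<Sum>j. \<integral>\<^sup>+y. ennreal (c j) * indicator (T j) y \<partial>M)"
    using T by (intro nn_integral_suminf) auto
  also have "\<dots> = (\<Sum>j. ennreal (c j) * emeasure M (T j))"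
    using T by (simp add: nn_integral_cmult_indicator)
  also have "\<dots> \<le> (\<Sum>j. ennreal (2 ^ s * A * R ^ (m - s) * (1/2) ^ j))"
    by (intro suminf_le cA summableI)
  also have "\<dots> = ennreal (\<Sum>j. 2 ^ s * A * R ^ (m - s) * (1/2) ^ j)"
    using A R by (intro suminf_ennreal2) (auto intro!: summable_mult)
  also have "(\<Sum>j. 2 ^ s * A * R ^ (m - s) * (1/2) ^ j) = 2 ^ Suc s * A * R ^ (m - s)"
    by (subst suminf_mult) (auto simp: suminf_geometric)
  finally show ?thesis .
qed

section \<open>Iterated integration over reduced bases\<close>

lemma measurable_gs:
  fixes i m :: nat
  assumes "i < m"
  shows "(\<lambda>x. gs x i) \<in> borel_measurable (PiM {..<m} (\<lambda>_. lborel :: 'a::euclidean_space measure))"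
  using assms
proof (induction i rule: less_induct)
  case (less i)
  have x: "(\<lambda>x. x i) \<in> borel_measurable (PiM {..<m} (\<lambda>_. lborel :: 'a measure))"
    using measurable_component_singleton[of i "{..<m}" "\<lambda>_. lborel :: 'a measure"] less.prems by simp
  have g: "(\<lambda>x. gs x j) \<in> borel_measurable (PiM {..<m} (\<lambda>_. lborel :: 'a measure))" if "j \<in> {..<i}" for j
    using less.IH[of j] less.prems that by simp
  show ?case
    by (subst gs.simps, intro borel_measurable_diff x borel_measurable_sum borel_measurable_scaleR
        borel_measurable_divide borel_measurable_inner g) assumption+
qed

lemma measurable_gprod:
  "k \<le> m \<Longrightarrow> (\<lambda>x. gprod x k) \<in> borel_measurable (PiM {..<m} (\<lambda>_. lborel :: 'a::euclidean_space measure))"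
  unfolding gprod_def by (intro borel_measurable_prod measurable_compose[OF measurable_gs borel_measurable_norm]) auto

text \<open>The last condition replaces the joint constraint \<open>gprod x e \<le> q\<close> on a basis with almost increasing
  Gram-Schmidt lengths by constraints that each involve only the vectors up to \<open>i\<close>, so that the vectors can
  be integrated out one at a time.\<close>

definition red_at :: "real \<Rightarrow> nat \<Rightarrow> (nat \<Rightarrow> 'a::real_inner) \<Rightarrow> nat \<Rightarrow> bool" where
  "red_at q e x i \<longleftrightarrow> 0 < norm (gs x i) \<and> (\<forall>j<i. \<bar>x i \<bullet> gs x j\<bar> \<le> (norm (gs x j))\<^sup>2)
     \<and> gprod x i * norm (gs x i) ^ (e - i) \<le> q"

lemma red_at_cong:
  assumes "\<And>j. j \<le> i \<Longrightarrow> x j = y j"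
  shows "red_at q e x i = red_at q e y i"
proof -
  have "gs x j = gs y j" if "j \<le> i" for j using assms that by (intro gs_cong) auto
  moreover have "gprod x i = gprod y i" using assms by (intro gprod_cong) auto
  ultimately show ?thesis using assms[of i] by (auto simp: red_at_def)
qed

lemma measurable_red_at:
  assumes "i < m"
  shows "{x \<in> space (PiM {..<m} (\<lambda>_. lborel)). red_at q e (x :: nat \<Rightarrow> 'a::euclidean_space) i}
    \<in> sets (PiM {..<m} (\<lambda>_. lborel :: 'a measure))"
proof -
  let ?P = "PiM {..<m} (\<lambda>_. lborel :: 'a measure)"
  have x: "(\<lambda>x. x i) \<in> borel_measurable ?P"
    using measurable_component_singleton[of i "{..<m}" "\<lambda>_. lborel :: 'a measure"] assms by simp
  have g: "(\<lambda>x. gs x j) \<in> borel_measurable ?P" if "j \<le> i" for j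
    using assms that by (intro measurable_gs) auto
  have n: "(\<lambda>x. norm (gs x j)) \<in> borel_measurable ?P" if "j \<le> i" for j
    using measurable_compose[OF g[OF that] borel_measurable_norm] .
  have p: "(\<lambda>x. gprod x i) \<in> borel_measurable ?P" using assms by (intro measurable_gprod) auto
  have 1: "{x \<in> space ?P. 0 < norm (gs x i)} \<in> sets ?P"
    by (intro borel_measurable_less n) auto
  have "{x \<in> space ?P. \<forall>j\<in>{..<i}. \<bar>x i \<bullet> gs x j\<bar> \<le> (norm (gs x j))\<^sup>2} \<in> sets ?P"
    by (intro sets.sets_Collect_finite_All borel_measurable_le borel_measurable_abs borel_measurable_inner
        x g borel_measurable_power n) auto
  then have 2: "{x \<in> space ?P. \<forall>j<i. \<bar>x i \<bullet> gs x j\<bar> \<le> (norm (gs x j))\<^sup>2} \<in> sets ?P"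
    by (simp only: Ball_def lessThan_iff)
  have 3: "{x \<in> space ?P. gprod x i * norm (gs x i) ^ (e - i) \<le> q} \<in> sets ?P"
    by (intro borel_measurable_le borel_measurable_times p borel_measurable_power n) auto
  show ?thesis unfolding red_at_def by (intro sets.sets_Collect_conj 1 2 3)
qed

lemma measurable_gs_perp:
  fixes x :: "nat \<Rightarrow> 'a::euclidean_space"
  shows "gs_perp x i \<in> borel_measurable borel"
  by (intro borel_measurable_continuous_onI linear_continuous_on linear_conv_bounded_linear[THEN iffD1] linear_gs_perp)

lemma borel_gs_slab:
  fixes x :: "nat \<Rightarrow> 'a::euclidean_space"
  shows "{y. \<forall>j<i. \<bar>y \<bullet> gs x j\<bar> \<le> (norm (gs x j))\<^sup>2} \<in> sets borel"
proof -
  have "{y. \<forall>j<i. \<bar>y \<bullet> gs x j\<bar> \<le> (norm (gs x j))\<^sup>2} = (\<Inter>j\<in>{..<i}. {y. \<bar>y \<bullet> gs x j\<bar> \<le> (norm (gs x j))\<^sup>2})"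
    by auto
  moreover have "closed \<dots>" by (intro closed_INT ballI closed_Collect_le continuous_intros)
  ultimately show ?thesis by simp
qed

lemma borel_red_at_upd:
  fixes x :: "nat \<Rightarrow> 'a::euclidean_space"
  shows "{y. red_at q e (x(i := y)) i} \<in> sets borel"
proof -
  have g: "gprod (x(i := y)) i = gprod x i" for y by (rule gprod_cong) auto
  have n: "(\<lambda>y. norm (gs_perp x i y)) \<in> borel_measurable borel"
    using measurable_compose[OF measurable_gs_perp borel_measurable_norm] .
  have eq: "{y. red_at q e (x(i := y)) i} = {y. \<forall>j<i. \<bar>y \<bullet> gs x j\<bar> \<le> (norm (gs x j))\<^sup>2} \<inter>
     {y \<in> space borel. 0 < norm (gs_perp x i y) \<and> gprod x i * norm (gs_perp x i y) ^ (e - i) \<le> q}"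
    by (auto simp: red_at_def gs_fun_upd gs_fun_upd_less g)
  have m: "{y \<in> space borel. 0 < norm (gs_perp x i y) \<and> gprod x i * norm (gs_perp x i y) ^ (e - i) \<le> q} \<in> sets borel"
    by (intro sets.sets_Collect_conj borel_measurable_le borel_measurable_less borel_measurable_times borel_measurable_power n) auto
  show ?thesis unfolding eq by (intro sets.Int borel_gs_slab m)
qed

text \<open>The condition on \<open>y\<close> says that its projection has norm at most
  \<open>R\<close>, where R^(e-i) = q / \<open>gprod x i\<close>. The slab estimate has growth
  exponent N-i, so the weight with exponent N-e leaves \<open>gprod x i\<close> times R^(e-i), which
  is \<open>q\<close>. This choice of weight makes the prefix cancel, and \<open>i < e\<close> is
  the convergence condition.\<close>

lemma nn_integral_red_at_le:
  fixes x :: "nat \<Rightarrow> real^'n"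
  assumes x: "\<And>j. j < i \<Longrightarrow> gs x j \<noteq> 0" and i: "i < e" and e: "e \<le> CARD('n)" and q: "0 < q"
  shows "(\<integral>\<^sup>+y. ennreal (inverse (norm (gs_perp x i y) ^ (CARD('n) - e))) * indicator {y. red_at q e (x(i := y)) i} y \<partial>lborel)
    \<le> ennreal (2 ^ (2 * CARD('n) + 1) * q)"
proof -
  let ?N = "CARD('n)"
  define S where "S = {y. \<forall>j<i. \<bar>y \<bullet> gs x j\<bar> \<le> (norm (gs x j))\<^sup>2}"
  have S: "S \<in> sets lborel" unfolding S_def using borel_gs_slab[of i x] by simp
  have g0: "0 < gprod x i" using x by (rule gprod_pos)
  define R where "R = root (e - i) (q / gprod x i)"
  have R: "0 < R" using g0 q i by (simp add: R_def)
  have Rp: "R ^ (e - i) = q / gprod x i" using g0 q i by (simp add: R_def)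
  have m: "(\<lambda>y. norm (gs_perp x i y)) \<in> borel_measurable lborel"
    using measurable_compose[OF measurable_gs_perp borel_measurable_norm, of x i] by simp
  have eq: "{y. red_at q e (x(i := y)) i} = {y \<in> S. 0 < norm (gs_perp x i y) \<and> norm (gs_perp x i y) \<le> R}"
  proof -
    have "gprod (x(i := y)) i * norm (gs_perp x i y) ^ (e - i) \<le> q \<longleftrightarrow> norm (gs_perp x i y) \<le> R" for y
    proof -
      have "gprod (x(i := y)) i = gprod x i" by (rule gprod_cong) auto
      moreover have "gprod x i * norm (gs_perp x i y) ^ (e - i) \<le> q \<longleftrightarrow> norm (gs_perp x i y) ^ (e - i) \<le> R ^ (e - i)"
        using g0 by (simp add: Rp pos_le_divide_eq mult.commute)
      moreover have "norm (gs_perp x i y) ^ (e - i) \<le> R ^ (e - i) \<longleftrightarrow> norm (gs_perp x i y) \<le> R"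
        using R i by (intro power_mono_iff) auto
      ultimately show ?thesis by simp
    qed
    then show ?thesis by (auto simp: red_at_def S_def gs_fun_upd gs_fun_upd_less)
  qed
  have "(\<integral>\<^sup>+y. ennreal (inverse (norm (gs_perp x i y) ^ (?N - e))) * indicator {y. red_at q e (x(i := y)) i} y \<partial>lborel)
    \<le> ennreal (2 ^ Suc (?N - e) * (2 ^ ?N * gprod x i) * R ^ ((?N - i) - (?N - e)))"
    unfolding eq
  proof (rule nn_integral_inverse_power_le[OF m S])
    fix t :: real assume t: "0 \<le> t"
    have "{y \<in> S. norm (gs_perp x i y) \<le> t} = {y. (\<forall>j<i. \<bar>y \<bullet> gs x j\<bar> \<le> (norm (gs x j))\<^sup>2) \<and> norm (gs_perp x i y) \<le> t}"
      by (auto simp: S_def)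
    then show "emeasure lborel {y \<in> S. norm (gs_perp x i y) \<le> t} \<le> ennreal (2 ^ ?N * gprod x i * t ^ (?N - i))"
      using emeasure_gs_slab[of i x t] x i e t by simp
  qed (use g0 R i e in auto)
  also have "(?N - i) - (?N - e) = e - i" using i e by auto
  also have "2 ^ Suc (?N - e) * (2 ^ ?N * gprod x i) * R ^ (e - i) = 2 ^ (Suc (?N - e) + ?N) * q"
    unfolding Rp using g0 by (simp add: power_add)
  also have "ennreal \<dots> \<le> ennreal (2 ^ (2 * ?N + 1) * q)"
    using q by (intro ennreal_leI mult_right_mono power_increasing) auto
  finally show ?thesis .
qed

definition red_set :: "(nat \<Rightarrow> real) \<Rightarrow> (nat \<Rightarrow> nat) \<Rightarrow> nat \<Rightarrow> (nat \<Rightarrow> 'a::real_inner) set" where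
  "red_set q e m = {x. \<forall>i<m. red_at (q i) (e i) x i}"

text \<open>The weight \<open>gprod x m ^ -t\<close> with \<open>t = N - e m\<close> is reproduced by integration over the last vector,
  at the cost of a factor proportional to \<open>q m\<close>.\<close>

definition red_int :: "(nat \<Rightarrow> real) \<Rightarrow> (nat \<Rightarrow> nat) \<Rightarrow> nat \<Rightarrow> nat \<Rightarrow> 'n::finite itself \<Rightarrow> ennreal" where
  "red_int q e t m _ = (\<integral>\<^sup>+x. ennreal (inverse (gprod x m ^ t)) * indicator (red_set q e m) x
      \<partial>PiM {..<m} (\<lambda>_. lborel :: (real^'n) measure))"

lemma measurable_red_set:
  "red_set q e m \<inter> space (PiM {..<m} (\<lambda>_. lborel :: 'a::euclidean_space measure)) \<in> sets (PiM {..<m} (\<lambda>_. lborel))"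
proof -
  have "{x \<in> space (PiM {..<m} (\<lambda>_. lborel)). \<forall>i\<in>{..<m}. red_at (q i) (e i) (x :: nat \<Rightarrow> 'a) i}
    \<in> sets (PiM {..<m} (\<lambda>_. lborel :: 'a measure))"
    by (rule sets.sets_Collect_finite_All) (auto intro: measurable_red_at)
  also have "{x \<in> space (PiM {..<m} (\<lambda>_. lborel)). \<forall>i\<in>{..<m}. red_at (q i) (e i) (x :: nat \<Rightarrow> 'a) i}
    = red_set q e m \<inter> space (PiM {..<m} (\<lambda>_. lborel :: 'a measure))"
    unfolding red_set_def by blast
  finally show ?thesis .
qed

lemma measurable_red_int:
  "(\<lambda>x. ennreal (inverse (gprod x m ^ t)) * indicator (red_set q e m) x)
    \<in> borel_measurable (PiM {..<m} (\<lambda>_. lborel :: 'a::euclidean_space measure))"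
proof -
  let ?P = "PiM {..<m} (\<lambda>_. lborel :: 'a measure)"
  have [measurable]: "(\<lambda>x. gprod x m) \<in> borel_measurable ?P" by (rule measurable_gprod) simp
  have "(\<lambda>x. indicator (red_set q e m \<inter> space ?P) x :: ennreal) \<in> borel_measurable ?P"
    using measurable_red_set by (rule borel_measurable_indicator)
  then have [measurable]: "(\<lambda>x. indicator (red_set q e m) x :: ennreal) \<in> borel_measurable ?P"
    by (rule measurable_cong[THEN iffD1, rotated]) (simp add: indicator_def)
  show ?thesis by measurable
qed

lemma red_set_nz: "x \<in> red_set q e m \<Longrightarrow> j < m \<Longrightarrow> gs x j \<noteq> 0"
  by (auto simp: red_set_def red_at_def)

lemma red_int_Suc:
  assumes m: "m < e m" "e m \<le> CARD('n::finite)" and q: "0 < q m"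
  shows "red_int q e (CARD('n) - e m) (Suc m) TYPE('n)
    \<le> ennreal (2 ^ (2 * CARD('n) + 1) * q m) * red_int q e (CARD('n) - e m) m TYPE('n)"
proof -
  let ?t = "CARD('n) - e m" and ?c = "ennreal (2 ^ (2 * CARD('n) + 1) * q m)"
  let ?P = "\<lambda>m. PiM {..<m} (\<lambda>_::nat. lborel :: (real^'n) measure)"
  let ?f = "\<lambda>m x. ennreal (inverse (gprod x m ^ ?t)) * indicator (red_set q e m) x"
  have I: "insert m {..<m} = {..<Suc m}" by auto
  have "red_int q e ?t (Suc m) TYPE('n) = (\<integral>\<^sup>+x. \<integral>\<^sup>+y. ?f (Suc m) (x(m := y)) \<partial>lborel \<partial>?P m)"
    unfolding red_int_def I[symmetric]
    by (rule PNS.product_nn_integral_insert) (use measurable_red_int[of "Suc m" ?t q e] in \<open>auto simp: I\<close>)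
  also have "\<dots> \<le> (\<integral>\<^sup>+x. ?c * ?f m x \<partial>?P m)"
  proof (rule nn_integral_mono)
    fix x :: "nat \<Rightarrow> real^'n"
    let ?h = "\<lambda>y. ennreal (inverse (norm (gs_perp x m y) ^ ?t)) * indicator {y. red_at (q m) (e m) (x(m := y)) m} y"
    have f: "?f (Suc m) (x(m := y)) = ?f m x * ?h y" for y
    proof -
      have "red_at (q i) (e i) (x(m := y)) i = red_at (q i) (e i) x i" if "i < m" for i
        using that by (intro red_at_cong) auto
      then have "x(m := y) \<in> red_set q e (Suc m) \<longleftrightarrow> x \<in> red_set q e m \<and> red_at (q m) (e m) (x(m := y)) m"
        by (auto simp: red_set_def less_Suc_eq)
      then have 1: "indicator (red_set q e (Suc m)) (x(m := y)) = (indicator (red_set q e m) x * indicator {y. red_at (q m) (e m) (x(m := y)) m} y :: ennreal)"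
        by (auto simp: indicator_def)
      have "gprod (x(m := y)) m = gprod x m" by (rule gprod_cong) auto
      then have "gprod (x(m := y)) (Suc m) = gprod x m * norm (gs_perp x m y)" by (simp add: gprod_Suc gs_fun_upd)
      then have 2: "ennreal (inverse (gprod (x(m := y)) (Suc m) ^ ?t)) = ennreal (inverse (gprod x m ^ ?t)) * ennreal (inverse (norm (gs_perp x m y) ^ ?t))"
        by (simp add: power_mult_distrib ennreal_mult gprod_nonneg)
      show ?thesis unfolding 1 2 by (simp only: mult_ac)
    qed
    show "(\<integral>\<^sup>+y. ?f (Suc m) (x(m := y)) \<partial>lborel) \<le> ?c * ?f m x"
    proof (cases "x \<in> red_set q e m")
      case False
      then have "?f m x = 0" by simp
      then show ?thesis by (simp only: f mult_zero_left nn_integral_const zero_le)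
    next
      case True
      have [measurable]: "(\<lambda>y. norm (gs_perp x m y)) \<in> borel_measurable borel"
        using measurable_compose[OF measurable_gs_perp borel_measurable_norm] .
      have "?h \<in> borel_measurable lborel"
        by (intro borel_measurable_times_ennreal borel_measurable_indicator) (auto simp: borel_red_at_upd)
      then have "(\<integral>\<^sup>+y. ?f m x * ?h y \<partial>lborel) = ?f m x * (\<integral>\<^sup>+y. ?h y \<partial>lborel)"
        by (rule nn_integral_cmult)
      also have "\<dots> \<le> ?f m x * ?c"
        using nn_integral_red_at_le[of m x "e m" "q m"] red_set_nz[OF True] m q by (intro mult_left_mono) auto
      finally show ?thesis by (simp only: f mult.commute[of ?c])
    qed
  qed
  also have "\<dots> = ?c * red_int q e ?t m TYPE('n)"
    unfolding red_int_def by (rule nn_integral_cmult) (rule measurable_red_int)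
  finally show ?thesis .
qed

text \<open>The last N-k vectors are integrated without weight (\<open>last\<close>), each costing
  \<open>c * \<Delta>\<close>. On what remains, \<open>gprod x k \<le> \<delta>\<close> allows
  inserting the weight with exponent N-k at the price \<delta>^(N-k) (\<open>mid\<close>), and the
  first k vectors then cost \<open>c * \<delta>\<close> each (\<open>first\<close>). The powers of
  \<delta> add up to N for every \<open>k\<close>. For \<open>k = 0\<close> the product is 1, so
  inserting the weight requires \<open>1 \<le> \<delta>\<close>.\<close>

lemma emeasure_red_set_le:
  fixes k :: nat and \<Delta> \<delta> :: real
  assumes k: "k \<le> CARD('n::finite)" and \<Delta>: "0 < \<Delta>" and \<delta>: "0 < \<delta>" "k = 0 \<Longrightarrow> 1 \<le> \<delta>"
  defines "q \<equiv> \<lambda>i. if i < k then \<delta> else \<Delta>" and "e \<equiv> \<lambda>i. if i < k then k else CARD('n)"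
  defines "c \<equiv> 2 ^ (2 * CARD('n) + 1)"
  shows "emeasure PN (red_set q e CARD('n) \<inter> space (PN :: (nat \<Rightarrow> real^'n) measure))
    \<le> ennreal ((c * \<Delta>) ^ (CARD('n) - k) * c ^ k * \<delta> ^ CARD('n))"
proof -
  let ?N = "CARD('n)"
  have c: "0 < c" by (simp add: c_def)
  have first: "red_int q e (?N - k) m TYPE('n) \<le> ennreal ((c * \<delta>) ^ m)" if "m \<le> k" for m
    using that
  proof (induction m)
    case 0
    show ?case by (simp add: red_int_def PNS.nn_integral_empty gprod_def indicator_def)
  next
    case (Suc m)
    have em: "e m = k" "q m = \<delta>" using Suc.prems by (auto simp: e_def q_def)
    have "red_int q e (?N - e m) (Suc m) TYPE('n) \<le> ennreal (c * q m) * red_int q e (?N - e m) m TYPE('n)"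
      unfolding c_def by (rule red_int_Suc) (use Suc.prems k \<delta> in \<open>auto simp: e_def q_def\<close>)
    then have "red_int q e (?N - k) (Suc m) TYPE('n) \<le> ennreal (c * \<delta>) * red_int q e (?N - k) m TYPE('n)"
      by (simp only: em)
    also have "\<dots> \<le> ennreal (c * \<delta>) * ennreal ((c * \<delta>) ^ m)"
      using Suc by (intro mult_left_mono) auto
    also have "\<dots> = ennreal ((c * \<delta>) ^ Suc m)" using c \<delta> by (simp add: ennreal_mult[symmetric])
    finally show ?case .
  qed
  have mid: "red_int q e 0 k TYPE('n) \<le> ennreal (\<delta> ^ (?N - k)) * red_int q e (?N - k) k TYPE('n)"
  proof -
    have "red_int q e 0 k TYPE('n) \<le> (\<integral>\<^sup>+x. ennreal (\<delta> ^ (?N - k)) * (ennreal (inverse (gprod x k ^ (?N - k))) * indicator (red_set q e k) x)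
      \<partial>PiM {..<k} (\<lambda>_. lborel :: (real^'n) measure))"
      unfolding red_int_def
    proof (rule nn_integral_mono)
      fix x :: "nat \<Rightarrow> real^'n"
      have "ennreal 1 \<le> ennreal (\<delta> ^ (?N - k)) * ennreal (inverse (gprod x k ^ (?N - k)))" if x: "x \<in> red_set q e k"
      proof -
        have g: "0 < gprod x k" using red_set_nz[OF x] by (rule gprod_pos)
        have "gprod x k \<le> \<delta>"
        proof (cases k)
          case 0 then show ?thesis using \<delta>(2) by (simp add: gprod_def)
        next
          case (Suc l)
          \<comment> \<open>At the last index of the prefix the exponent \<open>e l - l\<close>
            equals 1, so the condition at \<open>l\<close> bounds exactly
            \<open>gprod x k\<close>.\<close>
          then have "red_at (q l) (e l) x l" using x by (auto simp: red_set_def)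
          then show ?thesis using Suc by (simp add: red_at_def q_def e_def gprod_Suc)
        qed
        then have "gprod x k ^ (?N - k) \<le> \<delta> ^ (?N - k)" using g by (intro power_mono) auto
        then have "1 \<le> \<delta> ^ (?N - k) * inverse (gprod x k ^ (?N - k))" using g by (simp add: field_simps)
        then show ?thesis using \<delta> g by (simp add: ennreal_mult[symmetric] ennreal_leI del: ennreal_1)
      qed
      then show "ennreal (inverse (gprod x k ^ 0)) * indicator (red_set q e k) x
         \<le> ennreal (\<delta> ^ (?N - k)) * (ennreal (inverse (gprod x k ^ (?N - k))) * indicator (red_set q e k) x)"
        by (cases "x \<in> red_set q e k") auto
    qed
    also have "\<dots> = ennreal (\<delta> ^ (?N - k)) * red_int q e (?N - k) k TYPE('n)"
      unfolding red_int_def by (rule nn_integral_cmult) (rule measurable_red_int)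
    finally show ?thesis .
  qed
  have last: "red_int q e 0 (k + m) TYPE('n) \<le> ennreal ((c * \<Delta>) ^ m) * red_int q e 0 k TYPE('n)" if "k + m \<le> ?N" for m
    using that
  proof (induction m)
    case 0
    then show ?case by simp
  next
    case (Suc m)
    have em: "e (k + m) = ?N" "q (k + m) = \<Delta>" by (auto simp: e_def q_def)
    have "red_int q e (?N - e (k + m)) (Suc (k + m)) TYPE('n)
       \<le> ennreal (c * q (k + m)) * red_int q e (?N - e (k + m)) (k + m) TYPE('n)"
      unfolding c_def by (rule red_int_Suc) (use Suc.prems \<Delta> in \<open>auto simp: em\<close>)
    then have "red_int q e 0 (k + Suc m) TYPE('n) \<le> ennreal (c * \<Delta>) * red_int q e 0 (k + m) TYPE('n)"
      by (simp add: em)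
    also have "\<dots> \<le> ennreal (c * \<Delta>) * (ennreal ((c * \<Delta>) ^ m) * red_int q e 0 k TYPE('n))"
      using Suc by (intro mult_left_mono) auto
    also have "\<dots> = ennreal ((c * \<Delta>) ^ Suc m) * red_int q e 0 k TYPE('n)"
      using c \<Delta> by (simp add: ennreal_mult mult.assoc)
    finally show ?case .
  qed
  have "emeasure PN (red_set q e ?N \<inter> space (PN :: (nat \<Rightarrow> real^'n) measure)) = red_int q e 0 ?N TYPE('n)"
  proof -
    have "red_int q e 0 ?N TYPE('n) = (\<integral>\<^sup>+x. indicator (red_set q e ?N \<inter> space PN) x \<partial>(PN :: (nat \<Rightarrow> real^'n) measure))"
      unfolding red_int_def by (intro nn_integral_cong) (simp add: indicator_def)
    also have "\<dots> = emeasure PN (red_set q e ?N \<inter> space (PN :: (nat \<Rightarrow> real^'n) measure))"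
      using measurable_red_set by (rule nn_integral_indicator)
    finally show ?thesis by simp
  qed
  also have "red_int q e 0 ?N TYPE('n) \<le> ennreal ((c * \<Delta>) ^ (?N - k)) * red_int q e 0 k TYPE('n)"
    using last[of "?N - k"] k by simp
  also have "\<dots> \<le> ennreal ((c * \<Delta>) ^ (?N - k)) * (ennreal (\<delta> ^ (?N - k)) * ennreal ((c * \<delta>) ^ k))"
    using order_trans[OF mid mult_left_mono[OF first[of k]]] by (intro mult_left_mono) auto
  also have "\<dots> = ennreal ((c * \<Delta>) ^ (?N - k) * (\<delta> ^ (?N - k) * (c * \<delta>) ^ k))"
    using c \<delta> \<Delta> by (simp add: ennreal_mult)
  also have "\<delta> ^ (?N - k) * (c * \<delta>) ^ k = c ^ k * \<delta> ^ ?N"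
    using k by (simp add: power_mult_distrib power_add[symmetric])
  finally show ?thesis by (simp add: mult.assoc)
qed

section \<open>Reduced lattice bases\<close>

lemma inner_gs_less: "m < j \<Longrightarrow> x m \<bullet> gs x j = 0"
proof -
  assume m: "m < j"
  have "x m = gs x m + (\<Sum>l<m. (x m \<bullet> gs x l / (gs x l \<bullet> gs x l)) *\<^sub>R gs x l)"
    by (subst gs.simps) simp
  then have "x m \<bullet> gs x j = (gs x m + (\<Sum>l<m. (x m \<bullet> gs x l / (gs x l \<bullet> gs x l)) *\<^sub>R gs x l)) \<bullet> gs x j"
    by simp
  also have "\<dots> = 0" using m by (simp add: inner_add_left inner_sum_left gs_orth)
  finally show ?thesis .
qed

text \<open>Discreteness is stated as finiteness in every ball, the form in which shortest vectors
  are extracted. No basis is part of the definition; producing one is the purpose of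
  \<open>ex_reduced\<close> and \<open>reduced_zspan\<close>.\<close>

definition is_lattice :: "'a::euclidean_space set \<Rightarrow> bool" where
  "is_lattice L \<longleftrightarrow> (\<forall>v\<in>L. \<forall>w\<in>L. v + w \<in> L) \<and> (\<forall>v\<in>L. \<forall>n::int. of_int n *\<^sub>R v \<in> L)
     \<and> (\<forall>R. finite (L \<inter> cball 0 R)) \<and> span L = UNIV"

definition zspan :: "(nat \<Rightarrow> 'a::real_vector) \<Rightarrow> nat \<Rightarrow> 'a set" where
  "zspan x k = {\<Sum>i<k. of_int (n i) *\<^sub>R x i | n :: nat \<Rightarrow> int. True}"

lemma lattice_sub_mult: "is_lattice L \<Longrightarrow> v \<in> L \<Longrightarrow> w \<in> L \<Longrightarrow> v - of_int n *\<^sub>R w \<in> L"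
  unfolding is_lattice_def by (metis (no_types, opaque_lifting) add_uminus_conv_diff of_int_minus scaleR_minus_left)

lemma round_diff_le: "\<bar>(a::real) - of_int (round a)\<bar> \<le> 1 / 2"
  using of_int_round_abs_le[of a] by (simp add: abs_minus_commute)

text \<open>Babai's nearest plane procedure: integer multiples of the vectors of index k-1, ..., 0
  are subtracted in this order. Since \<open>x m\<close> is orthogonal to \<open>gs x j\<close> for
  \<open>m < j\<close>, each subtraction preserves the inequalities already achieved, and the
  projection off the prefix never changes.\<close>

lemma lattice_size_reduce:
  fixes x :: "nat \<Rightarrow> 'a::euclidean_space"
  assumes L: "is_lattice L" and x: "\<And>j. j < k \<Longrightarrow> x j \<in> L" "\<And>j. j < k \<Longrightarrow> gs x j \<noteq> 0" and w: "w \<in> L"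
  shows "\<exists>v\<in>L. gs_perp x k v = gs_perp x k w \<and> (\<forall>j<k. \<bar>v \<bullet> gs x j\<bar> \<le> (norm (gs x j))\<^sup>2 / 2)"
proof -
  have "\<exists>v\<in>L. gs_perp x k v = gs_perp x k w \<and> (\<forall>j<k. k \<le> j + d \<longrightarrow> \<bar>v \<bullet> gs x j\<bar> \<le> (norm (gs x j))\<^sup>2 / 2)"
    if "d \<le> k" for d
    using that
  proof (induction d)
    case 0
    then show ?case using w by (intro bexI[of _ w]) auto
  next
    case (Suc d)
    then obtain v where v: "v \<in> L" "gs_perp x k v = gs_perp x k w"
      "\<And>j. j < k \<Longrightarrow> k \<le> j + d \<Longrightarrow> \<bar>v \<bullet> gs x j\<bar> \<le> (norm (gs x j))\<^sup>2 / 2" by auto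
    define m where "m = k - Suc d"
    have m: "m < k" "k = m + Suc d" using Suc.prems by (auto simp: m_def)
    define g2 where "g2 = (norm (gs x m))\<^sup>2"
    have g2: "0 < g2" using x(2)[OF m(1)] by (simp add: g2_def)
    define n where "n = round (v \<bullet> gs x m / g2)"
    define v' where "v' = v - of_int n *\<^sub>R x m"
    have "v' \<in> L" unfolding v'_def by (rule lattice_sub_mult[OF L v(1) x(1)[OF m(1)]])
    moreover have "gs_perp x k v' = gs_perp x k w"
    proof -
      have "gs_perp x k (x m) = 0" using m by (auto simp: gs_perp_eq_0_iff intro!: span_base)
      then show ?thesis by (simp add: v'_def linear_diff[OF linear_gs_perp] linear_scale[OF linear_gs_perp] v(2))
    qed
    moreover have "\<bar>v' \<bullet> gs x j\<bar> \<le> (norm (gs x j))\<^sup>2 / 2" if j: "j < k" "k \<le> j + Suc d" for j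
    proof (cases "j = m")
      case True
      have "x m \<bullet> gs x m = g2" by (simp add: g2_def inner_gs_self)
      then have "v' \<bullet> gs x m = g2 * (v \<bullet> gs x m / g2 - of_int n)"
        using g2 by (simp add: v'_def inner_diff_left right_diff_distrib)
      then have "\<bar>v' \<bullet> gs x m\<bar> = g2 * \<bar>v \<bullet> gs x m / g2 - of_int n\<bar>"
        using g2 by (simp add: abs_mult)
      also have "\<dots> \<le> g2 * (1 / 2)" unfolding n_def using g2 by (intro mult_left_mono round_diff_le) auto
      finally show ?thesis using True by (simp add: g2_def)
    next
      case False
      then have "m < j" using j m by auto
      then show ?thesis using v(3)[of j] j m by (simp add: v'_def inner_diff_left inner_gs_less)
    qed
    ultimately show ?case by blast
  qed
  from this[of k] show ?thesis by auto
qed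

text \<open>A Korkine-Zolotarev reduced system: size-reduced, with each Gram-Schmidt vector shortest
  among the nonzero projections of lattice vectors off the preceding ones. That such a system
  generates the lattice is a consequence of minimality, not part of the definition.\<close>

definition reduced :: "'a::euclidean_space set \<Rightarrow> (nat \<Rightarrow> 'a) \<Rightarrow> nat \<Rightarrow> bool" where
  "reduced L x k \<longleftrightarrow> (\<forall>i<k. x i \<in> L \<and> gs x i \<noteq> 0 \<and> (\<forall>j<i. \<bar>x i \<bullet> gs x j\<bar> \<le> (norm (gs x j))\<^sup>2 / 2)
     \<and> (\<forall>w\<in>L. w \<notin> span (x ` {..<i}) \<longrightarrow> norm (gs x i) \<le> norm (gs_perp x i w)))"

text \<open>The projected lattice is not known to be discrete, so the minimum is taken over
  size-reduced representatives. Their components along the prefix are bounded, hence those with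
  projection no longer than that of a fixed candidate form a finite set. Size reduction does not
  alter the projection, so the minimum found is a minimum over all of \<open>L\<close>.\<close>

lemma ex_reduced:
  fixes L :: "'a::euclidean_space set"
  assumes L: "is_lattice L" and "k \<le> DIM('a)"
  shows "\<exists>x. reduced L x k"
  using assms(2)
proof (induction k)
  case 0
  show ?case by (simp add: reduced_def)
next
  case (Suc k)
  then obtain x where x: "reduced L x k" by auto
  have xL: "x j \<in> L" "gs x j \<noteq> 0" if "j < k" for j using x that by (auto simp: reduced_def)
  let ?V = "span (x ` {..<k})"
  have V: "?V \<noteq> UNIV" using Suc.prems by (intro span_image_lessThan_neq_UNIV) simp
  obtain w0 where w0: "w0 \<in> L" "w0 \<notin> ?V"
    using L V span_minimal[OF _ subspace_span, of L "x ` {..<k}"] unfolding is_lattice_def by blast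
  define good where "good w \<longleftrightarrow> w \<in> L \<and> w \<notin> ?V \<and> (\<forall>j<k. \<bar>w \<bullet> gs x j\<bar> \<le> (norm (gs x j))\<^sup>2 / 2)" for w
  have red: "\<exists>v. good v \<and> gs_perp x k v = gs_perp x k w" if w: "w \<in> L" "w \<notin> ?V" for w
  proof -
    obtain v where "v \<in> L" "gs_perp x k v = gs_perp x k w" "\<forall>j<k. \<bar>v \<bullet> gs x j\<bar> \<le> (norm (gs x j))\<^sup>2 / 2"
      using lattice_size_reduce[OF L xL w(1)] by blast
    then show ?thesis using w(2) unfolding good_def by (metis gs_perp_eq_0_iff)
  qed
  obtain w1 where w1: "good w1" using red[OF w0] by auto
  define R where "R = norm (gs_perp x k w1)"
  define Cd where "Cd = {w. good w \<and> norm (gs_perp x k w) \<le> R}"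
  have "Cd \<subseteq> L \<inter> cball 0 (R + (\<Sum>j<k. norm (gs x j)))"
  proof
    fix w assume w: "w \<in> Cd"
    have "norm w \<le> norm (gs_perp x k w) + norm (\<Sum>j<k. (w \<bullet> gs x j / (gs x j \<bullet> gs x j)) *\<^sub>R gs x j)"
      using gs_perp_decomp[of w x k] norm_triangle_ineq by metis
    also have "\<dots> \<le> R + (\<Sum>j<k. norm (gs x j))"
    proof (rule add_mono)
      show "norm (gs_perp x k w) \<le> R" using w by (simp add: Cd_def)
      show "norm (\<Sum>j<k. (w \<bullet> gs x j / (gs x j \<bullet> gs x j)) *\<^sub>R gs x j) \<le> (\<Sum>j<k. norm (gs x j))"
      proof (rule sum_norm_le)
        fix j assume j: "j \<in> {..<k}"
        have "\<bar>w \<bullet> gs x j\<bar> \<le> (norm (gs x j))\<^sup>2 / 2" using w j by (simp add: Cd_def good_def)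
        also have "\<dots> \<le> gs x j \<bullet> gs x j" by (simp add: power2_norm_eq_inner)
        finally have "\<bar>w \<bullet> gs x j / (gs x j \<bullet> gs x j)\<bar> \<le> 1" by (simp add: divide_le_eq_1 less_le)
        then show "norm ((w \<bullet> gs x j / (gs x j \<bullet> gs x j)) *\<^sub>R gs x j) \<le> norm (gs x j)"
          using mult_right_mono[of "\<bar>w \<bullet> gs x j / (gs x j \<bullet> gs x j)\<bar>" 1 "norm (gs x j)"] by simp
      qed
    qed
    finally show "w \<in> L \<inter> cball 0 (R + (\<Sum>j<k. norm (gs x j)))" using w by (simp add: Cd_def good_def)
  qed
  then have "finite Cd" using L finite_subset unfolding is_lattice_def by blast
  moreover have "w1 \<in> Cd" using w1 by (simp add: Cd_def R_def)
  ultimately obtain w where w: "w \<in> Cd" "\<And>v. v \<in> Cd \<Longrightarrow> norm (gs_perp x k w) \<le> norm (gs_perp x k v)"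
    using arg_min_if_finite[of Cd "\<lambda>w. norm (gs_perp x k w)"] by (metis empty_iff leI)
  have wmin: "norm (gs_perp x k w) \<le> norm (gs_perp x k v)" if vL: "v \<in> L" "v \<notin> ?V" for v
  proof -
    obtain v' where v': "good v'" "gs_perp x k v' = gs_perp x k v" using red[OF vL] by auto
    show ?thesis
    proof (cases "norm (gs_perp x k v) \<le> R")
      case True
      then have "v' \<in> Cd" using v' by (simp add: Cd_def)
      then show ?thesis using w(2) v'(2) by metis
    next
      case False
      then show ?thesis using w(1) by (simp add: Cd_def)
    qed
  qed
  let ?y = "x(k := w)"
  have img: "?y ` {..<i} = x ` {..<i}" if "i \<le> k" for i using that by (intro image_cong) auto
  have "reduced L ?y (Suc k)"
    unfolding reduced_def
  proof (intro allI impI)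
    fix i assume "i < Suc k"
    then consider "i < k" | "i = k" by linarith
    then show "?y i \<in> L \<and> gs ?y i \<noteq> 0 \<and> (\<forall>j<i. \<bar>?y i \<bullet> gs ?y j\<bar> \<le> (norm (gs ?y j))\<^sup>2 / 2)
       \<and> (\<forall>w\<in>L. w \<notin> span (?y ` {..<i}) \<longrightarrow> norm (gs ?y i) \<le> norm (gs_perp ?y i w))"
    proof cases
      case 1
      then have "gs_perp ?y i v = gs_perp x i v" for v by (intro gs_perp_cong) auto
      then show ?thesis using x 1 img[of i] by (auto simp: reduced_def gs_fun_upd_less)
    next
      case 2
      have p: "gs_perp ?y k v = gs_perp x k v" for v by (intro gs_perp_cong) auto
      have "w \<in> L" "w \<notin> ?V" "\<forall>j<k. \<bar>w \<bullet> gs x j\<bar> \<le> (norm (gs x j))\<^sup>2 / 2"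
        using w(1) by (auto simp: Cd_def good_def)
      then show ?thesis unfolding 2
        using wmin img[of k] by (auto simp: gs_fun_upd gs_fun_upd_less gs_perp_eq_0_iff p)
    qed
  qed
  then show ?case by blast
qed

text \<open>The next vector \<open>x (Suc i)\<close> competes in the minimality of
  \<open>gs x i\<close>. Its projection is \<open>gs x (Suc i)\<close> plus at most half of
  \<open>gs x i\<close> in norm, and that half is absorbed on the left.\<close>

lemma reduced_le_Suc:
  fixes x :: "nat \<Rightarrow> 'a::euclidean_space"
  assumes x: "reduced L x k" and i: "Suc i < k"
  shows "norm (gs x i) \<le> 2 * norm (gs x (Suc i))"
proof -
  define \<mu> where "\<mu> = x (Suc i) \<bullet> gs x i / (gs x i \<bullet> gs x i)"
  have "x (Suc i) \<in> L" "gs x (Suc i) \<noteq> 0" using x i by (auto simp: reduced_def)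
  moreover have "span (x ` {..<i}) \<subseteq> span (x ` {..<Suc i})" by (intro span_mono image_mono) auto
  ultimately have "x (Suc i) \<notin> span (x ` {..<i})" by (auto simp: gs_eq_0_iff)
  then have "norm (gs x i) \<le> norm (gs_perp x i (x (Suc i)))"
    using x i \<open>x (Suc i) \<in> L\<close> by (auto simp: reduced_def)
  also have "gs_perp x i (x (Suc i)) = gs x (Suc i) + \<mu> *\<^sub>R gs x i"
    unfolding \<mu>_def gs_eq_perp[of x "Suc i"] by (rule gs_perp_Suc)
  also have "norm \<dots> \<le> norm (gs x (Suc i)) + \<bar>\<mu>\<bar> * norm (gs x i)"
    by (metis norm_scaleR norm_triangle_ineq)
  also have "\<bar>\<mu>\<bar> * norm (gs x i) \<le> (1 / 2) * norm (gs x i)"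
  proof (rule mult_right_mono)
    have "gs x i \<noteq> 0" "\<bar>x (Suc i) \<bullet> gs x i\<bar> \<le> (norm (gs x i))\<^sup>2 / 2" using x i by (auto simp: reduced_def)
    then show "\<bar>\<mu>\<bar> \<le> 1 / 2" by (simp add: \<mu>_def divide_le_eq power2_norm_eq_inner)
  qed simp
  finally show ?thesis by simp
qed

lemma reduced_le:
  fixes x :: "nat \<Rightarrow> 'a::euclidean_space"
  assumes x: "reduced L x k" and i: "j + d < k"
  shows "norm (gs x j) \<le> 2 ^ d * norm (gs x (j + d))"
  using i
proof (induction d)
  case (Suc d)
  have "norm (gs x j) \<le> 2 ^ d * norm (gs x (j + d))" using Suc by simp
  also have "\<dots> \<le> 2 ^ d * (2 * norm (gs x (Suc (j + d))))"
    using reduced_le_Suc[OF x, of "j + d"] Suc.prems by (intro mult_left_mono) auto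
  finally show ?case by simp
qed simp

lemma zspan_Suc: "zspan x (Suc k) = (\<Union>n::int. (\<lambda>v. v + of_int n *\<^sub>R x k) ` zspan x k)"
proof (intro equalityI subsetI)
  fix w assume "w \<in> zspan x (Suc k)"
  then obtain n :: "nat \<Rightarrow> int" where "w = (\<Sum>i<Suc k. of_int (n i) *\<^sub>R x i)" by (auto simp: zspan_def)
  then show "w \<in> (\<Union>n::int. (\<lambda>v. v + of_int n *\<^sub>R x k) ` zspan x k)" by (auto simp: zspan_def)
next
  fix w assume "w \<in> (\<Union>n::int. (\<lambda>v. v + of_int n *\<^sub>R x k) ` zspan x k)"
  then obtain m :: int and n :: "nat \<Rightarrow> int" where w: "w = (\<Sum>i<k. of_int (n i) *\<^sub>R x i) + of_int m *\<^sub>R x k"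
    by (auto simp: zspan_def)
  then have "w = (\<Sum>i<Suc k. of_int ((n(k := m)) i) *\<^sub>R x i)" by simp
  then show "w \<in> zspan x (Suc k)" unfolding zspan_def by blast
qed

text \<open>Rounding the coefficient of \<open>w\<close> along \<open>gs x k\<close> leaves a
  lattice vector whose projection is at most half as long as \<open>gs x k\<close>. By minimality it
  lies in the span of the shorter prefix, where the induction hypothesis applies.\<close>

lemma reduced_zspan:
  fixes x :: "nat \<Rightarrow> 'a::euclidean_space"
  assumes L: "is_lattice L" and x: "reduced L x K" and k: "k \<le> K" and w: "w \<in> L" "w \<in> span (x ` {..<k})"
  shows "w \<in> zspan x k"
  using k w
proof (induction k arbitrary: w)
  case 0
  then show ?case by (simp add: zspan_def)
next
  case (Suc k)
  define \<mu> where "\<mu> = w \<bullet> gs x k / (gs x k \<bullet> gs x k)"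
  define w' where "w' = w - of_int (round \<mu>) *\<^sub>R x k"
  have xk: "x k \<in> L" "gs x k \<noteq> 0" using x Suc.prems by (auto simp: reduced_def)
  have w'L: "w' \<in> L" unfolding w'_def by (rule lattice_sub_mult[OF L Suc.prems(2) xk(1)])
  have w's: "w' \<in> span (x ` {..<Suc k})" unfolding w'_def
    by (intro span_diff Suc.prems span_scale span_base) auto
  have "w' \<in> span (x ` {..<k})"
  proof (rule ccontr)
    assume "w' \<notin> span (x ` {..<k})"
    then have "norm (gs x k) \<le> norm (gs_perp x k w')" using x w'L Suc.prems by (auto simp: reduced_def)
    also have "gs_perp x k w' = (w' \<bullet> gs x k / (gs x k \<bullet> gs x k)) *\<^sub>R gs x k"
      using gs_perp_Suc[of x k w'] w's by (simp add: gs_perp_eq_0_iff[symmetric])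
    also have "w' \<bullet> gs x k / (gs x k \<bullet> gs x k) = \<mu> - of_int (round \<mu>)"
      using xk(2) by (simp add: w'_def \<mu>_def inner_diff_left diff_divide_distrib inner_gs_self power2_norm_eq_inner)
    also have "norm ((\<mu> - of_int (round \<mu>)) *\<^sub>R gs x k) \<le> (1 / 2) * norm (gs x k)"
      unfolding norm_scaleR by (intro mult_right_mono round_diff_le) auto
    finally show False using xk(2) by simp
  qed
  then have "w' \<in> zspan x k" using Suc.IH w'L Suc.prems by auto
  moreover have "w = w' + of_int (round \<mu>) *\<^sub>R x k" by (simp add: w'_def)
  ultimately show ?case unfolding zspan_Suc by blast
qed

lemma span_gs_full:
  fixes x :: "nat \<Rightarrow> 'a::euclidean_space"
  assumes x: "\<And>i. i < DIM('a) \<Longrightarrow> gs x i \<noteq> 0"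
  shows "span (x ` {..<DIM('a)}) = UNIV"
proof -
  let ?G = "gs x ` {..<DIM('a)}"
  have inj: "inj_on (gs x) {..<DIM('a)}"
    by (rule inj_onI) (metis x gs_orth inner_eq_zero_iff lessThan_iff)
  have "pairwise orthogonal ?G" by (auto simp: pairwise_def orthogonal_def intro!: gs_orth)
  then have "independent ?G" using x by (intro pairwise_orthogonal_independent) auto
  then have "dim ?G = DIM('a)" using inj by (simp add: dim_eq_card_independent card_image)
  then show ?thesis using dim_eq_full[of ?G] by (simp add: span_gs)
qed

section \<open>Counting lattice points in a ball\<close>

lemma card_int_interval:
  fixes \<alpha> \<beta> :: real
  assumes "0 \<le> \<beta>"
  shows "finite {n::int. \<bar>of_int n - \<alpha>\<bar> \<le> \<beta>}" "real (card {n::int. \<bar>of_int n - \<alpha>\<bar> \<le> \<beta>}) \<le> 2 * \<beta> + 1"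
proof -
  have eq: "{n::int. \<bar>of_int n - \<alpha>\<bar> \<le> \<beta>} = {\<lceil>\<alpha> - \<beta>\<rceil>..\<lfloor>\<alpha> + \<beta>\<rfloor>}"
    by (auto simp: ceiling_le_iff le_floor_iff abs_le_iff)
  then show "finite {n::int. \<bar>of_int n - \<alpha>\<bar> \<le> \<beta>}" by simp
  have "\<lfloor>\<alpha> + \<beta>\<rfloor> \<le> \<alpha> + \<beta>" "\<alpha> - \<beta> \<le> \<lceil>\<alpha> - \<beta>\<rceil>" by auto
  then show "real (card {n::int. \<bar>of_int n - \<alpha>\<bar> \<le> \<beta>}) \<le> 2 * \<beta> + 1"
    unfolding eq using assms by (cases "0 \<le> \<lfloor>\<alpha> + \<beta>\<rfloor> - \<lceil>\<alpha> - \<beta>\<rceil> + 1") (simp_all, linarith)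
qed

text \<open>Slice by the coefficient of the last vector. Everything in \<open>zspan x k\<close> is
  orthogonal to \<open>gs x k\<close>, so this coefficient is read off from the inner product with
  \<open>gs x k\<close> and runs through an interval of length twice \<rho> /
  \<open>norm (gs x k)\<close>. Each slice is a translate of a set of the same kind with a shifted
  centre, hence the induction over arbitrary \<open>c\<close>.\<close>

lemma card_zspan_ball:
  fixes x :: "nat \<Rightarrow> 'a::euclidean_space"
  assumes "\<And>i. i < k \<Longrightarrow> gs x i \<noteq> 0" and \<rho>: "0 \<le> \<rho>"
  shows "finite {w \<in> zspan x k. norm (w - c) \<le> \<rho>} \<and>
    real (card {w \<in> zspan x k. norm (w - c) \<le> \<rho>}) \<le> (\<Prod>i<k. 2 * \<rho> / norm (gs x i) + 1)"
  using assms(1)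
proof (induction k arbitrary: c)
  case 0
  have "{w \<in> zspan x 0. norm (w - c) \<le> \<rho>} \<subseteq> {0}" by (auto simp: zspan_def)
  then show ?case using card_mono[of "{0::'a}" "{w \<in> zspan x 0. norm (w - c) \<le> \<rho>}"]
    by (simp add: finite_subset[of _ "{0::'a}"])
next
  case (Suc k)
  define r where "r = norm (gs x k)"
  have r: "0 < r" using Suc.prems[of k] by (simp add: r_def)
  define I where "I = {n::int. \<bar>of_int n - c \<bullet> gs x k / r\<^sup>2\<bar> \<le> \<rho> / r}"
  have I: "finite I" "real (card I) \<le> 2 * (\<rho> / r) + 1"
    unfolding I_def using card_int_interval[of "\<rho> / r" "c \<bullet> gs x k / r\<^sup>2"] \<rho> r by auto
  let ?S = "\<lambda>c. {w \<in> zspan x k. norm (w - c) \<le> \<rho>}"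
  let ?B = "\<Prod>i<k. 2 * \<rho> / norm (gs x i) + 1"
  have IH: "finite (?S c)" "real (card (?S c)) \<le> ?B" for c using Suc by auto
  let ?U = "\<Union>n\<in>I. (\<lambda>v. v + of_int n *\<^sub>R x k) ` ?S (c - of_int n *\<^sub>R x k)"
  have sub: "{w \<in> zspan x (Suc k). norm (w - c) \<le> \<rho>} \<subseteq> ?U"
  proof clarify
    fix w assume w: "w \<in> zspan x (Suc k)" "norm (w - c) \<le> \<rho>"
    then obtain n :: int and v where v: "v \<in> zspan x k" "w = v + of_int n *\<^sub>R x k" unfolding zspan_Suc by auto
    have "v \<bullet> gs x k = 0" using v(1) by (auto simp: zspan_def inner_sum_left inner_gs_less)
    then have "w \<bullet> gs x k = of_int n * r\<^sup>2"
      by (simp add: v(2) inner_add_left r_def inner_gs_self)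
    then have "(w - c) \<bullet> gs x k = r\<^sup>2 * (of_int n - c \<bullet> gs x k / r\<^sup>2)"
      using r by (simp add: inner_diff_left right_diff_distrib mult.commute)
    then have "r\<^sup>2 * \<bar>of_int n - c \<bullet> gs x k / r\<^sup>2\<bar> = \<bar>(w - c) \<bullet> gs x k\<bar>" by (simp add: abs_mult)
    also have "\<dots> \<le> norm (w - c) * r" unfolding r_def by (rule Cauchy_Schwarz_ineq2)
    also have "\<dots> \<le> \<rho> * r" using w(2) r by (intro mult_right_mono) auto
    finally have "r * (r * \<bar>of_int n - c \<bullet> gs x k / r\<^sup>2\<bar>) \<le> r * \<rho>"
      by (simp only: power2_eq_square mult.assoc mult.commute[of \<rho>])
    then have "r * \<bar>of_int n - c \<bullet> gs x k / r\<^sup>2\<bar> \<le> \<rho>" using r by (simp only: mult_le_cancel_left_pos)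
    then have "n \<in> I" unfolding I_def using r by (simp add: pos_le_divide_eq mult.commute)
    have e: "v - (c - of_int n *\<^sub>R x k) = w - c" by (simp add: v(2))
    have "v \<in> ?S (c - of_int n *\<^sub>R x k)" unfolding mem_Collect_eq e using v(1) w(2) by blast
    with \<open>n \<in> I\<close> show "w \<in> ?U" unfolding v(2) by (intro UN_I[of n] imageI)
  qed
  have fin: "finite ?U" using I IH by auto
  have "real (card ?U) \<le> real (\<Sum>n\<in>I. card ((\<lambda>v. v + of_int n *\<^sub>R x k) ` ?S (c - of_int n *\<^sub>R x k)))"
    by (intro of_nat_mono card_UN_le I)
  also have "\<dots> = (\<Sum>n\<in>I. real (card ((\<lambda>v. v + of_int n *\<^sub>R x k) ` ?S (c - of_int n *\<^sub>R x k))))"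
    by (rule of_nat_sum)
  also have "\<dots> \<le> (\<Sum>n\<in>I. ?B)"
  proof (rule sum_mono)
    fix n
    have "card ((\<lambda>v. v + of_int n *\<^sub>R x k) ` ?S (c - of_int n *\<^sub>R x k)) \<le> card (?S (c - of_int n *\<^sub>R x k))"
      by (rule card_image_le[OF IH(1)])
    then show "real (card ((\<lambda>v. v + of_int n *\<^sub>R x k) ` ?S (c - of_int n *\<^sub>R x k))) \<le> ?B"
      using IH(2)[of "c - of_int n *\<^sub>R x k"] by linarith
  qed
  also have "\<dots> = real (card I) * ?B" by simp
  also have "\<dots> \<le> (2 * (\<rho> / r) + 1) * ?B"
    using I(2) \<rho> by (intro mult_right_mono prod_nonneg) auto
  also have "\<dots> = (\<Prod>i<Suc k. 2 * \<rho> / norm (gs x i) + 1)" by (simp add: r_def)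
  finally have "real (card ?U) \<le> (\<Prod>i<Suc k. 2 * \<rho> / norm (gs x i) + 1)" .
  then show ?case using sub fin card_mono[OF fin sub] finite_subset[OF sub fin] by linarith
qed

section \<open>Unfolding over integral unimodular matrices\<close>

definition int_mat :: "real^'n^'n \<Rightarrow> bool" where
  "int_mat A \<longleftrightarrow> (\<forall>i j. A $ i $ j \<in> \<int>)"

lemma int_mat_mult: "int_mat A \<Longrightarrow> int_mat B \<Longrightarrow> int_mat (A ** B)"
  by (auto simp: int_mat_def matrix_matrix_mult_def intro!: Ints_sum Ints_mult)

lemma int_mat_iff: "int_mat A \<longleftrightarrow> (\<exists>f :: 'n \<Rightarrow> 'n \<Rightarrow> int. A = (\<chi> i j. of_int (f i j)))" for A :: "real^'n^'n"
proof
  assume A: "int_mat A"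
  then have "A = (\<chi> i j. of_int (\<lfloor>A $ i $ j\<rfloor>))" by (auto simp: int_mat_def vec_eq_iff)
  then show "\<exists>f :: 'n \<Rightarrow> 'n \<Rightarrow> int. A = (\<chi> i j. of_int (f i j))" by (intro exI[of _ "\<lambda>i j. \<lfloor>A $ i $ j\<rfloor>"])
qed (auto simp: int_mat_def)

lemma countable_int_mat: "countable {A :: real^'n^'n. int_mat A}"
proof -
  have "{A :: real^'n^'n. int_mat A} = range (\<lambda>f :: 'n \<Rightarrow> 'n \<Rightarrow> int. \<chi> i j. of_int (f i j))"
    by (auto simp: int_mat_iff)
  then show ?thesis by simp
qed

lemma finite_bounded_int_mat: "finite {A :: real^'n^'n. int_mat A \<and> (\<forall>i j. \<bar>A $ i $ j\<bar> \<le> of_int b)}"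
proof (rule finite_subset)
  let ?F = "PiE (UNIV :: 'n set) (\<lambda>_. PiE (UNIV :: 'n set) (\<lambda>_. {-b..b}))"
  show "{A :: real^'n^'n. int_mat A \<and> (\<forall>i j. \<bar>A $ i $ j\<bar> \<le> of_int b)} \<subseteq> (\<lambda>f. \<chi> i j. of_int (f i j)) ` ?F"
  proof clarify
    fix A :: "real^'n^'n" assume "int_mat A" and b: "\<forall>i j. \<bar>A $ i $ j\<bar> \<le> of_int b"
    then obtain f :: "'n \<Rightarrow> 'n \<Rightarrow> int" where f: "A = (\<chi> i j. of_int (f i j))" by (auto simp: int_mat_iff)
    have "f i j \<in> {-b..b}" for i j
    proof -
      have "real_of_int \<bar>f i j\<bar> \<le> of_int b" using b by (simp add: f)
      then have "\<bar>f i j\<bar> \<le> b" by linarith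
      then show ?thesis by auto
    qed
    then have "f \<in> ?F" by (auto simp: PiE_iff)
    then show "A \<in> (\<lambda>f. \<chi> i j. of_int (f i j)) ` ?F" using f by blast
  qed
  show "finite ((\<lambda>f. \<chi> i j. of_int (f i j) :: real^'n^'n) ` ?F)" by (intro finite_imageI finite_PiE) auto
qed

lemma det_Ints: "int_mat A \<Longrightarrow> det A \<in> \<int>"
  unfolding det_def int_mat_def by (intro Ints_sum Ints_mult Ints_prod) auto

definition GLZ :: "(real^'n^'n) set" where
  "GLZ = {A. int_mat A \<and> (\<exists>B. int_mat B \<and> A ** B = mat 1)}"

definition GLZ_inv :: "real^'n^'n \<Rightarrow> real^'n^'n" where
  "GLZ_inv A = (SOME B. int_mat B \<and> A ** B = mat 1)"

lemma GLZ_inv: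
  fixes A :: "real^'n^'n"
  assumes "A \<in> GLZ"
  shows "int_mat A" "int_mat (GLZ_inv A)" "A ** GLZ_inv A = mat 1" "GLZ_inv A ** A = mat 1" "\<bar>det A\<bar> = 1"
proof -
  show A: "int_mat A" using assms by (simp add: GLZ_def)
  have "int_mat (GLZ_inv A) \<and> A ** GLZ_inv A = mat 1"
    unfolding GLZ_inv_def by (rule someI_ex) (use assms in \<open>auto simp: GLZ_def\<close>)
  then show B: "int_mat (GLZ_inv A)" and AB: "A ** GLZ_inv A = mat 1" by auto
  then show "GLZ_inv A ** A = mat 1" by (simp add: matrix_left_right_inverse)
  have "det A * det (GLZ_inv A) = 1" using arg_cong[OF AB, of det] by (simp add: det_mul)
  moreover obtain p q :: int where "det A = of_int p" "det (GLZ_inv A) = of_int q"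
    using det_Ints[OF A] det_Ints[OF B] by (auto elim!: Ints_cases)
  ultimately have "real_of_int (p * q) = 1" "det A = of_int p" by simp_all
  then have "p * q = 1" by linarith
  then have "\<bar>p\<bar> = 1" by (metis abs_zmult_eq_1 abs_one)
  then show "\<bar>det A\<bar> = 1" using \<open>det A = of_int p\<close> by simp
qed

text \<open>\<open>E\<close> is covered by the sets \<open>T j\<close> of those Y in
  \<open>V\<close> that \<open>\<gamma> j\<close> moves into \<open>F\<close>. As |det| = 1, each
  has the measure of its translate \<open>H' j\<close> inside \<open>F\<close>. A point X of
  \<open>F\<close> lies in as many translates as there are G in \<open>GLZ\<close> with X G^-1 in
  \<open>V\<close>, and this multiplicity is bounded by a count of integer matrices. No fundamental
  domain and no measurable choice of \<open>G\<close> is involved.\<close>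

lemma emeasure_unfold_GLZ:
  fixes V F E :: "(real^'n^'n) set"
  assumes V: "V \<in> sets borel" and F: "F \<in> sets borel" and EV: "E \<subseteq> V"
    and EF: "\<And>Y. Y \<in> E \<Longrightarrow> \<exists>G\<in>GLZ. Y ** G \<in> F"
    and bd: "\<And>Y Y' Z i j. Y \<in> V \<Longrightarrow> Y' \<in> V \<Longrightarrow> int_mat Z \<Longrightarrow> Y ** Z = Y' \<Longrightarrow> \<bar>Z $ i $ j\<bar> \<le> of_int b"
  shows "emeasure lborel E \<le> of_nat (card {A :: real^'n^'n. int_mat A \<and> (\<forall>i j. \<bar>A $ i $ j\<bar> \<le> of_int b)}) * emeasure lborel F"
proof -
  let ?m = "card {A :: real^'n^'n. int_mat A \<and> (\<forall>i j. \<bar>A $ i $ j\<bar> \<le> of_int b)}"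
  have cG: "countable (GLZ :: (real^'n^'n) set)"
    by (rule countable_subset[OF _ countable_int_mat]) (auto simp: GLZ_def)
  define J where "J = to_nat_on (GLZ :: (real^'n^'n) set) ` GLZ"
  define \<gamma> where "\<gamma> = from_nat_into (GLZ :: (real^'n^'n) set)"
  have \<gamma>: "\<gamma> j \<in> GLZ" if "j \<in> J" for j
    using that cG by (auto simp: J_def \<gamma>_def)
  have \<gamma>inj: "inj_on \<gamma> J" using cG by (auto simp: inj_on_def J_def \<gamma>_def)
  have \<gamma>surj: "\<exists>j\<in>J. \<gamma> j = G" if "G \<in> GLZ" for G
    using that cG by (auto simp: J_def \<gamma>_def)
  define H where "H G = {X \<in> F. X ** GLZ_inv G \<in> V}" for G
  define T where "T j = (if j \<in> J then {Y \<in> V. Y ** \<gamma> j \<in> F} else {})" for j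
  define H' where "H' j = (if j \<in> J then H (\<gamma> j) else {})" for j
  have Hm: "H G \<in> sets borel" for G
  proof -
    have "H G = F \<inter> (\<lambda>X. X ** GLZ_inv G) -` V" by (auto simp: H_def)
    then show ?thesis using F measurable_sets[OF measurable_matrix_mult_right[of "GLZ_inv G"] V] by auto
  qed
  have Tm: "T j \<in> sets borel" for j
  proof -
    have "T j = (if j \<in> J then V \<inter> (\<lambda>X. X ** \<gamma> j) -` F else {})" by (auto simp: T_def)
    then show ?thesis using V measurable_sets[OF measurable_matrix_mult_right[of "\<gamma> j"] F] by auto
  qed
  have TH: "emeasure lborel (T j) = emeasure lborel (H' j)" for j
  proof (cases "j \<in> J")
    case True
    note g = GLZ_inv[OF \<gamma>[OF True]]
    have d: "det (\<gamma> j) \<noteq> 0" using g(5) by auto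
    have "Y ** \<gamma> j ** GLZ_inv (\<gamma> j) = Y" for Y :: "real^'n^'n"
      unfolding matrix_mul_assoc[symmetric] g(3) by simp
    then have "T j = (\<lambda>X. X ** \<gamma> j) -` H (\<gamma> j)"
      using True unfolding T_def H_def by auto
    then have "emeasure lborel (T j) * ennreal (\<bar>det (\<gamma> j)\<bar> ^ CARD('n)) = emeasure lborel (H (\<gamma> j))"
      using emeasure_lborel_matrix_mult_right[OF d Hm[of "\<gamma> j"]] by simp
    then show ?thesis using True g(5) by (simp add: H'_def)
  qed (simp add: T_def H'_def)
  have "E \<subseteq> (\<Union>j. T j)"
  proof
    fix Y assume Y: "Y \<in> E"
    then obtain G where "G \<in> GLZ" "Y ** G \<in> F" using EF by auto
    then obtain j where "j \<in> J" "\<gamma> j = G" using \<gamma>surj by blast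
    then have "Y \<in> T j" using Y EV \<open>Y ** G \<in> F\<close> by (auto simp: T_def)
    then show "Y \<in> (\<Union>j. T j)" by blast
  qed
  then have "emeasure lborel E \<le> emeasure lborel (\<Union>j. T j)"
    using Tm by (intro emeasure_mono) auto
  also have "\<dots> \<le> (\<Sum>j. emeasure lborel (T j))"
    using Tm by (intro emeasure_subadditive_countably) auto
  also have "\<dots> = (\<Sum>j. \<integral>\<^sup>+X. indicator (H' j) X \<partial>lborel)"
    using Hm by (intro suminf_cong) (simp add: TH H'_def)
  also have "\<dots> = (\<integral>\<^sup>+X. (\<Sum>j. indicator (H' j) X) \<partial>lborel)"
    using Hm by (intro nn_integral_suminf[symmetric]) (simp add: H'_def)
  also have "\<dots> \<le> (\<integral>\<^sup>+X. of_nat ?m * indicator F X \<partial>lborel)"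
  proof (rule nn_integral_mono)
    fix X :: "real^'n^'n"
    have "(\<Sum>j<k. indicator (H' j) X) \<le> (of_nat ?m * indicator F X :: ennreal)" for k
    proof (cases "X \<in> F")
      case False
      then have "X \<notin> H' j" for j by (auto simp: H'_def H_def)
      then show ?thesis by simp
    next
      case True
      let ?Q = "{G \<in> GLZ. X \<in> H G}"
      have Q: "finite ?Q \<and> card ?Q \<le> ?m"
      proof (cases "?Q = {}")
        case True
        show ?thesis unfolding True by simp
      next
        case False
        then obtain G0 where G0: "G0 \<in> GLZ" "X \<in> H G0" by auto
        note g0 = GLZ_inv[OF G0(1)]
        \<comment> \<open>Relative to one admissible \<open>G0\<close>, any other admissible
          \<open>G\<close> is determined by the integer matrix G G0^-1, which carries one point of
          \<open>V\<close> to another and therefore has bounded entries.\<close>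
        have "?Q \<subseteq> (\<lambda>Z. Z ** G0) ` {A. int_mat A \<and> (\<forall>i j. \<bar>A $ i $ j\<bar> \<le> of_int b)}"
        proof clarify
          fix G assume G: "G \<in> GLZ" "X \<in> H G"
          note g = GLZ_inv[OF G(1)]
          let ?Z = "G ** GLZ_inv G0"
          have Z: "int_mat ?Z" using g(1) g0(2) by (rule int_mat_mult)
          have "(X ** GLZ_inv G) ** ?Z = X ** (GLZ_inv G ** G) ** GLZ_inv G0"
            by (simp only: matrix_mul_assoc)
          also have "\<dots> = X ** GLZ_inv G0" unfolding g(4) by simp
          finally have "(X ** GLZ_inv G) ** ?Z = X ** GLZ_inv G0" .
          moreover have "X ** GLZ_inv G \<in> V" "X ** GLZ_inv G0 \<in> V" using G G0 by (auto simp: H_def)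
          ultimately have "\<bar>?Z $ i $ j\<bar> \<le> of_int b" for i j by (intro bd[OF _ _ Z]) assumption+
          moreover have "?Z ** G0 = G ** (GLZ_inv G0 ** G0)" by (simp only: matrix_mul_assoc)
          then have "G = ?Z ** G0" unfolding g0(4) by simp
          ultimately show "G \<in> (\<lambda>Z. Z ** G0) ` {A. int_mat A \<and> (\<forall>i j. \<bar>A $ i $ j\<bar> \<le> of_int b)}"
            using Z by blast
        qed
        then show ?thesis
          by (intro conjI finite_surj[OF finite_bounded_int_mat] surj_card_le[OF finite_bounded_int_mat])
      qed
      have "(\<Sum>j<k. indicator (H' j) X :: ennreal) = of_nat (card {j. j < k \<and> X \<in> H' j})"
      proof -
        have "(\<Sum>j<k. indicator (H' j) X :: ennreal) = (\<Sum>j\<in>{j. j < k \<and> X \<in> H' j}. 1)"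
          by (rule sum.mono_neutral_cong_right) (auto simp: indicator_def)
        then show ?thesis by simp
      qed
      also have "\<dots> \<le> of_nat ?m"
      proof (rule of_nat_mono)
      have "card {j. j < k \<and> X \<in> H' j} \<le> card ?Q"
      proof (rule card_inj_on_le[of \<gamma>])
        show "inj_on \<gamma> {j. j < k \<and> X \<in> H' j}" by (rule inj_on_subset[OF \<gamma>inj]) (auto simp: H'_def split: if_splits)
        show "\<gamma> ` {j. j < k \<and> X \<in> H' j} \<subseteq> ?Q" using \<gamma> by (auto simp: H'_def split: if_splits)
      qed (use Q in auto)
      then show "card {j. j < k \<and> X \<in> H' j} \<le> ?m" using Q by linarith
      qed
      finally show ?thesis using True by simp
    qed
    then show "(\<Sum>j. indicator (H' j) X) \<le> (of_nat ?m * indicator F X :: ennreal)"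
      by (intro suminf_le_const summableI)
  qed
  also have "\<dots> = of_nat ?m * emeasure lborel F" using F by (simp add: nn_integral_cmult_indicator)
  finally show ?thesis .
qed

section \<open>Matrices sending many integer points to a box\<close>

text \<open>Here the integer vectors are on the domain side. Left factors of \<open>g\<close> then
  act on the box and integral right factors only change the basis of the lattice. The finite witness
  also covers infinitely many solutions.\<close>

definition lattice_pts :: "real^'n^'n \<Rightarrow> (real^'n) set \<Rightarrow> real \<Rightarrow> bool" where
  "lattice_pts g B K \<longleftrightarrow> (\<exists>Z. finite Z \<and> Z \<subseteq> int_lattice \<and> K \<le> real (card Z) \<and> (\<forall>z\<in>Z. g *v z \<in> B))"

definition abox :: "('n \<Rightarrow> real) \<Rightarrow> (real^'n) set" where
  "abox a = {x. \<forall>i. \<bar>x $ i\<bar> \<le> a i}"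

lemma closed_abox: "closed (abox a)"
proof -
  have "abox a = (\<Inter>i. {x. \<bar>x $ i\<bar> \<le> a i})" by (auto simp: abox_def)
  then show ?thesis by (simp only:) (intro closed_INT ballI closed_Collect_le continuous_intros)
qed

lemma int_lattice_iff: "z \<in> int_lattice \<longleftrightarrow> (\<exists>f :: 'n \<Rightarrow> int. z = (\<chi> i. of_int (f i)))" for z :: "real^'n"
proof
  assume z: "z \<in> int_lattice"
  then have "z = (\<chi> i. of_int \<lfloor>z $ i\<rfloor>)" by (auto simp: int_lattice_def vec_eq_iff)
  then show "\<exists>f :: 'n \<Rightarrow> int. z = (\<chi> i. of_int (f i))" by (intro exI[of _ "\<lambda>i. \<lfloor>z $ i\<rfloor>"])
qed (auto simp: int_lattice_def)

lemma countable_int_lattice: "countable (int_lattice :: (real^'n) set)"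
proof -
  have eq: "(int_lattice :: (real^'n) set) = range (\<lambda>f :: 'n \<Rightarrow> int. \<chi> i. of_int (f i))"
    by (auto simp: int_lattice_iff)
  show ?thesis unfolding eq by (intro countable_image countableI_type)
qed

lemma finite_int_lattice_cball: "finite (int_lattice \<inter> cball 0 R :: (real^'n) set)"
proof (rule finite_subset)
  let ?F = "PiE (UNIV :: 'n set) (\<lambda>_. {-\<lceil>R\<rceil>..\<lceil>R\<rceil>})"
  show "int_lattice \<inter> cball 0 R \<subseteq> (\<lambda>f. (\<chi> i. of_int (f i)) :: real^'n) ` ?F"
  proof
    fix z :: "real^'n" assume z: "z \<in> int_lattice \<inter> cball 0 R"
    then obtain f :: "'n \<Rightarrow> int" where f: "z = (\<chi> i. of_int (f i))" by (auto simp: int_lattice_iff)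
    have "f i \<in> {-\<lceil>R\<rceil>..\<lceil>R\<rceil>}" for i
    proof -
      have "\<bar>z $ i\<bar> \<le> R" using component_le_norm_cart[of z i] z by simp
      then have "\<bar>real_of_int (f i)\<bar> \<le> R" by (simp add: f)
      then have "\<bar>f i\<bar> \<le> \<lceil>R\<rceil>" by linarith
      then show ?thesis by auto
    qed
    then have "f \<in> ?F" by (auto simp: PiE_iff)
    then show "z \<in> (\<lambda>f. (\<chi> i. of_int (f i)) :: real^'n) ` ?F" using f by blast
  qed
  show "finite ((\<lambda>f. (\<chi> i. of_int (f i)) :: real^'n) ` ?F)" by (intro finite_imageI finite_PiE) auto
qed

lemma continuous_matrix_vector: "continuous_on UNIV (\<lambda>g::real^'n^'n. g *v z)"
  unfolding matrix_vector_mult_def by (intro continuous_intros)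

text \<open>There are only countably many finite sets of integer vectors, and each fixed one imposes
  a closed condition on \<open>g\<close>.\<close>

lemma borel_pts:
  fixes B :: "(real^'n) set"
  assumes "closed B"
  shows "{g. lattice_pts g B K} \<in> sets borel"
proof -
  let ?\<Z> = "{Z :: (real^'n) set. finite Z \<and> Z \<subseteq> int_lattice}"
  have c: "countable ?\<Z>" using countable_Collect_finite_subset[OF countable_int_lattice] .
  have "{g. lattice_pts g B K} = (\<Union>Z\<in>{Z \<in> ?\<Z>. K \<le> real (card Z)}. (\<Inter>z\<in>Z. (\<lambda>g. g *v z) -` B))"
    by (auto simp: lattice_pts_def)
  moreover have "(\<Inter>z\<in>Z. (\<lambda>g. g *v z) -` B) \<in> sets borel" for Z :: "(real^'n) set"
    by (intro borel_closed closed_INT ballI closed_vimage assms continuous_matrix_vector)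
  moreover have "countable {Z \<in> ?\<Z>. K \<le> real (card Z)}" by (rule countable_subset[OF _ c]) auto
  ultimately show ?thesis by auto
qed

section \<open>Lattices given by matrices and their reduced bases\<close>

lemma is_lattice_image:
  fixes Y :: "real^'n^'n"
  assumes c: "0 < c" and Y: "\<And>x. c * norm x \<le> norm (Y *v x)"
  shows "is_lattice ((\<lambda>z. Y *v z) ` int_lattice)"
  unfolding is_lattice_def
proof (intro conjI ballI allI)
  fix v w assume "v \<in> (\<lambda>z. Y *v z) ` int_lattice" "w \<in> (\<lambda>z. Y *v z) ` int_lattice"
  then show "v + w \<in> (\<lambda>z. Y *v z) ` int_lattice"
    by (auto simp: int_lattice_def matrix_vector_right_distrib[symmetric])
next
  fix v and n :: int assume "v \<in> (\<lambda>z. Y *v z) ` int_lattice"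
  then show "of_int n *\<^sub>R v \<in> (\<lambda>z. Y *v z) ` int_lattice"
    by (auto simp: int_lattice_def matrix_vector_mult_scaleR[symmetric])
next
  fix R
  have "(\<lambda>z. Y *v z) ` int_lattice \<inter> cball 0 R \<subseteq> (\<lambda>z. Y *v z) ` (int_lattice \<inter> cball 0 (R / c))"
  proof
    fix v assume "v \<in> (\<lambda>z. Y *v z) ` int_lattice \<inter> cball 0 R"
    then obtain z where z: "z \<in> int_lattice" "v = Y *v z" "norm (Y *v z) \<le> R" by auto
    then have "norm z \<le> R / c" using Y[of z] c by (simp add: pos_le_divide_eq mult.commute)
    then show "v \<in> (\<lambda>z. Y *v z) ` (int_lattice \<inter> cball 0 (R / c))" using z by auto
  qed
  then show "finite ((\<lambda>z. Y *v z) ` int_lattice \<inter> cball 0 R)"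
    by (rule finite_subset) (intro finite_imageI finite_int_lattice_cball)
next
  have lin: "linear (\<lambda>z. Y *v z)" by simp
  have "inj (\<lambda>z. Y *v z)"
  proof (subst linear_injective_0[OF lin], intro allI impI)
    fix x assume "Y *v x = 0"
    then have "c * norm x \<le> 0" using Y[of x] by simp
    then show "x = 0" using c by (simp add: mult_le_0_iff)
  qed
  then have "surj (\<lambda>z. Y *v z)" using lin linear_injective_imp_surjective by blast
  have "(Basis :: (real^'n) set) \<subseteq> int_lattice"
    by (auto simp: Basis_vec_def int_lattice_def axis_def)
  then have "span (int_lattice :: (real^'n) set) = UNIV"
    by (metis span_Basis span_mono top.extremum_uniqueI)
  then show "span ((\<lambda>z. Y *v z) ` int_lattice) = UNIV"
    using \<open>surj _\<close> by (simp add: linear_span_image[OF lin])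
qed

lemma colmat_mult: "B ** colmat x = colmat (\<lambda>i. B *v x i)"
  by (simp add: vec_eq_iff colmat_def matrix_matrix_mult_def matrix_vector_mult_def)

text \<open>The columns of \<open>G\<close> are the integer coordinates of the reduced basis with
  respect to \<open>Y\<close>. Its integral inverse comes from writing each image
  \<open>Y *v axis j 1\<close> as an integer combination of the basis and cancelling the injective
  \<open>Y\<close>.\<close>

lemma ex_reduced_matrix:
  fixes Y :: "real^'n^'n"
  assumes c: "0 < c" and Y: "\<And>x. c * norm x \<le> norm (Y *v x)"
  defines "L \<equiv> (\<lambda>z. Y *v z) ` int_lattice"
  shows "\<exists>x G. G \<in> GLZ \<and> Y ** G = colmat x \<and> reduced L x CARD('n) \<and> L \<subseteq> zspan x CARD('n)"
proof -
  let ?N = "CARD('n)"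
  have L: "is_lattice L" unfolding L_def using c Y by (rule is_lattice_image)
  obtain x where x: "reduced L x ?N" using ex_reduced[OF L, of ?N] by auto
  have "span (x ` {..<DIM(real^'n)}) = UNIV"
    by (rule span_gs_full) (use x in \<open>auto simp: reduced_def\<close>)
  then have Lz: "L \<subseteq> zspan x ?N" using reduced_zspan[OF L x order_refl] by auto
  have "\<forall>i\<in>{..<?N}. \<exists>z. z \<in> int_lattice \<and> x i = Y *v z" using x by (auto simp: reduced_def L_def)
  from bchoice[OF this] obtain \<gamma>
    where \<gamma>: "\<And>i. i < ?N \<Longrightarrow> \<gamma> i \<in> int_lattice" "\<And>i. i < ?N \<Longrightarrow> x i = Y *v \<gamma> i" by auto
  have inj: "u = v" if "Y *v u = Y *v v" for u v
  proof -
    have "c * norm (u - v) \<le> 0" using Y[of "u - v"] that by (simp add: matrix_vector_mult_diff_distrib)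
    then show ?thesis using c by (simp add: mult_le_0_iff)
  qed
  have "\<forall>j::'n. \<exists>n::nat \<Rightarrow> int. axis j 1 = (\<Sum>i<?N. of_int (n i) *\<^sub>R \<gamma> i)"
  proof
    fix j :: 'n
    have "Y *v axis j 1 \<in> L" by (auto simp: L_def int_lattice_def axis_def)
    then obtain n :: "nat \<Rightarrow> int" where "Y *v axis j 1 = (\<Sum>i<?N. of_int (n i) *\<^sub>R x i)"
      using Lz by (auto simp: zspan_def)
    also have "\<dots> = Y *v (\<Sum>i<?N. of_int (n i) *\<^sub>R \<gamma> i)"
      by (simp add: \<gamma>(2) linear_sum[OF matrix_vector_mul_linear] matrix_vector_mult_scaleR)
    finally show "\<exists>n::nat \<Rightarrow> int. axis j 1 = (\<Sum>i<?N. of_int (n i) *\<^sub>R \<gamma> i)" using inj by blast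
  qed
  from choice[OF this] obtain n :: "'n \<Rightarrow> nat \<Rightarrow> int"
    where n: "\<And>j. axis j 1 = (\<Sum>i<?N. of_int (n j i) *\<^sub>R \<gamma> i)" by blast
  define B where "B = (\<chi> c j. of_int (n j (idx c)) :: real^'n^'n)"
  have "colmat \<gamma> ** B = mat 1"
  proof -
    have "(colmat \<gamma> ** B) $ r $ j = mat 1 $ r $ j" for r j
    proof -
      have "(colmat \<gamma> ** B) $ r $ j = (\<Sum>c\<in>(UNIV::'n set). \<gamma> (idx c) $ r * of_int (n j (idx c)))"
        by (simp add: matrix_matrix_mult_def colmat_def B_def)
      also have "\<dots> = (\<Sum>i<?N. \<gamma> i $ r * of_int (n j i))" by (rule sum_idx[of "\<lambda>i. \<gamma> i $ r * of_int (n j i)"])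
      also have "\<dots> = (\<Sum>i<?N. of_int (n j i) *\<^sub>R \<gamma> i) $ r" by (simp add: mult.commute)
      also have "\<dots> = axis j 1 $ r" by (simp add: n[symmetric])
      finally show ?thesis by (simp add: axis_def mat_def)
    qed
    then show ?thesis by (simp add: vec_eq_iff)
  qed
  moreover have "int_mat (colmat \<gamma>)" using \<gamma>(1) by (auto simp: int_mat_def colmat_def int_lattice_def idx_less)
  moreover have "int_mat B" by (simp add: int_mat_def B_def)
  ultimately have "colmat \<gamma> \<in> GLZ" by (auto simp: GLZ_def)
  moreover have "Y ** colmat \<gamma> = colmat x"
    by (simp add: colmat_mult) (simp add: colmat_def \<gamma>(2) idx_less)
  ultimately show ?thesis using x Lz by blast
qed

text \<open>Only short Gram-Schmidt vectors make the count large. Beyond \<open>k\<close> all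
  lengths are at least 1 and each factor is at most \<tau> = 2\<rho> + 2^N. Before \<open>k\<close>,
  almost monotonicity and a last length below 1 bound all lengths by 2^N, so each factor is at most
  \<tau> divided by the length.\<close>

lemma reduced_prefix:
  fixes x :: "nat \<Rightarrow> 'a::euclidean_space"
  assumes x: "reduced L x N" and \<rho>: "0 \<le> \<rho>" and K: "K \<le> (\<Prod>i<N. 2 * \<rho> / norm (gs x i) + 1)"
  shows "\<exists>k\<le>N. K * gprod x k \<le> (2 * \<rho> + 2 ^ N) ^ N"
proof -
  let ?r = "\<lambda>i. norm (gs x i)" and ?\<tau> = "2 * \<rho> + 2 ^ N"
  have r: "0 < ?r i" if "i < N" for i using x that by (auto simp: reduced_def)
  define P where "P k \<longleftrightarrow> (\<forall>i<N. k \<le> i \<longrightarrow> 1 \<le> ?r i)" for k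
  \<comment> \<open>This is one more than the last index whose Gram-Schmidt length is below 1, or 0
    if there is none.\<close>
  define k where "k = (LEAST k. P k)"
  have PN: "P N" by (auto simp: P_def)
  have k1: "k \<le> N" unfolding k_def using PN by (rule Least_le)
  have "P k" unfolding k_def using PN by (rule LeastI)
  then have k2: "1 \<le> ?r i" if "i < N" "k \<le> i" for i using that unfolding P_def by blast
  note k = k1 k2
  have rk: "?r i \<le> 2 ^ N" if i: "i < k" for i
  proof -
    have "k - 1 < k" using i by auto
    then have "\<not> P (k - 1)" unfolding k_def by (rule not_less_Least)
    then obtain l where "l < N" "k - 1 \<le> l" "?r l < 1" unfolding P_def by (auto simp: not_le)
    moreover from this have "\<not> k \<le> l" using k(2)[of l] by auto
    ultimately have "l = k - 1" by linarith
    then have l: "?r (k - 1) < 1" using \<open>?r l < 1\<close> by simp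
    have "?r i \<le> 2 ^ (k - 1 - i) * ?r (k - 1)" using reduced_le[OF x, of i "k - 1 - i"] i k(1) by simp
    also have "\<dots> \<le> 2 ^ N * 1" using l k(1) by (intro mult_mono power_increasing) auto
    finally show ?thesis by simp
  qed
  have A: "(\<Prod>i<k. 2 * \<rho> / ?r i + 1) \<le> (\<Prod>i<k. ?\<tau> / ?r i)"
  proof (rule prod_mono, rule conjI)
    fix i assume i: "i \<in> {..<k}"
    then have "0 < ?r i" using r[of i] k(1) by auto
    then have "2 * \<rho> / ?r i + 1 = (2 * \<rho> + ?r i) / ?r i" by (simp add: field_simps)
    also have "\<dots> \<le> ?\<tau> / ?r i" using rk[of i] i by (intro divide_right_mono) auto
    finally show "2 * \<rho> / ?r i + 1 \<le> ?\<tau> / ?r i" .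
    show "0 \<le> 2 * \<rho> / ?r i + 1" using \<rho> by simp
  qed
  have B: "(\<Prod>i\<in>{k..<N}. 2 * \<rho> / ?r i + 1) \<le> (\<Prod>i\<in>{k..<N}. ?\<tau>)"
  proof (rule prod_mono, rule conjI)
    fix i assume i: "i \<in> {k..<N}"
    then have r1: "1 \<le> ?r i" using k(2) by auto
    then have "2 * \<rho> / ?r i \<le> 2 * \<rho> / 1" using \<rho> by (intro divide_left_mono) auto
    moreover have "(1::real) \<le> 2 ^ N" by simp
    ultimately show "2 * \<rho> / ?r i + 1 \<le> ?\<tau>" by linarith
    show "0 \<le> 2 * \<rho> / ?r i + 1" using \<rho> by simp
  qed
  have \<tau>0: "0 \<le> ?\<tau>" using \<rho> by simp
  have "(\<Prod>i<N. 2 * \<rho> / ?r i + 1) = (\<Prod>i<k. 2 * \<rho> / ?r i + 1) * (\<Prod>i\<in>{k..<N}. 2 * \<rho> / ?r i + 1)"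
    using k(1) by (subst prod.union_disjoint[symmetric]) (auto simp: ivl_disj_un)
  moreover have "\<dots> \<le> (\<Prod>i<k. ?\<tau> / ?r i) * (\<Prod>i\<in>{k..<N}. ?\<tau>)"
    by (intro mult_mono A B prod_nonneg ballI divide_nonneg_nonneg add_nonneg_nonneg \<tau>0 norm_ge_zero) (use \<rho> in simp_all)
  ultimately have 1: "K \<le> (\<Prod>i<k. ?\<tau> / ?r i) * (\<Prod>i\<in>{k..<N}. ?\<tau>)" using K by linarith
  have "(\<Prod>i<k. ?\<tau> / ?r i) = ?\<tau> ^ k / gprod x k" by (simp add: prod_dividef gprod_def)
  moreover have "(\<Prod>i\<in>{k..<N}. ?\<tau>) = ?\<tau> ^ (N - k)" by simp
  moreover have "?\<tau> ^ k * ?\<tau> ^ (N - k) = ?\<tau> ^ N" using k(1) by (subst power_add[symmetric]) simp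
  ultimately have "K \<le> ?\<tau> ^ N / gprod x k" using 1 by (simp only: times_divide_eq_left)
  moreover have "0 < gprod x k" by (rule gprod_pos) (metis r k(1) less_le_trans norm_eq_zero less_irrefl)
  ultimately show ?thesis using k(1) by (auto simp: pos_le_divide_eq)
qed

text \<open>Each of the lengths of index i, ..., e-1 is at least 2^-N times the one of index
  \<open>i\<close>, so the power may be replaced by their product; at most N factors 2^N are lost. A
  bound on the single number \<open>gprod x e\<close> thereby controls every earlier stage of the
  integration.\<close>

lemma reduced_power_le:
  fixes x :: "nat \<Rightarrow> 'a::euclidean_space"
  assumes x: "reduced L x N" and i: "i < e" "e \<le> N"
  shows "gprod x i * norm (gs x i) ^ (e - i) \<le> 2 ^ (N * N) * gprod x e"
proof -
  let ?r = "\<lambda>i. norm (gs x i)"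
  have "?r i ^ (e - i) = (\<Prod>j\<in>{i..<e}. ?r i)" by simp
  also have "\<dots> \<le> (\<Prod>j\<in>{i..<e}. 2 ^ N * ?r j)"
  proof (intro prod_mono conjI)
    fix j assume j: "j \<in> {i..<e}"
    have "?r i \<le> 2 ^ (j - i) * ?r j" using reduced_le[OF x, of i "j - i"] j i by simp
    also have "\<dots> \<le> 2 ^ N * ?r j" using j i by (intro mult_right_mono power_increasing) auto
    finally show "?r i \<le> 2 ^ N * ?r j" .
  qed auto
  also have "\<dots> = 2 ^ (N * (e - i)) * (\<Prod>j\<in>{i..<e}. ?r j)" by (simp add: prod.distrib power_mult)
  also have "\<dots> \<le> 2 ^ (N * N) * (\<Prod>j\<in>{i..<e}. ?r j)"
    using i by (intro mult_right_mono power_increasing mult_le_mono prod_nonneg) auto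
  finally have 1: "?r i ^ (e - i) \<le> 2 ^ (N * N) * (\<Prod>j\<in>{i..<e}. ?r j)" .
  have 2: "gprod x e = gprod x i * (\<Prod>j\<in>{i..<e}. ?r j)"
    unfolding gprod_def using i by (subst prod.union_disjoint[symmetric]) (auto simp: ivl_disj_un)
  show ?thesis unfolding 2 using mult_left_mono[OF 1 gprod_nonneg[of x i]] by (simp add: mult_ac)
qed

lemma reduced_imp_red_set:
  fixes x :: "nat \<Rightarrow> 'a::euclidean_space"
  assumes x: "reduced L x N" and k: "k \<le> N" and \<eta>: "2 ^ (N * N) * gprod x k \<le> \<delta>" and \<zeta>: "2 ^ (N * N) * gprod x N \<le> \<Delta>"
  shows "x \<in> red_set (\<lambda>i. if i < k then \<delta> else \<Delta>) (\<lambda>i. if i < k then k else N) N"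
proof -
  have "red_at (if i < k then \<delta> else \<Delta>) (if i < k then k else N) x i" if i: "i < N" for i
  proof -
    from x i have "gs x i \<noteq> 0" and j: "\<forall>j<i. \<bar>x i \<bullet> gs x j\<bar> \<le> (norm (gs x j))\<^sup>2 / 2"
      unfolding reduced_def by blast+
    then have "0 < norm (gs x i)" by simp
    moreover have "\<forall>j<i. \<bar>x i \<bullet> gs x j\<bar> \<le> (norm (gs x j))\<^sup>2"
      using j by (smt (verit) zero_le_power2 field_sum_of_halves)
    moreover have "gprod x i * norm (gs x i) ^ ((if i < k then k else N) - i) \<le> (if i < k then \<delta> else \<Delta>)"
    proof (cases "i < k")
      case True
      then show ?thesis using order_trans[OF reduced_power_le[OF x True k] \<eta>] by simp
    next
      case False
      then show ?thesis using order_trans[OF reduced_power_le[OF x i order_refl] \<zeta>] by simp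
    qed
    ultimately show ?thesis unfolding red_at_def by blast
  qed
  then show ?thesis unfolding red_set_def by blast
qed

section \<open>Near-orthogonal matrices and the cusp of the space of lattices\<close>

definition near_orth :: "(real^'n^'n) set" where
  "near_orth = {g. \<forall>x. norm x \<le> 2 * norm (g *v x) \<and> norm (g *v x) \<le> 2 * norm x}"

lemma closed_near_orth: "closed (near_orth :: (real^'n^'n) set)"
proof -
  have "(near_orth :: (real^'n^'n) set) = (\<Inter>x. {g. norm x \<le> 2 * norm (g *v x)} \<inter> {g. norm (g *v x) \<le> 2 * norm x})"
    by (auto simp: near_orth_def)
  moreover have "closed \<dots>"
    by (intro closed_INT ballI closed_Int closed_Collect_le continuous_on_mult continuous_on_const
        continuous_on_norm continuous_matrix_vector)
  ultimately show ?thesis by simp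
qed

text \<open>Inverse to \<open>colmat\<close>; the restriction makes the values extensional, as
  points of the product space \<open>PN\<close> have to be.\<close>

definition colsof :: "real^'n^'n \<Rightarrow> nat \<Rightarrow> real^'n" where
  "colsof X = (\<lambda>i\<in>{..<CARD('n)}. column (inv_into UNIV idx i) X)"

lemma inv_idx: "inv_into UNIV idx (idx i) = i"
  by (simp add: inj_def inv_f_f)

lemma colmat_colsof: "colmat (colsof X) = X"
  by (simp add: vec_eq_iff colmat_def colsof_def idx_less inv_idx column_def)

lemma colsof_colmat: "colsof (colmat x) = restrict x {..<CARD('n)}" for x :: "nat \<Rightarrow> real^'n"
proof
  fix i
  show "colsof (colmat x) i = restrict x {..<CARD('n)} i"
  proof (cases "i < CARD('n)")
    case True
    then obtain c :: 'n where "idx c = i" using idx_surj by blast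
    then show ?thesis using True by (auto simp: colsof_def colmat_def column_def inv_idx vec_eq_iff)
  qed (simp add: colsof_def)
qed

lemma measurable_colsof: "colsof \<in> borel \<rightarrow>\<^sub>M (PN :: (nat \<Rightarrow> real^'n) measure)"
  unfolding colsof_def
proof (rule measurable_restrict)
  fix i
  have "(\<lambda>X::real^'n^'n. column (inv_into UNIV idx i) X) \<in> borel_measurable borel"
    by (rule measurable_vecI) (simp add: column_def)
  then show "(\<lambda>X::real^'n^'n. column (inv_into UNIV idx i) X) \<in> borel \<rightarrow>\<^sub>M lborel" by simp
qed

lemma red_set_restrict: "restrict x {..<N} \<in> red_set q e N \<longleftrightarrow> x \<in> red_set q e N"
proof -
  have "red_at (q i) (e i) (restrict x {..<N}) i = red_at (q i) (e i) x i" if "i < N" for i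
    using that by (intro red_at_cong) auto
  then show ?thesis by (simp add: red_set_def)
qed

lemma borel_colsof_red_set: "colsof -` (red_set q e CARD('n)) \<in> sets (borel :: (real^'n^'n) measure)"
proof -
  have "colsof -` (red_set q e CARD('n)) = colsof -` (red_set q e CARD('n) \<inter> space (PN :: (nat \<Rightarrow> real^'n) measure))"
    by (auto simp: colsof_def space_PiM)
  then show ?thesis using measurable_sets[OF measurable_colsof measurable_red_set[of q e "CARD('n)"]] by simp
qed

lemma emeasure_colsof_red_set:
  "emeasure lborel (colsof -` (red_set q e CARD('n)) :: (real^'n^'n) set)
    = emeasure PN (red_set q e CARD('n) \<inter> space (PN :: (nat \<Rightarrow> real^'n) measure))"
proof -
  have "emeasure lborel (colsof -` (red_set q e CARD('n)) :: (real^'n^'n) set)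
    = emeasure PN (colmat -` (colsof -` (red_set q e CARD('n))) \<inter> space (PN :: (nat \<Rightarrow> real^'n) measure))"
    by (subst lborel_colmat, subst emeasure_distr) (auto simp: borel_colsof_red_set)
  also have "colmat -` (colsof -` (red_set q e CARD('n))) \<inter> space (PN :: (nat \<Rightarrow> real^'n) measure)
     = red_set q e CARD('n) \<inter> space PN"
    by (auto simp: colsof_colmat red_set_restrict)
  finally show ?thesis .
qed

text \<open>Hadamard's inequality: Gram-Schmidt lengths do not exceed column lengths, and columns
  are images of unit vectors.\<close>

lemma det_near_orth: "n \<in> near_orth \<Longrightarrow> \<bar>det n\<bar> \<le> 2 ^ CARD('n)" for n :: "real^'n^'n"
proof -
  assume n: "n \<in> near_orth"
  have c: "norm (colsof n i) \<le> 2" if "i < CARD('n)" for i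
  proof -
    let ?c = "inv_into UNIV idx i :: 'n"
    have "column ?c n = n *v axis ?c 1" by (simp add: matrix_vector_mult_basis)
    moreover have "norm (n *v axis ?c 1) \<le> 2 * norm (axis ?c 1 :: real^'n)" using n unfolding near_orth_def by blast
    ultimately show ?thesis using that by (simp add: colsof_def norm_axis_1)
  qed
  have "\<bar>det n\<bar> = (\<Prod>i<CARD('n). norm (gs (colsof n) i))" using det_colmat[of "colsof n"] by (simp add: colmat_colsof)
  also have "\<dots> \<le> (\<Prod>i<CARD('n). 2)"
    using order_trans[OF norm_gs_le c] by (intro prod_mono conjI) auto
  finally show ?thesis by simp
qed

definition diag_mat :: "('n \<Rightarrow> real) \<Rightarrow> real^'n^'n" where
  "diag_mat a = (\<chi> i j. if i = j then a i else 0)"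

lemma diag_mat_mult_vec: "(diag_mat a *v y) $ i = a i * y $ i"
proof -
  have "(diag_mat a *v y) $ i = (\<Sum>j\<in>UNIV. if j = i then a i * y $ i else 0)"
    unfolding matrix_vector_mult_def vec_lambda_beta by (rule sum.cong) (auto simp: diag_mat_def)
  then show ?thesis by simp
qed

lemma det_diag_mat: "det (diag_mat a) = (\<Prod>i\<in>UNIV. a i)"
  using det_diagonal[of "diag_mat a"] by (simp add: diag_mat_def)

lemma norm_diag_mat_le:
  assumes "\<And>i. 0 \<le> a i"
  shows "norm (diag_mat a *v y) \<le> (\<Sum>i\<in>UNIV. a i) * norm y"
proof -
  have "norm (diag_mat a *v y) \<le> (\<Sum>i\<in>UNIV. \<bar>(diag_mat a *v y) $ i\<bar>)" by (rule norm_le_l1_cart)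
  also have "\<dots> \<le> (\<Sum>i\<in>UNIV. a i * norm y)"
    using assms component_le_norm_cart[of y] by (intro sum_mono) (simp add: diag_mat_mult_vec abs_mult mult_left_mono)
  finally show ?thesis by (simp add: sum_distrib_right)
qed

lemma near_orthD: "g \<in> near_orth \<Longrightarrow> norm x \<le> 2 * norm (g *v x)" "g \<in> near_orth \<Longrightarrow> norm (g *v x) \<le> 2 * norm x"
  unfolding near_orth_def by blast+

text \<open>The length \<open>k\<close> of the short prefix depends on the lattice, hence the union.
  With \<delta> of order 1/K this is a cusp neighbourhood in the space of lattices. The empty prefix
  has product 1 and can satisfy the bound only if \<open>1 \<le> \<delta>\<close>.\<close>

definition cusp :: "real \<Rightarrow> real \<Rightarrow> (real^'n^'n) set" where
  "cusp \<delta> \<Delta> = (\<Union>k\<in>{k. k \<le> CARD('n) \<and> (k = 0 \<longrightarrow> 1 \<le> \<delta>)}.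
     colsof -` red_set (\<lambda>i. if i < k then \<delta> else \<Delta>) (\<lambda>i. if i < k then k else CARD('n)) CARD('n))"

lemma borel_cusp: "(cusp \<delta> \<Delta> :: (real^'n^'n) set) \<in> sets borel"
proof -
  have "finite {k. k \<le> CARD('n) \<and> (k = 0 \<longrightarrow> 1 \<le> \<delta>)}" by (rule finite_subset[of _ "{..CARD('n)}"]) auto
  then show ?thesis unfolding cusp_def by (intro sets.finite_UN borel_colsof_red_set)
qed

lemma of_nat_mult_ennreal: "0 \<le> t \<Longrightarrow> of_nat n * ennreal t = ennreal (real n * t)"
  by (simp add: ennreal_mult ennreal_of_nat_eq_real_of_nat)

lemma emeasure_cusp_le:
  assumes \<delta>: "0 < \<delta>" and \<Delta>: "0 < \<Delta>"
  shows "emeasure lborel (cusp \<delta> \<Delta> :: (real^'n^'n) set)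
    \<le> ennreal (real (CARD('n) + 1) * ((2 ^ (2 * CARD('n) + 1) * (\<Delta> + 1)) ^ CARD('n) * \<delta> ^ CARD('n)))"
proof -
  let ?N = "CARD('n)"
  define c :: real where "c = 2 ^ (2 * ?N + 1)"
  have c: "0 < c" by (simp add: c_def)
  \<comment> \<open>The summand 1 makes \<open>c * (\<Delta> + 1)\<close> dominate both
    \<open>c * \<Delta>\<close> and \<open>c\<close>, so one bound serves all
    \<open>k\<close>.\<close>
  define b where "b = (c * (\<Delta> + 1)) ^ ?N * \<delta> ^ ?N"
  have b: "0 \<le> b" unfolding b_def using c \<Delta> \<delta> by (intro mult_nonneg_nonneg zero_le_power) auto
  define Ks where "Ks = {k. k \<le> ?N \<and> (k = 0 \<longrightarrow> 1 \<le> \<delta>)}"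
  define R :: "nat \<Rightarrow> (nat \<Rightarrow> real^'n) set"
    where "R k = red_set (\<lambda>i. if i < k then \<delta> else \<Delta>) (\<lambda>i. if i < k then k else ?N) ?N" for k
  have KsN: "Ks \<subseteq> {..?N}" by (auto simp: Ks_def)
  have Ks: "finite Ks" using KsN by (rule finite_subset) simp
  have cKs: "card Ks \<le> ?N + 1" using card_mono[OF _ KsN] by simp
  have Rm: "colsof -` R k \<in> sets (borel :: (real^'n^'n) measure)" for k
    unfolding R_def by (rule borel_colsof_red_set)
  have Rb: "emeasure lborel (colsof -` R k :: (real^'n^'n) set) \<le> ennreal b" if k: "k \<in> Ks" for k
  proof -
    have kN: "k \<le> ?N" and k0: "k = 0 \<Longrightarrow> 1 \<le> \<delta>" using k by (simp_all add: Ks_def)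
    have "emeasure lborel (colsof -` R k :: (real^'n^'n) set) \<le> ennreal ((c * \<Delta>) ^ (?N - k) * c ^ k * \<delta> ^ ?N)"
      unfolding R_def emeasure_colsof_red_set c_def by (rule emeasure_red_set_le[OF kN \<Delta> \<delta> k0])
    moreover have "(c * \<Delta>) ^ (?N - k) * c ^ k \<le> (c * (\<Delta> + 1)) ^ (?N - k) * (c * (\<Delta> + 1)) ^ k"
      using c \<Delta> by (intro mult_mono power_mono) auto
    moreover have "(c * (\<Delta> + 1)) ^ (?N - k) * (c * (\<Delta> + 1)) ^ k = (c * (\<Delta> + 1)) ^ ?N"
      using kN by (subst power_add[symmetric]) simp
    ultimately show ?thesis
      unfolding b_def using \<delta> by (elim order_trans) (intro ennreal_leI mult_right_mono, simp_all)
  qed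
  have "emeasure lborel (\<Union>k\<in>Ks. colsof -` R k :: (real^'n^'n) set) \<le> (\<Sum>k\<in>Ks. emeasure lborel (colsof -` R k :: (real^'n^'n) set))"
    using Ks Rm by (intro emeasure_subadditive_finite) auto
  also have "\<dots> \<le> (\<Sum>k\<in>Ks. ennreal b)" by (intro sum_mono Rb)
  also have "\<dots> = of_nat (card Ks) * ennreal b" by simp
  also have "\<dots> \<le> of_nat (?N + 1) * ennreal b" by (intro mult_right_mono of_nat_mono cKs) simp
  also have "\<dots> = ennreal (real (?N + 1) * b)" using b by (rule of_nat_mult_ennreal)
  finally show ?thesis unfolding cusp_def R_def Ks_def b_def c_def .
qed

text \<open>The norm of W v is at most twice that of D Y W v = D Y' v, hence at most 4 times that of
  v. The factor \<open>D\<close> cancels, so the bound does not see the shape of the box.\<close>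

lemma near_orth_int_mat_le:
  fixes D Y Y' W :: "real^'n^'n"
  assumes Y: "D ** Y \<in> near_orth" and Y': "D ** Y' \<in> near_orth" and W: "Y ** W = Y'"
  shows "\<bar>W $ i $ j\<bar> \<le> 4"
proof -
  have "D ** Y' = (D ** Y) ** W" unfolding W[symmetric] by (rule matrix_mul_assoc)
  then have e: "(D ** Y) *v (W *v v) = (D ** Y') *v v" for v by (simp add: matrix_vector_mul_assoc)
  have "norm (W *v v) \<le> 4 * norm v" for v
    using near_orthD(1)[OF Y, of "W *v v"] near_orthD(2)[OF Y', of v] unfolding e by linarith
  from this[of "axis j 1"] have "norm (column j W) \<le> 4" by (simp add: matrix_vector_mult_basis norm_axis_1)
  then show ?thesis using component_le_norm_cart[of "column j W" i] by (simp add: column_def)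
qed

text \<open>Dividing coordinate \<open>i\<close> by \<open>a i\<close> turns the box into a cube
  inside the ball of radius \<kappa>N. A reduced basis of the lattice of \<open>Y\<close> supplies
  \<open>H\<close>. The value of \<delta> is the prefix bound divided by \<open>K\<close>, and
  \<Delta> comes from |det Y| \<le> 2^N / (product of the sides); both carry the factor 2^(N*N) lost
  in \<open>reduced_power_le\<close>.\<close>

lemma pts_imp_cusp:
  fixes a :: "'n::finite \<Rightarrow> real" and Y :: "real^'n^'n"
  assumes a: "\<And>i. 0 < a i" and \<kappa>: "0 \<le> \<kappa>" and K: "1 \<le> K"
    and Y: "diag_mat a ** Y \<in> near_orth" and pts: "lattice_pts (diag_mat a ** Y) (abox (\<lambda>i. \<kappa> * a i)) K"
  defines "\<delta> \<equiv> 2 ^ (CARD('n) * CARD('n)) * (2 * (\<kappa> * CARD('n)) + 2 ^ CARD('n)) ^ CARD('n) / K"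
    and "\<Delta> \<equiv> 2 ^ (CARD('n) * CARD('n)) * (2 ^ CARD('n) / (\<Prod>i\<in>UNIV. a i))"
  shows "\<exists>H\<in>GLZ. Y ** H \<in> cusp \<delta> \<Delta>"
proof -
  let ?N = "CARD('n)" and ?s = "\<Sum>i\<in>UNIV. a i" and ?P = "\<Prod>i\<in>UNIV. a i"
  define \<rho> where "\<rho> = \<kappa> * ?N"
  have \<rho>: "0 \<le> \<rho>" using \<kappa> by (simp add: \<rho>_def)
  define \<tau> where "\<tau> = (2 * \<rho> + 2 ^ ?N) ^ ?N"
  define G :: real where "G = 2 ^ (?N * ?N)"
  have G: "1 \<le> G" by (simp add: G_def)
  have P: "0 < ?P" using a by (intro prod_pos) auto
  have s: "0 < ?s" using a by (intro sum_pos) auto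
  \<comment> \<open>This lower bound depends on the individual sides, but it serves only to show
    that \<open>Y\<close> is injective with discrete image; it enters neither \<delta> nor
    \<Delta>.\<close>
  define c0 where "c0 = inverse (2 * ?s)"
  have c0: "0 < c0" using s by (simp add: c0_def)
  have Dv: "diag_mat a *v (Y *v z) = (diag_mat a ** Y) *v z" for z by (simp add: matrix_vector_mul_assoc)
  have Yl: "c0 * norm x \<le> norm (Y *v x)" for x
  proof -
    have "norm x \<le> 2 * norm (diag_mat a *v (Y *v x))" using near_orthD(1)[OF Y] by (simp only: Dv)
    also have "norm (diag_mat a *v (Y *v x)) \<le> ?s * norm (Y *v x)" using a by (intro norm_diag_mat_le less_imp_le)
    finally have "norm x \<le> (2 * ?s) * norm (Y *v x)" by simp
    then have "c0 * norm x \<le> c0 * ((2 * ?s) * norm (Y *v x))" using c0 by (intro mult_left_mono) auto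
    then show ?thesis using s by (simp add: c0_def mult.assoc[symmetric])
  qed
  define L where "L = (\<lambda>z. Y *v z) ` int_lattice"
  obtain x H where H: "H \<in> GLZ" "Y ** H = colmat x" and x: "reduced L x ?N" "L \<subseteq> zspan x ?N"
    using ex_reduced_matrix[OF c0 Yl] unfolding L_def by blast
  obtain Z where Z: "finite Z" "Z \<subseteq> int_lattice" "K \<le> real (card Z)"
    "\<And>z. z \<in> Z \<Longrightarrow> (diag_mat a ** Y) *v z \<in> abox (\<lambda>i. \<kappa> * a i)"
    using pts unfolding lattice_pts_def by blast
  have inj: "inj_on (\<lambda>z. Y *v z) Z"
  proof (rule inj_onI)
    fix u v assume "Y *v u = Y *v v"
    then have "c0 * norm (u - v) \<le> 0" using Yl[of "u - v"] by (simp add: matrix_vector_mult_diff_distrib)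
    then show "u = v" using c0 by (simp add: mult_le_0_iff)
  qed
  let ?B = "{w \<in> zspan x ?N. norm (w - 0) \<le> \<rho>}"
  have sub: "(\<lambda>z. Y *v z) ` Z \<subseteq> ?B"
  proof (rule image_subsetI)
    fix z assume z: "z \<in> Z"
    have "\<bar>(Y *v z) $ i\<bar> \<le> \<kappa>" for i
    proof -
      have "\<bar>a i * (Y *v z) $ i\<bar> \<le> \<kappa> * a i"
        using Z(4)[OF z] by (simp add: abox_def Dv[symmetric] diag_mat_mult_vec)
      then have "a i * \<bar>(Y *v z) $ i\<bar> \<le> a i * \<kappa>" using a[of i] by (simp add: abs_mult mult.commute)
      then show ?thesis using a[of i] by simp
    qed
    then have "(\<Sum>i\<in>UNIV. \<bar>(Y *v z) $ i\<bar>) \<le> (\<Sum>i\<in>(UNIV::'n set). \<kappa>)" by (intro sum_mono)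
    then have "norm (Y *v z) \<le> \<rho>" using norm_le_l1_cart[of "Y *v z"] by (simp add: \<rho>_def mult.commute)
    moreover have "Y *v z \<in> zspan x ?N" using z Z(2) x(2) unfolding L_def by blast
    ultimately show "Y *v z \<in> ?B" by simp
  qed
  have gs0: "gs x i \<noteq> 0" if "i < ?N" for i using x(1) that unfolding reduced_def by blast
  have B: "finite ?B" "real (card ?B) \<le> (\<Prod>i<?N. 2 * \<rho> / norm (gs x i) + 1)"
    using card_zspan_ball[of ?N x \<rho> 0, OF gs0 \<rho>] by blast+
  have "card Z \<le> card ?B" using card_mono[OF B(1) sub] by (simp only: card_image[OF inj])
  then have "K \<le> (\<Prod>i<?N. 2 * \<rho> / norm (gs x i) + 1)" using B(2) Z(3) by linarith
  then obtain k where k: "k \<le> ?N" "K * gprod x k \<le> \<tau>"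
    using reduced_prefix[OF x(1) \<rho>] unfolding \<tau>_def by blast
  have "gprod x k \<le> \<tau> / K" using k(2) K by (simp add: pos_le_divide_eq mult.commute)
  then have gk: "G * gprod x k \<le> \<delta>"
    using mult_left_mono[of "gprod x k" "\<tau> / K" G] G by (simp add: \<delta>_def G_def \<tau>_def \<rho>_def)
  have "gprod x ?N = \<bar>det (colmat x)\<bar>" by (simp add: gprod_def det_colmat)
  also have "\<dots> = \<bar>det Y\<bar>" unfolding H(2)[symmetric] by (simp add: det_mul abs_mult GLZ_inv(5)[OF H(1)])
  also have "\<dots> \<le> 2 ^ ?N / ?P"
    using det_near_orth[OF Y] P by (simp add: det_mul det_diag_mat abs_mult pos_le_divide_eq mult.commute)
  finally have gN: "G * gprod x ?N \<le> \<Delta>" unfolding \<Delta>_def G_def by (intro mult_left_mono) auto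
  have "x \<in> red_set (\<lambda>i. if i < k then \<delta> else \<Delta>) (\<lambda>i. if i < k then k else ?N) ?N"
    by (rule reduced_imp_red_set[OF x(1) k(1) gk[unfolded G_def] gN[unfolded G_def]])
  then have "colmat x \<in> colsof -` red_set (\<lambda>i. if i < k then \<delta> else \<Delta>) (\<lambda>i. if i < k then k else ?N) ?N"
    by (simp only: vimage_eq colsof_colmat red_set_restrict)
  \<comment> \<open>For \<open>k = 0\<close> the product is empty, so \<open>gk\<close> already
    bounds \<delta> from below by \<open>G\<close>.\<close>
  moreover have "1 \<le> \<delta>" if "k = 0" using gk G that by (simp add: gprod_def)
  ultimately have "Y ** H \<in> cusp \<delta> \<Delta>" unfolding cusp_def H(2) using k(1) by blast
  then show ?thesis using H(1) by blast
qed

text \<open>After the substitution n = D X with D = \<open>diag_mat a\<close>, the sides enter only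
  through their product: as P^N from the change of variables and as 1/P inside \<Delta>. This is why
  \<open>C\<close> can be chosen before \<open>a\<close>.\<close>

lemma emeasure_near_orth_pts_le:
  fixes P \<kappa> :: real
  assumes P: "0 < P" and \<kappa>: "0 \<le> \<kappa>"
  shows "\<exists>C\<ge>0. \<forall>(a :: 'n::finite \<Rightarrow> real) K. (\<forall>i. 0 < a i) \<longrightarrow> (\<Prod>i\<in>UNIV. a i) = P \<longrightarrow> 1 \<le> K \<longrightarrow>
    emeasure lborel {n \<in> near_orth. lattice_pts n (abox (\<lambda>i. \<kappa> * a i)) K} \<le> ennreal (C / K ^ CARD('n))"
proof -
  let ?N = "CARD('n)"
  define G :: real where "G = 2 ^ (?N * ?N) * (2 * (\<kappa> * ?N) + 2 ^ ?N) ^ ?N"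
  define \<Delta> :: real where "\<Delta> = 2 ^ (?N * ?N) * (2 ^ ?N / P)"
  define m where "m = card {A :: real^'n^'n. int_mat A \<and> (\<forall>i j. \<bar>A $ i $ j\<bar> \<le> of_int 4)}"
  have G: "0 < G" unfolding G_def using \<kappa> by (intro mult_pos_pos zero_less_power add_nonneg_pos) auto
  have \<Delta>: "0 < \<Delta>" using P by (simp add: \<Delta>_def)
  define B where "B = real (?N + 1) * (2 ^ (2 * ?N + 1) * (\<Delta> + 1)) ^ ?N"
  have B: "0 \<le> B" unfolding B_def using \<Delta> by (intro mult_nonneg_nonneg zero_le_power) auto
  define C where "C = real m * (B * G ^ ?N) * P ^ ?N"
  have C: "0 \<le> C" unfolding C_def using P B G by (intro mult_nonneg_nonneg zero_le_power) auto
  have main: "emeasure lborel {n \<in> near_orth. lattice_pts n (abox (\<lambda>i. \<kappa> * a i)) K} \<le> ennreal (C / K ^ ?N)"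
    if a: "\<And>i. 0 < a i" and aP: "(\<Prod>i\<in>UNIV. a i) = P" and K: "1 \<le> K" for a :: "'n \<Rightarrow> real" and K :: real
  proof -
    define S where "S = {n :: real^'n^'n. n \<in> near_orth \<and> lattice_pts n (abox (\<lambda>i. \<kappa> * a i)) K}"
    define V where "V = (\<lambda>X. diag_mat a ** X) -` near_orth"
    define E where "E = (\<lambda>X. diag_mat a ** X) -` S"
    define \<delta> where "\<delta> = G / K"
    have \<delta>: "0 < \<delta>" using G K by (simp add: \<delta>_def)
    have nm: "near_orth \<in> sets (borel :: (real^'n^'n) measure)" using closed_near_orth by (rule borel_closed)
    have Vm: "V \<in> sets borel" unfolding V_def
      using measurable_sets[OF measurable_matrix_mult_left nm] by simp
    have "S = near_orth \<inter> {n. lattice_pts n (abox (\<lambda>i. \<kappa> * a i)) K}" by (auto simp: S_def)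
    then have Sm: "S \<in> sets borel" using sets.Int[OF nm borel_pts[OF closed_abox]] by simp
    have EV: "E \<subseteq> V" by (auto simp: E_def V_def S_def)
    have EF: "\<exists>H\<in>GLZ. Y ** H \<in> cusp \<delta> \<Delta>" if "Y \<in> E" for Y
    proof -
      have 1: "diag_mat a ** Y \<in> near_orth" and 2: "lattice_pts (diag_mat a ** Y) (abox (\<lambda>i. \<kappa> * a i)) K"
        using that by (simp_all add: E_def S_def)
      show ?thesis using pts_imp_cusp[OF a \<kappa> K 1 2] unfolding aP \<delta>_def G_def \<Delta>_def .
    qed
    have bd: "\<bar>W $ i $ j\<bar> \<le> of_int 4" if "Y \<in> V" "Y' \<in> V" "int_mat W" "Y ** W = Y'" for Y Y' W :: "real^'n^'n" and i j
      using near_orth_int_mat_le[of "diag_mat a" Y Y' W i j] that by (simp add: V_def)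
    have "emeasure lborel E \<le> of_nat m * emeasure lborel (cusp \<delta> \<Delta> :: (real^'n^'n) set)"
      unfolding m_def using Vm borel_cusp EV EF bd by (rule emeasure_unfold_GLZ)
    also have "\<dots> \<le> of_nat m * ennreal (B * \<delta> ^ ?N)"
      using emeasure_cusp_le[OF \<delta> \<Delta>, where 'n='n] unfolding B_def by (intro mult_left_mono) (simp_all only: mult.assoc zero_le)
    also have "\<dots> = ennreal (real m * (B * \<delta> ^ ?N))"
      using B \<delta> by (intro of_nat_mult_ennreal mult_nonneg_nonneg zero_le_power) auto
    finally have Eb: "emeasure lborel E \<le> ennreal (real m * (B * \<delta> ^ ?N))" .
    have "det (diag_mat a) = P" using aP by (simp add: det_diag_mat)
    then have "emeasure lborel S = emeasure lborel E * ennreal (P ^ ?N)"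
      using emeasure_lborel_matrix_mult_left[of "diag_mat a" S] Sm P by (simp add: E_def)
    also have "\<dots> \<le> ennreal (real m * (B * \<delta> ^ ?N)) * ennreal (P ^ ?N)"
      by (intro mult_right_mono Eb) simp
    also have "\<dots> = ennreal (real m * (B * \<delta> ^ ?N) * P ^ ?N)"
      using P by (intro ennreal_mult''[symmetric]) simp
    finally have Sb: "emeasure lborel S \<le> ennreal (real m * (B * \<delta> ^ ?N) * P ^ ?N)" .
    have "real m * (B * \<delta> ^ ?N) * P ^ ?N = C / K ^ ?N" unfolding C_def \<delta>_def power_divide by simp
    then show ?thesis using Sb unfolding S_def by simp
  qed
  show ?thesis using C main by blast
qed

section \<open>From Haar measure to Lebesgue measure\<close>

lemma SO_norm: "g \<in> SO \<Longrightarrow> norm (g *v x) = norm x" for g :: "real^'n^'n"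
proof -
  assume "g \<in> SO"
  then have "orthogonal_transformation (\<lambda>x. g *v x)"
    by (simp add: SO_def orthogonal_transformation_matrix)
  then show ?thesis by (rule orthogonal_transformation_norm)
qed

lemma near_orth_mult_SO:
  fixes n g :: "real^'n^'n"
  assumes "n \<in> near_orth" "g \<in> SO"
  shows "n ** g \<in> near_orth"
proof -
  have "norm x \<le> 2 * norm ((n ** g) *v x) \<and> norm ((n ** g) *v x) \<le> 2 * norm x" for x
    using near_orthD[OF assms(1), of "g *v x"] SO_norm[OF assms(2), of x] by (simp add: matrix_vector_mul_assoc)
  then show ?thesis by (simp add: near_orth_def)
qed

lemma SO_mult_transpose: "g \<in> SO \<Longrightarrow> g ** transpose g = mat 1" "g \<in> SO \<Longrightarrow> transpose g ** g = mat 1"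
  by (simp_all add: SO_def orthogonal_matrix_def)

text \<open>Apply \<open>n\<close> to its own row: the squared norm of row \<open>c\<close> is the
  c-th coordinate of the image, which is at most twice the norm of the row.\<close>

lemma near_orth_row: "n \<in> near_orth \<Longrightarrow> norm (n $ c) \<le> 2" for n :: "real^'n^'n"
proof -
  assume n: "n \<in> near_orth"
  have "(norm (n $ c))\<^sup>2 = (n *v (n $ c)) $ c"
    by (simp add: power2_norm_eq_inner matrix_vector_mult_def inner_vec_def)
  also have "\<dots> \<le> norm (n *v (n $ c))" using component_le_norm_cart[of "n *v (n $ c)" c] by linarith
  also have "\<dots> \<le> 2 * norm (n $ c)" by (rule near_orthD(2)[OF n])
  finally have "norm (n $ c) * norm (n $ c) \<le> 2 * norm (n $ c)" by (simp add: power2_eq_square)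
  then show ?thesis by (cases "norm (n $ c) = 0") (auto simp: mult_le_cancel_right)
qed

lemma near_orth_det: "n \<in> near_orth \<Longrightarrow> det n \<noteq> 0" for n :: "real^'n^'n"
proof -
  assume n: "n \<in> near_orth"
  have "x = 0" if "n *v x = 0" for x using near_orthD(1)[OF n, of x] that by simp
  then have "inj (\<lambda>x. n *v x)" by (subst linear_injective_0) auto
  then have "invertible n" by (metis invertible_left_inverse matrix_left_invertible_injective)
  then show ?thesis by (simp add: invertible_det_nz)
qed

text \<open>An orthonormal system gives an orthogonal matrix of determinant 1 or -1. Flipping the
  sign of a single row corrects the determinant and is invisible to absolute values of coordinates,
  hence to boxes.\<close>

lemma ex_SO_rows:
  fixes u :: "nat \<Rightarrow> real^'n"
  assumes u1: "\<And>i. i < CARD('n) \<Longrightarrow> norm (u i) = 1"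
    and u2: "\<And>i j. i < CARD('n) \<Longrightarrow> j < CARD('n) \<Longrightarrow> i \<noteq> j \<Longrightarrow> u i \<bullet> u j = 0"
  shows "\<exists>h\<in>SO. \<forall>v c. \<bar>(h *v v) $ c\<bar> = \<bar>u (idx c) \<bullet> v\<bar>"
proof -
  define q where "q = rowmat u"
  have q: "orthogonal_matrix q" unfolding q_def using u1 u2 by (rule orthogonal_matrix_rowmat)
  then have dq: "det q = 1 \<or> det q = - 1" by (rule det_orthogonal_matrix)
  define c0 :: 'n where "c0 = undefined"
  define \<epsilon> where "\<epsilon> c = (if c = c0 then det q else 1)" for c
  have \<epsilon>1: "\<bar>\<epsilon> c\<bar> = 1" for c using dq by (auto simp: \<epsilon>_def)
  have \<epsilon>P: "(\<Prod>c\<in>UNIV. \<epsilon> c) = det q" by (simp add: \<epsilon>_def)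
  have "norm (diag_mat \<epsilon> *v x) = norm x" for x
    by (simp add: norm_vec_def diag_mat_mult_vec abs_mult \<epsilon>1)
  then have "orthogonal_transformation (\<lambda>x. diag_mat \<epsilon> *v x)" by (simp add: orthogonal_transformation)
  then have "orthogonal_matrix (diag_mat \<epsilon>)" by (simp add: orthogonal_transformation_matrix)
  then have "diag_mat \<epsilon> ** q \<in> SO"
    using q dq by (auto simp: SO_def orthogonal_matrix_mul det_mul det_diag_mat \<epsilon>P)
  moreover have "((diag_mat \<epsilon> ** q) *v v) $ c = \<epsilon> c * (u (idx c) \<bullet> v)" for v c
    by (simp add: matrix_vector_mul_assoc[symmetric] diag_mat_mult_vec q_def rowmat_mult_vec)
  then have "\<bar>((diag_mat \<epsilon> ** q) *v v) $ c\<bar> = \<bar>u (idx c) \<bullet> v\<bar>" for v c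
    by (simp only: abs_mult \<epsilon>1 mult_1)
  ultimately show ?thesis by blast
qed

text \<open>An RQ decomposition of \<open>n\<close>: rows are orthonormalised in order of increasing side length, so the
  triangular factor only adds shorter sides to longer ones.\<close>

lemma near_orth_RQ:
  fixes n :: "real^'n^'n" and a :: "'n \<Rightarrow> real"
  assumes n: "n \<in> near_orth" and a: "\<And>i j. idx i \<le> idx j \<Longrightarrow> a i \<le> a j"
  shows "\<exists>q\<in>SO. \<forall>v. q *v v \<in> abox a \<longrightarrow> n *v v \<in> abox (\<lambda>i. (2 * CARD('n)) * a i)"
proof -
  let ?N = "CARD('n)"
  define ix where "ix = inv_into UNIV (idx :: 'n \<Rightarrow> nat)"
  have ix: "ix (idx c) = c" for c by (simp add: ix_def inv_idx)
  define \<nu> where "\<nu> i = n $ ix i" for i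
  have row: "rowmat \<nu> = n" by (simp add: rowmat_def \<nu>_def ix)
  have "(\<Prod>i<?N. norm (gs \<nu> i)) \<noteq> 0" using near_orth_det[OF n] det_rowmat[of \<nu>] unfolding row by (metis abs_eq_0)
  then have g0: "gs \<nu> i \<noteq> 0" if "i < ?N" for i using that by auto
  define u where "u i = gs \<nu> i /\<^sub>R norm (gs \<nu> i)" for i
  have u1: "norm (u i) = 1" if "i < ?N" for i using g0[OF that] by (simp add: u_def)
  have u2: "u i \<bullet> u j = 0" if "i \<noteq> j" for i j using gs_orth[OF that, of \<nu>] by (simp add: u_def)
  obtain q where q: "q \<in> SO" "\<And>v c. \<bar>(q *v v) $ c\<bar> = \<bar>u (idx c) \<bullet> v\<bar>"
    using ex_SO_rows[of u] u1 u2 by blast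
  have "n *v v \<in> abox (\<lambda>i. (2 * ?N) * a i)" if v: "q *v v \<in> abox a" for v
  proof -
    have uv: "\<bar>u (idx c) \<bullet> v\<bar> \<le> a c" for c
      using v unfolding abox_def mem_Collect_eq q(2) by blast
    have "\<bar>(n *v v) $ c\<bar> \<le> (2 * ?N) * a c" for c
    proof -
      let ?i = "idx c"
      have nc: "n $ c = \<nu> ?i" by (simp add: \<nu>_def ix)
      have a0: "0 \<le> a c" using uv[of c] by linarith
      have dec: "\<nu> ?i = (\<Sum>j<Suc ?i. (\<nu> ?i \<bullet> u j) *\<^sub>R u j)"
      proof -
        have coef: "(\<nu> ?i \<bullet> gs \<nu> j / (gs \<nu> j \<bullet> gs \<nu> j)) *\<^sub>R gs \<nu> j = (\<nu> ?i \<bullet> u j) *\<^sub>R u j" for j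
          by (simp add: u_def power2_norm_eq_inner[symmetric] power2_eq_square divide_inverse)
        have "gs_perp \<nu> (Suc ?i) (\<nu> ?i) = 0" unfolding gs_perp_eq_0_iff by (intro span_base) auto
        then have "\<nu> ?i = (\<Sum>j<Suc ?i. (\<nu> ?i \<bullet> gs \<nu> j / (gs \<nu> j \<bullet> gs \<nu> j)) *\<^sub>R gs \<nu> j)"
          using gs_perp_decomp[of "\<nu> ?i" \<nu> "Suc ?i"] by simp
        then show ?thesis by (simp only: coef)
      qed
      have "(n *v v) $ c = \<nu> ?i \<bullet> v" unfolding nc[symmetric] by (simp add: matrix_vector_mult_def inner_vec_def)
      also have "\<dots> = (\<Sum>j<Suc ?i. (\<nu> ?i \<bullet> u j) * (u j \<bullet> v))"
        using arg_cong[OF dec, of "\<lambda>w. w \<bullet> v"] by (simp only: inner_sum_left inner_scaleR_left)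
      finally have "\<bar>(n *v v) $ c\<bar> \<le> (\<Sum>j<Suc ?i. \<bar>(\<nu> ?i \<bullet> u j) * (u j \<bullet> v)\<bar>)" by (simp only: sum_abs)
      \<comment> \<open>The coefficient is at most the row norm, hence 2, and every \<open>d\<close>
        with \<open>idx d \<le> idx c\<close> has side \<open>a d \<le> a c\<close>. With at most N
        terms this produces the factor 2N.\<close>
      also have "\<dots> \<le> (\<Sum>j<Suc ?i. 2 * a c)"
      proof (rule sum_mono)
        fix j assume j: "j \<in> {..<Suc ?i}"
        have jN: "j < ?N" using j idx_less[of c] by simp
        then obtain d :: 'n where d: "idx d = j" using idx_surj by blast
        have "\<bar>u j \<bullet> v\<bar> \<le> a c" using uv[of d] a[of d c] d j by simp
        moreover have "\<bar>\<nu> ?i \<bullet> u j\<bar> \<le> 2"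
          using Cauchy_Schwarz_ineq2[of "\<nu> ?i" "u j"] u1[OF jN] near_orth_row[OF n, of c] nc by simp
        ultimately show "\<bar>(\<nu> ?i \<bullet> u j) * (u j \<bullet> v)\<bar> \<le> 2 * a c" unfolding abs_mult by (intro mult_mono) auto
      qed
      also have "\<dots> = real (Suc ?i) * (2 * a c)" by simp
      also have "\<dots> \<le> real ?N * (2 * a c)"
        using idx_less[of c] a0 by (intro mult_right_mono) auto
      finally show ?thesis by (simp add: mult.assoc mult.left_commute)
    qed
    then show ?thesis by (simp add: abox_def)
  qed
  with q(1) show ?thesis by blast
qed

lemma pts_mono: "lattice_pts g B K \<Longrightarrow> (\<And>z. g *v z \<in> B \<Longrightarrow> h *v z \<in> B') \<Longrightarrow> lattice_pts h B' K"
  unfolding lattice_pts_def by blast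

lemma norm_matrix_vector_le: "norm (A *v x) \<le> norm A * norm x" for A :: "real^'n^'n"
proof -
  have "norm (A *v x) = L2_set (\<lambda>i. norm (A $ i \<bullet> x)) UNIV"
    by (simp add: norm_vec_def matrix_vector_mult_def inner_vec_def)
  also have "\<dots> \<le> L2_set (\<lambda>i. norm (A $ i) * norm x) UNIV"
    by (intro L2_set_mono) (auto simp: Cauchy_Schwarz_ineq2)
  also have "\<dots> = norm A * norm x" by (simp add: norm_vec_def[of A] L2_set_left_distrib)
  finally show ?thesis .
qed

text \<open>A matrix within 1/2 of the identity changes norms by a factor between 1/2 and 3/2, so
  the set contains a ball; the bound on rows makes it bounded.\<close>

lemma emeasure_near_orth:
  "0 < emeasure lborel (near_orth :: (real^'n^'n) set)" "emeasure lborel (near_orth :: (real^'n^'n) set) < \<infinity>"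
proof -
  have "ball (mat 1) (1/2) \<subseteq> (near_orth :: (real^'n^'n) set)"
  proof
    fix n :: "real^'n^'n" assume "n \<in> ball (mat 1) (1/2)"
    then have n: "norm (n - mat 1) \<le> 1 / 2" by (simp add: dist_norm norm_minus_commute)
    have "norm x \<le> 2 * norm (n *v x) \<and> norm (n *v x) \<le> 2 * norm x" for x
    proof -
      have "norm (n *v x - x) = norm ((n - mat 1) *v x)" by (simp add: matrix_vector_mult_diff_rdistrib)
      also have "\<dots> \<le> norm (n - mat 1) * norm x" by (rule norm_matrix_vector_le)
      also have "\<dots> \<le> (1 / 2) * norm x" using n by (intro mult_right_mono) auto
      finally have "norm (n *v x - x) \<le> norm x / 2" by simp
      then show ?thesis using norm_triangle_ineq2[of "n *v x" x] norm_triangle_ineq3[of "n *v x" x] by (simp, linarith)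
    qed
    then show "n \<in> near_orth" by (simp add: near_orth_def)
  qed
  then have "emeasure lborel (ball (mat 1 :: real^'n^'n) (1/2)) \<le> emeasure lborel (near_orth :: (real^'n^'n) set)"
    by (rule emeasure_mono) (simp add: borel_closed[OF closed_near_orth])
  moreover have "0 < emeasure lborel (ball (mat 1 :: real^'n^'n) (1/2))"
    using open_not_negligible[of "ball (mat 1 :: real^'n^'n) (1/2)"]
    by (auto simp: negligible_iff_emeasure0 zero_less_iff_neq_zero)
  ultimately show "0 < emeasure lborel (near_orth :: (real^'n^'n) set)" by (rule less_le_trans[rotated])
  have "bounded (near_orth :: (real^'n^'n) set)"
  proof (rule boundedI)
    fix n :: "real^'n^'n" assume n: "n \<in> near_orth"
    have "norm n \<le> (\<Sum>c\<in>UNIV. norm (n $ c))" unfolding norm_vec_def by (rule L2_set_le_sum) simp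
    also have "\<dots> \<le> (\<Sum>c\<in>(UNIV::'n set). 2)" by (intro sum_mono near_orth_row[OF n])
    finally show "norm n \<le> 2 * CARD('n)" by simp
  qed
  then show "emeasure lborel (near_orth :: (real^'n^'n) set) < \<infinity>" by (rule emeasure_bounded_finite)
qed

text \<open>For each fixed n in \<open>near_orth\<close>, left invariance under its orthogonal
  factor \<open>q\<close> bounds the Haar measure of \<open>S\<close> by that of all g with n g in
  \<open>T\<close>. Integrate over n and exchange the integrals: for fixed g in \<open>SO\<close>,
  right multiplication by g preserves Lebesgue measure and the inner integral is the measure of
  \<open>T\<close>. The inequality is used for each n separately, so \<open>q\<close> need not
  depend measurably on n.\<close>

lemma haar_SO_pts_le:
  fixes M :: "(real^'n^'n) measure" and a :: "'n \<Rightarrow> real"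
  assumes M: "haar_SO M" and a: "\<And>i j. idx i \<le> idx j \<Longrightarrow> a i \<le> a j"
  shows "emeasure lborel (near_orth :: (real^'n^'n) set) * emeasure M {g. lattice_pts g (abox a) K}
    \<le> emeasure lborel {n \<in> near_orth. lattice_pts n (abox (\<lambda>i. (2 * CARD('n)) * a i)) K}"
proof -
  interpret M: prob_space M using M by (simp add: haar_SO_def)
  interpret LM: pair_sigma_finite "lborel :: (real^'n^'n) measure" M ..
  have sets: "sets M = sets borel" using M by (simp add: haar_SO_def)
  have inv: "emeasure M ((\<lambda>g. h ** g) -` B) = emeasure M B" if "h \<in> SO" "B \<in> sets borel" for h B
    using M that sets by (simp add: haar_SO_def)
  have AE: "AE g in M. g \<in> SO" by (rule haar_SO_AE[OF M])
  define S where "S = {g :: real^'n^'n. lattice_pts g (abox a) K}"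
  define T where "T = {n :: real^'n^'n. n \<in> near_orth \<and> lattice_pts n (abox (\<lambda>i. (2 * CARD('n)) * a i)) K}"
  have Sm: "S \<in> sets borel" unfolding S_def by (rule borel_pts[OF closed_abox])
  have nm: "near_orth \<in> sets (borel :: (real^'n^'n) measure)" using closed_near_orth by (rule borel_closed)
  have "T = near_orth \<inter> {n. lattice_pts n (abox (\<lambda>i. (2 * CARD('n)) * a i)) K}" by (auto simp: T_def)
  then have Tm: "T \<in> sets borel" using sets.Int[OF nm borel_pts[OF closed_abox]] by simp
  have mult: "(\<lambda>p. fst p ** snd p :: real^'n^'n) \<in> borel_measurable (borel \<Otimes>\<^sub>M borel)"
    by (rule measurable_matrixI) (simp add: matrix_matrix_mult_def)
  have Q: "(\<lambda>p. indicator T (fst p ** snd p) :: ennreal) \<in> borel_measurable (lborel \<Otimes>\<^sub>M M)"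
    using measurable_compose[OF mult borel_measurable_indicator[OF Tm]]
    by (simp add: measurable_cong_sets[OF sets_pair_measure_cong[OF sets_lborel sets] refl])
  have vim: "(\<lambda>g. n ** g) -` T \<in> sets M" for n
    using measurable_sets[OF measurable_matrix_mult_left[of n] Tm] sets by simp
  have lower: "emeasure M S \<le> (\<integral>\<^sup>+g. indicator T (n ** g) \<partial>M)" if n: "n \<in> near_orth" for n
  proof -
    obtain q where q: "q \<in> SO" "\<And>v. q *v v \<in> abox a \<Longrightarrow> n *v v \<in> abox (\<lambda>i. (2 * CARD('n)) * a i)"
      using near_orth_RQ[OF n, of a] a by blast
    have "emeasure M S = emeasure M ((\<lambda>g. q ** g) -` S)" using inv[OF q(1) Sm] by simp
    also have "\<dots> \<le> emeasure M ((\<lambda>g. n ** g) -` T)"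
    proof (rule emeasure_mono_AE)
      show "AE g in M. g \<in> (\<lambda>g. q ** g) -` S \<longrightarrow> g \<in> (\<lambda>g. n ** g) -` T"
        using AE
      proof eventually_elim
        fix g :: "real^'n^'n" assume g: "g \<in> SO"
        have "lattice_pts (n ** g) (abox (\<lambda>i. (2 * CARD('n)) * a i)) K" if "lattice_pts (q ** g) (abox a) K"
        proof (rule pts_mono[OF that])
          fix z assume "(q ** g) *v z \<in> abox a"
          then have "q *v (g *v z) \<in> abox a" by (simp add: matrix_vector_mul_assoc)
          then have "n *v (g *v z) \<in> abox (\<lambda>i. (2 * CARD('n)) * a i)" by (rule q(2))
          then show "(n ** g) *v z \<in> abox (\<lambda>i. (2 * CARD('n)) * a i)" by (simp add: matrix_vector_mul_assoc)
        qed
        then show "g \<in> (\<lambda>g. q ** g) -` S \<longrightarrow> g \<in> (\<lambda>g. n ** g) -` T"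
          using near_orth_mult_SO[OF n g] by (simp add: S_def T_def)
      qed
    qed (rule vim)
    also have "\<dots> = (\<integral>\<^sup>+g. indicator ((\<lambda>g. n ** g) -` T) g \<partial>M)" using vim by simp
    also have "\<dots> = (\<integral>\<^sup>+g. indicator T (n ** g) \<partial>M)" by (simp add: indicator_def)
    finally show ?thesis .
  qed
  have "emeasure lborel (near_orth :: (real^'n^'n) set) * emeasure M S
     = (\<integral>\<^sup>+n. emeasure M S * indicator near_orth n \<partial>(lborel :: (real^'n^'n) measure))"
    using nm by (simp add: nn_integral_cmult_indicator) (simp add: mult.commute)
  also have "\<dots> \<le> (\<integral>\<^sup>+n. \<integral>\<^sup>+g. indicator T (n ** g) \<partial>M \<partial>lborel)"
    by (intro nn_integral_mono) (use lower in \<open>auto simp: indicator_def\<close>)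
  also have "\<dots> = (\<integral>\<^sup>+g. \<integral>\<^sup>+n. indicator T (n ** g) \<partial>lborel \<partial>M)"
    using LM.Fubini'[of "\<lambda>n g. indicator T (n ** g)"] Q by (simp add: split_beta')
  also have "\<dots> = (\<integral>\<^sup>+g. emeasure lborel T \<partial>M)"
  proof (rule nn_integral_cong_AE, use AE in eventually_elim)
    fix g :: "real^'n^'n" assume g: "g \<in> SO"
    have m: "(\<lambda>n. n ** g) -` T \<in> sets lborel" using measurable_sets[OF measurable_matrix_mult_right[of g] Tm] by simp
    have "(\<integral>\<^sup>+n. indicator T (n ** g) \<partial>lborel) = (\<integral>\<^sup>+n. indicator ((\<lambda>n. n ** g) -` T) n \<partial>lborel)"
      by (simp add: indicator_def)
    also have "\<dots> = emeasure lborel ((\<lambda>n. n ** g) -` T)" using m by simp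
    also have "\<dots> = emeasure lborel T"
      using emeasure_lborel_matrix_mult_right[of g T] Tm g by (simp add: SO_def)
    finally show "(\<integral>\<^sup>+n. indicator T (n ** g) \<partial>lborel) = emeasure lborel T" .
  qed
  also have "\<dots> = emeasure lborel T" by (simp add: M.emeasure_space_1)
  finally show ?thesis unfolding S_def T_def .
qed

section \<open>Enclosing a convex set in a box\<close>

text \<open>Choose each new vector with projection longer than half the supremum. The set is not
  assumed closed, so the supremum may not be attained; this is where the factor 2 comes
  from.\<close>

lemma ex_greedy_gs:
  fixes W :: "'a::euclidean_space set"
  assumes W: "span W = UNIV" and bW: "bounded W" and "k \<le> DIM('a)"
  shows "\<exists>x. \<forall>i<k. x i \<in> W \<and> gs x i \<noteq> 0 \<and> (\<forall>w\<in>W. norm (gs_perp x i w) \<le> 2 * norm (gs x i))"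
  using assms(3)
proof (induction k)
  case 0
  show ?case by simp
next
  case (Suc k)
  then obtain x where x: "\<And>i. i < k \<Longrightarrow> x i \<in> W \<and> gs x i \<noteq> 0 \<and> (\<forall>w\<in>W. norm (gs_perp x i w) \<le> 2 * norm (gs x i))"
    by auto
  let ?V = "span (x ` {..<k})"
  have V: "?V \<noteq> UNIV" using Suc.prems by (intro span_image_lessThan_neq_UNIV) simp
  obtain w0 where w0: "w0 \<in> W" "w0 \<notin> ?V"
    using W V span_minimal[OF _ subspace_span, of W "x ` {..<k}"] by blast
  obtain R where R: "\<And>w. w \<in> W \<Longrightarrow> norm w \<le> R" using bW by (auto simp: bounded_iff)
  define s where "s = Sup ((\<lambda>w. norm (gs_perp x k w)) ` W)"
  have bdd: "bdd_above ((\<lambda>w. norm (gs_perp x k w)) ` W)"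
    by (rule bdd_aboveI2[of _ _ R]) (rule order_trans[OF norm_gs_perp_le R])
  have s: "norm (gs_perp x k w) \<le> s" if "w \<in> W" for w
    unfolding s_def using bdd that by (rule cSUP_upper2) simp
  have "0 < norm (gs_perp x k w0)" using w0(2) by (simp add: gs_perp_eq_0_iff)
  then have "s / 2 < s" using s[OF w0(1)] by linarith
  then obtain w where w: "w \<in> W" "s / 2 < norm (gs_perp x k w)"
    using less_cSUP_iff[OF _ bdd, of "s / 2"] w0(1) unfolding s_def by auto
  have w0': "gs_perp x k w \<noteq> 0" using w(2) \<open>s / 2 < s\<close> by auto
  have "(x(k := w)) i \<in> W \<and> gs (x(k := w)) i \<noteq> 0 \<and> (\<forall>v\<in>W. norm (gs_perp (x(k := w)) i v) \<le> 2 * norm (gs (x(k := w)) i))"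
    if i: "i < Suc k" for i
  proof (cases "i = k")
    case True
    have p: "gs_perp (x(k := w)) k v = gs_perp x k v" for v by (rule gs_perp_cong) simp
    have "norm (gs_perp x k v) \<le> 2 * norm (gs_perp x k w)" if "v \<in> W" for v
      using s[OF that] w(2) by linarith
    then show ?thesis using True w(1) w0' by (simp add: gs_fun_upd p)
  next
    case False
    then have ik: "i < k" using i by simp
    have p: "gs_perp (x(k := w)) i v = gs_perp x i v" for v by (rule gs_perp_cong) (use ik in simp)
    show ?thesis using x[OF ik] ik False by (simp add: gs_fun_upd_less p)
  qed
  then show ?case by blast
qed

text \<open>The body contains every combination of the vectors \<open>x c\<close> with coefficients
  in [0, 1/N]: it is the average of N points, each on the segment from 0 to one of the vectors. In
  the coordinates of the inverse matrix \<open>C\<close> these combinations form a cube of volume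
  N^-N.\<close>

lemma convex_parallelepiped:
  fixes W :: "(real^'n) set" and x :: "nat \<Rightarrow> real^'n"
  assumes W: "convex W" "bounded W" "0 \<in> W" and x: "\<And>i. i < CARD('n) \<Longrightarrow> x i \<in> W" "\<And>i. i < CARD('n) \<Longrightarrow> gs x i \<noteq> 0"
  shows "ennreal (gprod x CARD('n) / CARD('n) ^ CARD('n)) \<le> emeasure lebesgue W"
proof -
  let ?N = "CARD('n)"
  let ?B = "colmat x"
  have det: "\<bar>det ?B\<bar> = gprod x ?N" by (simp add: det_colmat gprod_def)
  have g: "0 < gprod x ?N" using x(2) by (rule gprod_pos)
  then have "invertible ?B" using det by (auto simp: invertible_det_nz)
  then obtain C where C: "C ** ?B = mat 1" "?B ** C = mat 1" by (auto simp: invertible_def)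
  have "det C * det ?B = 1" using arg_cong[OF C(1), of det] by (simp add: det_mul)
  then have "\<bar>det C\<bar> * gprod x ?N = 1" by (simp add: det[symmetric] abs_mult[symmetric])
  then have detC: "\<bar>det C\<bar> = 1 / gprod x ?N" using g by (simp add: field_simps)
  define Q where "Q = cbox 0 (\<chi> c. 1 / ?N :: real^'n)"
  have "(\<lambda>y. C *v y) -` Q \<subseteq> W"
  proof
    fix y assume y: "y \<in> (\<lambda>y. C *v y) -` Q"
    define t where "t = C *v y"
    have t: "0 \<le> t $ c" "t $ c \<le> 1 / ?N" for c using y by (auto simp: t_def Q_def mem_box_cart)
    have "y = ?B *v t" unfolding t_def by (simp add: matrix_vector_mul_assoc C(2))
    also have "\<dots> = (\<Sum>c\<in>UNIV. t $ c *\<^sub>R x (idx c))"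
      by (simp add: vec_eq_iff matrix_vector_mult_def colmat_def mult.commute)
    also have "\<dots> = (\<Sum>c\<in>UNIV. (1 / ?N) *\<^sub>R ((?N * t $ c) *\<^sub>R x (idx c)))" by simp
    also have "\<dots> \<in> W"
    proof (rule convex_sum)
      fix c :: 'n
      have "(1 - ?N * t $ c) *\<^sub>R 0 + (?N * t $ c) *\<^sub>R x (idx c) \<in> W"
        using t[of c] W(3) x(1)[OF idx_less[of c]] by (intro convexD[OF W(1)]) (auto simp: field_simps)
      then show "(?N * t $ c) *\<^sub>R x (idx c) \<in> W" by simp
    qed (use W in auto)
    finally show "y \<in> W" .
  qed
  moreover have Wm: "W \<in> sets lebesgue" using measurable_convex[OF W(1,2)] by (rule fmeasurableD)
  ultimately have "emeasure lebesgue ((\<lambda>y. C *v y) -` Q) \<le> emeasure lebesgue W" by (rule emeasure_mono)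
  moreover have "(\<lambda>y. C *v y) -` Q \<in> sets lborel"
    using measurable_sets[OF measurable_matrix_vector_mult[of C], of Q] by (simp add: Q_def)
  ultimately have le: "emeasure lborel ((\<lambda>y. C *v y) -` Q) \<le> emeasure lebesgue W" by simp
  have "det C \<noteq> 0" using detC g by auto
  then have "emeasure lborel ((\<lambda>y. C *v y) -` Q) * ennreal (1 / gprod x ?N) = emeasure lborel Q"
    using emeasure_lborel_matrix_vimage[of C Q] by (simp add: detC Q_def)
  also have "\<dots> = ennreal (1 / ?N ^ ?N)"
  proof -
    have "emeasure lborel Q = ennreal (\<Prod>b\<in>Basis. ((\<chi> c. 1 / ?N) - 0 :: real^'n) \<bullet> b)"
      unfolding Q_def by (rule emeasure_lborel_cbox) (auto simp: Basis_vec_def inner_axis)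
    also have "(\<Prod>b\<in>Basis. ((\<chi> c. 1 / ?N) - 0 :: real^'n) \<bullet> b) = 1 / ?N ^ ?N"
      by (simp add: prod_Basis_vec inner_axis power_one_over)
    finally show ?thesis .
  qed
  finally have e: "emeasure lborel ((\<lambda>y. C *v y) -` Q) * ennreal (1 / gprod x ?N) = ennreal (1 / ?N ^ ?N)" .
  have "ennreal (gprod x ?N / ?N ^ ?N) = ennreal (1 / ?N ^ ?N) * ennreal (gprod x ?N)"
    using g by (simp add: ennreal_mult[symmetric])
  also have "\<dots> = emeasure lborel ((\<lambda>y. C *v y) -` Q) * (ennreal (1 / gprod x ?N) * ennreal (gprod x ?N))"
    by (simp only: e[symmetric] mult.assoc)
  also have "ennreal (1 / gprod x ?N) * ennreal (gprod x ?N) = 1"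
    using g by (simp add: ennreal_mult[symmetric])
  finally show ?thesis using le by simp
qed

lemma gs_0: "gs x 0 = x 0" by (subst gs.simps) simp

lemma gs_inner_perp: "gs x l \<bullet> w = gs x l \<bullet> gs_perp x l w"
proof -
  have "gs x l \<bullet> w = gs x l \<bullet> (gs_perp x l w + (\<Sum>j<l. (w \<bullet> gs x j / (gs x j \<bullet> gs x j)) *\<^sub>R gs x j))"
    using gs_perp_decomp[of w x l] by simp
  also have "\<dots> = gs x l \<bullet> gs_perp x l w" by (simp add: inner_add_right inner_sum_right gs_orth)
  finally show ?thesis .
qed

text \<open>The product of the sides is prescribed exactly because the later constant depends on it,
  and the sides increase with the index because the triangular factor requires this order.\<close>

definition orthonormal_box :: "(real^'n) set \<Rightarrow> real \<Rightarrow> (nat \<Rightarrow> real^'n) \<Rightarrow> (nat \<Rightarrow> real) \<Rightarrow> bool" where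
  "orthonormal_box W P u s \<longleftrightarrow> (\<forall>i<CARD('n). norm (u i) = 1)
    \<and> (\<forall>i<CARD('n). \<forall>j<CARD('n). i \<noteq> j \<longrightarrow> u i \<bullet> u j = 0)
    \<and> (\<forall>i<CARD('n). 0 < s i) \<and> (\<forall>j<CARD('n). \<forall>i\<le>j. s i \<le> s j) \<and> (\<Prod>i<CARD('n). s i) = P
    \<and> (\<forall>v\<in>W. \<forall>w\<in>W. \<forall>i<CARD('n). \<bar>u i \<bullet> (v - w)\<bar> \<le> s i)"

text \<open>A greedy choice makes the successive widths comparable to the Gram-Schmidt lengths of
  points of the body, and these span a parallelepiped of volume at most N^N A. The 4 combines the
  greedy factor 2 with the factor 2 for passing to differences.\<close>

lemma ex_orthonormal_box_full:
  fixes W :: "(real^'n) set" and A :: real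
  assumes W: "convex W" "bounded W" "0 \<in> W" "span W = UNIV" and A: "0 < A" "emeasure lebesgue W \<le> ennreal A"
  shows "\<exists>u s. orthonormal_box W ((4 * real CARD('n)) ^ CARD('n) * A) u s"
proof -
  let ?N = "CARD('n)"
  define P where "P = (4 * real ?N) ^ ?N * A"
  obtain m where m: "?N = Suc m" using not0_implies_Suc[of ?N] by auto
  obtain x where x: "\<And>i. i < ?N \<Longrightarrow> x i \<in> W" "\<And>i. i < ?N \<Longrightarrow> gs x i \<noteq> 0"
    "\<And>i w. i < ?N \<Longrightarrow> w \<in> W \<Longrightarrow> norm (gs_perp x i w) \<le> 2 * norm (gs x i)"
    using ex_greedy_gs[OF W(4,2), of ?N] by auto
  \<comment> \<open>The suprema are exactly decreasing in \<open>i\<close>, whereas the greedy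
    lengths are so only up to a factor 2.\<close>
  define \<sigma> where "\<sigma> i = (SUP w\<in>W. norm (gs_perp x i w))" for i
  obtain R where R: "\<And>w. w \<in> W \<Longrightarrow> norm w \<le> R" using W(2) by (auto simp: bounded_iff)
  have bdd: "bdd_above ((\<lambda>w. norm (gs_perp x i w)) ` W)" for i
    by (rule bdd_aboveI2[of _ _ R]) (rule order_trans[OF norm_gs_perp_le R])
  have \<sigma>: "norm (gs_perp x i w) \<le> \<sigma> i" if "w \<in> W" for i w
    unfolding \<sigma>_def using bdd that by (rule cSUP_upper2) simp
  have \<sigma>2: "\<sigma> i \<le> 2 * norm (gs x i)" if "i < ?N" for i
    unfolding \<sigma>_def using x(3)[OF that] W(3) by (intro cSUP_least) auto
  have \<sigma>0: "0 < \<sigma> i" if "i < ?N" for i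
    using \<sigma>[OF x(1)[OF that], of i] x(2)[OF that] unfolding gs_eq_perp[symmetric]
    by (metis less_le_trans zero_less_norm_iff)
  have dec1: "\<sigma> (Suc i) \<le> \<sigma> i" for i
    unfolding \<sigma>_def[of "Suc i"]
  proof (rule cSUP_least)
    fix w assume "w \<in> W"
    then show "norm (gs_perp x (Suc i) w) \<le> \<sigma> i" by (rule order_trans[OF norm_gs_perp_antimono \<sigma>])
  qed (use W(3) in auto)
  have dec: "\<sigma> j \<le> \<sigma> i" if "i \<le> j" for i j using lift_Suc_antimono_le[of \<sigma>, OF dec1 that] .
  \<comment> \<open>Reversing the indices turns the decreasing widths into increasing sides; the
    factor 2 accounts for differences of two points.\<close>
  define f where "f i = 2 * \<sigma> (m - i)" for i
  define p where "p = (\<Prod>i<m. f i)"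
  have f0: "0 < f i" for i using \<sigma>0[of "m - i"] by (simp add: f_def m)
  have p0: "0 < p" unfolding p_def using f0 by (intro prod_pos) auto
  have fP: "p * f m \<le> P"
  proof -
    have "p * f m = (\<Prod>i<?N. f i)" by (simp add: p_def m)
    also have "\<dots> = (\<Prod>i<?N. 2 * \<sigma> (?N - Suc i))" unfolding f_def by (rule prod.cong) (auto simp: m)
    also have "\<dots> = (\<Prod>i<?N. 2 * \<sigma> i)" by (rule prod.nat_diff_reindex)
    also have "\<dots> \<le> (\<Prod>i<?N. 4 * norm (gs x i))"
    proof (intro prod_mono conjI)
      fix i assume i: "i \<in> {..<?N}"
      show "0 \<le> 2 * \<sigma> i" using \<sigma>0[of i] i by simp
      show "2 * \<sigma> i \<le> 4 * norm (gs x i)" using \<sigma>2[of i] i by simp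
    qed
    also have "\<dots> = 4 ^ ?N * gprod x ?N" by (simp add: prod.distrib gprod_def)
    also have "\<dots> \<le> 4 ^ ?N * (real ?N ^ ?N * A)"
    proof (rule mult_left_mono)
      have "ennreal (gprod x ?N / real ?N ^ ?N) \<le> emeasure lebesgue W"
        using convex_parallelepiped[of W x] W(1,2,3) x(1,2) by simp
      then have "ennreal (gprod x ?N / real ?N ^ ?N) \<le> ennreal A" using A(2) by (rule order_trans)
      then have "gprod x ?N / real ?N ^ ?N \<le> A" using A(1) by (subst (asm) ennreal_le_iff) auto
      then show "gprod x ?N \<le> real ?N ^ ?N * A" by (simp add: pos_divide_le_eq mult.commute)
    qed simp
    finally show ?thesis unfolding P_def power_mult_distrib by (simp only: mult.assoc)
  qed
  \<comment> \<open>Only the longest side is enlarged, so that the product becomes exactly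
    \<open>P\<close> and the order is kept.\<close>
  define s where "s i = (if i < m then f i else P / p)" for i
  define u where "u i = gs x (m - i) /\<^sub>R norm (gs x (m - i))" for i
  have fm: "f m \<le> P / p" using fP p0 by (simp add: pos_le_divide_eq mult.commute)
  have fs: "f i \<le> s i" if "i < ?N" for i
  proof (cases "i < m")
    case False
    then have "i = m" using that m by simp
    then show ?thesis using fm by (simp add: s_def)
  qed (simp add: s_def)
  have u1: "norm (u i) = 1" for i using x(2)[of "m - i"] by (simp add: u_def m)
  have u2: "u i \<bullet> u j = 0" if "i < ?N" "j < ?N" "i \<noteq> j" for i j
  proof -
    have "m - i \<noteq> m - j" using that by (simp add: m)
    then show ?thesis by (simp add: u_def gs_orth)
  qed
  have s0: "0 < s i" if "i < ?N" for i using f0 fs[OF that] by (rule less_le_trans)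
  have smono: "s i \<le> s j" if ij: "i \<le> j" "j < ?N" for i j
  proof (cases "i < m")
    case True
    have "s i = f i" using True by (simp add: s_def)
    also have "f i \<le> f j" using dec[of "m - j" "m - i"] ij by (simp add: f_def)
    also have "f j \<le> s j" by (rule fs[OF ij(2)])
    finally show ?thesis .
  next
    case False
    then have "i = j" using ij m by simp
    then show ?thesis by simp
  qed
  have sP: "(\<Prod>i<?N. s i) = P"
  proof -
    have "(\<Prod>i<?N. s i) = (\<Prod>i<m. s i) * s m" by (simp add: m)
    also have "(\<Prod>i<m. s i) = p" unfolding p_def by (rule prod.cong) (auto simp: s_def)
    also have "p * s m = P" using p0 by (simp add: s_def)
    finally show ?thesis .
  qed
  have uw: "\<bar>u i \<bullet> w\<bar> \<le> \<sigma> (m - i)" if "w \<in> W" for i w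
  proof -
    have "u i \<bullet> w = u i \<bullet> gs_perp x (m - i) w" by (simp add: u_def gs_inner_perp[of x "m - i" w])
    also have "\<bar>\<dots>\<bar> \<le> norm (u i) * norm (gs_perp x (m - i) w)" by (rule Cauchy_Schwarz_ineq2)
    also have "\<dots> \<le> \<sigma> (m - i)" using \<sigma>[OF that] by (simp add: u1)
    finally show ?thesis .
  qed
  have main: "\<bar>u i \<bullet> (v - w)\<bar> \<le> s i" if "v \<in> W" "w \<in> W" "i < ?N" for v w i
  proof -
    have "\<bar>u i \<bullet> (v - w)\<bar> \<le> \<bar>u i \<bullet> v\<bar> + \<bar>u i \<bullet> w\<bar>" by (simp add: inner_diff_right abs_triangle_ineq4)
    also have "\<dots> \<le> f i" using uw[OF that(1), of i] uw[OF that(2), of i] by (simp add: f_def)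
    also have "\<dots> \<le> s i" by (rule fs[OF that(3)])
    finally show ?thesis .
  qed
  show ?thesis unfolding orthonormal_box_def
    by (intro exI[of _ u] exI[of _ s] conjI allI impI ballI u1 u2 s0 smono sP[unfolded P_def] main) assumption+
qed

text \<open>Some direction is orthogonal to the whole set, so the side in that direction can be as
  thin as the prescribed product demands, whatever the extent in the other directions.\<close>

lemma ex_orthonormal_box_flat:
  fixes W :: "(real^'n) set" and P :: real
  assumes W: "bounded W" "span W \<noteq> UNIV" and P: "0 < P"
  shows "\<exists>u s. orthonormal_box W P u s"
proof -
  let ?N = "CARD('n)"
  obtain m where m: "?N = Suc m" using not0_implies_Suc[of ?N] by auto
  have "span W \<subset> UNIV" using W(2) by auto
  then obtain v0 where v0: "v0 \<noteq> 0" "\<And>w. w \<in> span W \<Longrightarrow> orthogonal v0 w"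
    using orthogonal_to_subspace_exists_gen[of W UNIV] by auto
  obtain x where x: "x 0 = v0" "\<And>i. i < ?N \<Longrightarrow> gs x i \<noteq> 0"
    using ex_gs_extension[of 1 "\<lambda>_. v0"] v0(1) m by (auto simp: gs_0)
  define u where "u i = gs x i /\<^sub>R norm (gs x i)" for i
  have u1: "norm (u i) = 1" if "i < ?N" for i using x(2)[OF that] by (simp add: u_def)
  have u2: "u i \<bullet> u j = 0" if "i \<noteq> j" for i j using that by (simp add: u_def gs_orth)
  obtain R where R: "\<And>w. w \<in> W \<Longrightarrow> norm w \<le> R" using W(1) by (auto simp: bounded_iff)
  \<comment> \<open>The bound 2R covers differences of points; the bounds 1 and \<open>P\<close>
    ensure that the thin side \<open>P / Q ^ m\<close> does not exceed \<open>Q\<close>.\<close>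
  define Q where "Q = max (max 1 P) (2 * R)"
  have Q: "1 \<le> Q" "P \<le> Q" "2 * R \<le> Q" by (auto simp: Q_def)
  define s where "s i = (if i = 0 then P / Q ^ m else Q)" for i :: nat
  have s0: "0 < s i" for i using P Q by (simp add: s_def)
  have "P / Q ^ m \<le> Q"
  proof -
    have "P / Q ^ m \<le> P / 1" using P Q by (intro divide_left_mono) auto
    then show ?thesis using Q by simp
  qed
  then have smono: "s i \<le> s j" if "i \<le> j" for i j using that by (auto simp: s_def)
  have sP: "(\<Prod>i<?N. s i) = P"
    unfolding m prod.lessThan_Suc_shift using Q by (simp add: s_def)
  have main: "\<bar>u i \<bullet> (v - w)\<bar> \<le> s i" if "v \<in> W" "w \<in> W" "i < ?N" for v w i
  proof (cases "i = 0")
    case True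
    have "gs x 0 = v0" by (simp add: gs_0 x(1))
    moreover have "v0 \<bullet> (v - w) = 0" using v0(2)[of v] v0(2)[of w] that by (simp add: inner_diff_right orthogonal_def span_base)
    ultimately have "u i \<bullet> (v - w) = 0" by (simp add: True u_def)
    then show ?thesis using s0[of i] by simp
  next
    case False
    have "\<bar>u i \<bullet> (v - w)\<bar> \<le> norm (u i) * norm (v - w)" by (rule Cauchy_Schwarz_ineq2)
    also have "\<dots> \<le> norm v + norm w" using u1[OF that(3)] by (simp add: norm_triangle_ineq4)
    also have "\<dots> \<le> Q" using R[OF that(1)] R[OF that(2)] Q(3) by linarith
    finally show ?thesis using False by (simp add: s_def)
  qed
  show ?thesis unfolding orthonormal_box_def
    by (intro exI[of _ u] exI[of _ s] conjI allI impI ballI u1 u2 s0 smono sP main) assumption+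
qed

lemma ex_SO_box:
  fixes T :: "(real^'n) set" and A :: real
  assumes T: "convex T" "bounded T" "T \<noteq> {}" and A: "0 < A" "emeasure lebesgue T \<le> ennreal A"
  shows "\<exists>h\<in>SO. \<exists>a. (\<forall>i. 0 < a i) \<and> (\<forall>i j. idx i \<le> idx j \<longrightarrow> a i \<le> a j)
    \<and> (\<Prod>i\<in>UNIV. a i) = (4 * real CARD('n)) ^ CARD('n) * A \<and> (\<forall>v\<in>T. \<forall>w\<in>T. h *v (v - w) \<in> abox a)"
proof -
  let ?N = "CARD('n)" and ?P = "(4 * real CARD('n)) ^ CARD('n) * A"
  have P: "0 < ?P" using A(1) by simp
  obtain x0 where x0: "x0 \<in> T" using T(3) by auto
  define W where "W = (\<lambda>x. - x0 + x) ` T"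
  have W: "convex W" "bounded W" "0 \<in> W"
    unfolding W_def using convex_translation[OF T(1), of "- x0"] bounded_translation[OF T(2), of "- x0"] x0
    by (simp_all add: image_iff)
  have WA: "emeasure lebesgue W \<le> ennreal A"
    using emeasure_lebesgue_affine[of 1 "- x0" T] A(2) by (simp add: W_def add.commute)
  have "\<exists>u s. orthonormal_box W ?P u s"
  proof (cases "span W = UNIV")
    case True
    show ?thesis using ex_orthonormal_box_full[OF W True A(1) WA] .
  next
    case False
    show ?thesis using ex_orthonormal_box_flat[OF W(2) False P] .
  qed
  then obtain u s where us: "orthonormal_box W ?P u s" by (elim exE)
  have u: "\<And>i. i < ?N \<Longrightarrow> norm (u i) = 1" "\<And>i j. i < ?N \<Longrightarrow> j < ?N \<Longrightarrow> i \<noteq> j \<Longrightarrow> u i \<bullet> u j = 0"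
    and s: "\<And>i. i < ?N \<Longrightarrow> 0 < s i" "\<And>i j. i \<le> j \<Longrightarrow> j < ?N \<Longrightarrow> s i \<le> s j" "(\<Prod>i<?N. s i) = ?P"
    and uW: "\<And>v w i. v \<in> W \<Longrightarrow> w \<in> W \<Longrightarrow> i < ?N \<Longrightarrow> \<bar>u i \<bullet> (v - w)\<bar> \<le> s i"
    using us unfolding orthonormal_box_def by simp_all
  obtain h where h: "h \<in> SO" "\<And>v c. \<bar>(h *v v) $ c\<bar> = \<bar>u (idx c) \<bullet> v\<bar>"
    using ex_SO_rows[of u] u by blast
  have hT: "h *v (v - w) \<in> abox (\<lambda>c. s (idx c))" if "v \<in> T" "w \<in> T" for v w
  proof -
    have "- x0 + v \<in> W" "- x0 + w \<in> W" using that by (auto simp: W_def)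
    then have "\<bar>u (idx c) \<bullet> ((- x0 + v) - (- x0 + w))\<bar> \<le> s (idx c)" for c :: 'n by (intro uW idx_less)
    then show ?thesis unfolding abox_def mem_Collect_eq h(2) by simp
  qed
  have sP: "(\<Prod>c\<in>(UNIV::'n set). s (idx c)) = ?P" using s(3) by (simp only: prod_idx)
  show ?thesis
    by (intro bexI[of _ h] exI[of _ "\<lambda>c. s (idx c)"] conjI allI impI ballI h(1) s(1,2) idx_less sP hT) assumption+
qed

section \<open>Proof of the theorem\<close>

text \<open>Subtracting one lattice point of \<open>g T\<close> from all of them keeps their number
  and eliminates the unknown position of \<open>T\<close>: the inverse rotation sends each
  difference to a difference of points of \<open>T\<close>.\<close>

lemma many_lattice_pts_imp_pts:
  fixes g h :: "real^'n^'n"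
  assumes g: "g \<in> SO" and T: "\<And>v w. v \<in> T \<Longrightarrow> w \<in> T \<Longrightarrow> h *v (v - w) \<in> B"
    and K: "1 \<le> K" and many: "many_lattice_pts g T K"
  shows "lattice_pts (h ** transpose g) B K"
proof -
  obtain S where S: "S \<subseteq> (\<lambda>v. g *v v) ` T \<inter> int_lattice" "finite S" "K \<le> real (card S)"
    using many unfolding many_lattice_pts_def by blast
  have "S \<noteq> {}" using S(3) K by auto
  then obtain s0 where s0: "s0 \<in> S" by auto
  have inj: "inj_on (\<lambda>s. s - s0) S" by (auto simp: inj_on_def)
  have "(h ** transpose g) *v (s - s0) \<in> B" if s: "s \<in> S" for s
  proof -
    obtain v w where vw: "v \<in> T" "w \<in> T" "s = g *v v" "s0 = g *v w" using S(1) s s0 by blast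
    have "transpose g *v (s - s0) = v - w"
      by (simp only: vw matrix_vector_mult_diff_distrib[symmetric] matrix_vector_mul_assoc
          SO_mult_transpose(2)[OF g] matrix_vector_mul_lid)
    then have "(h ** transpose g) *v (s - s0) = h *v (v - w)" by (metis matrix_vector_mul_assoc)
    then show ?thesis using T[OF vw(1,2)] by simp
  qed
  moreover have "(\<lambda>s. s - s0) ` S \<subseteq> int_lattice" 
  proof (rule image_subsetI)
    fix s assume "s \<in> S"
    then have "s \<in> int_lattice" "s0 \<in> int_lattice" using S(1) s0 by auto
    then show "s - s0 \<in> int_lattice" by (simp add: int_lattice_def Ints_diff)
  qed
  moreover have "K \<le> real (card ((\<lambda>s. s - s0) ` S))" using S(3) by (simp only: card_image[OF inj])
  ultimately show ?thesis unfolding lattice_pts_def using S(2) by (intro exI[of _ "(\<lambda>s. s - s0) ` S"]) auto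
qed

text \<open>The covering set is the transposed, \<open>h\<close>-translated set of
  \<open>lattice_pts\<close>, which is Borel; the event itself is not claimed to be measurable.
  Division by the volume \<open>u\<close> of \<open>near_orth\<close> turns the Lebesgue estimate
  into one for probabilities.\<close>

lemma haar_many_lattice_pts_bounded:
  fixes A :: real
  assumes A: "0 < A"
  shows "\<exists>C\<ge>0. \<forall>(M :: (real^'n^'n) measure) T K. haar_SO M \<longrightarrow> convex T \<longrightarrow> bounded T \<longrightarrow>
    emeasure lebesgue T \<le> ennreal A \<longrightarrow> 1 \<le> K \<longrightarrow>
    (\<exists>B\<in>sets M. {g \<in> SO. many_lattice_pts g T K} \<subseteq> B \<and> emeasure M B \<le> ennreal (C / K ^ CARD('n)))"
proof -
  let ?N = "CARD('n)" and ?\<kappa> = "real (2 * CARD('n))"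
  define P where "P = (4 * real ?N) ^ ?N * A"
  have P: "0 < P" using A by (simp add: P_def)
  obtain C where C: "0 \<le> C" "\<And>(a :: 'n \<Rightarrow> real) K. (\<forall>i. 0 < a i) \<Longrightarrow> (\<Prod>i\<in>UNIV. a i) = P \<Longrightarrow> 1 \<le> K \<Longrightarrow>
    emeasure lborel {n \<in> near_orth. lattice_pts n (abox (\<lambda>i. ?\<kappa> * a i)) K} \<le> ennreal (C / K ^ ?N)"
    using emeasure_near_orth_pts_le[OF P, of ?\<kappa>, where 'n='n] by auto
  define u where "u = measure lborel (near_orth :: (real^'n^'n) set)"
  have nu: "emeasure lborel (near_orth :: (real^'n^'n) set) = ennreal u"
    unfolding u_def using emeasure_near_orth(2)[where 'n='n] by (intro emeasure_eq_ennreal_measure) auto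
  have u: "0 < u" using emeasure_near_orth(1)[where 'n='n] unfolding nu by simp
  have main: "\<exists>B\<in>sets M. {g \<in> SO. many_lattice_pts g T K} \<subseteq> B \<and> emeasure M B \<le> ennreal (C / u / K ^ ?N)"
    if M: "haar_SO M" and T: "convex T" "bounded T" "emeasure lebesgue T \<le> ennreal A" and K: "1 \<le> K"
    for M :: "(real^'n^'n) measure" and T K
  proof (cases "T = {}")
    case True
    then have "\<not> many_lattice_pts g T K" for g using K by (auto simp: many_lattice_pts_def)
    then show ?thesis by (intro bexI[of _ "{}"]) auto
  next
    case False
    have sets: "sets M = sets borel" using M by (simp add: haar_SO_def)
    obtain h a where h: "h \<in> SO" and a: "\<And>i. 0 < a i" "\<And>i j. idx i \<le> idx j \<Longrightarrow> a i \<le> a j" "(\<Prod>i\<in>UNIV. a i) = P"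
      and hT: "\<And>v w. v \<in> T \<Longrightarrow> w \<in> T \<Longrightarrow> h *v (v - w) \<in> abox a"
      using ex_SO_box[OF T(1,2) False A T(3)] unfolding P_def by blast
    define S where "S = {g :: real^'n^'n. lattice_pts g (abox a) K}"
    have Sm: "S \<in> sets borel" unfolding S_def by (rule borel_pts[OF closed_abox])
    define S' where "S' = (\<lambda>g. h ** g) -` S"
    have S'm: "S' \<in> sets borel" using measurable_sets[OF measurable_matrix_mult_left[of h] Sm] by (simp add: S'_def)
    have Bm: "transpose -` S' \<in> sets M" using measurable_sets[OF measurable_transpose S'm] sets by simp
    have "emeasure M (transpose -` S') = emeasure M S'" by (rule haar_SO_transpose[OF M S'm])
    also have "\<dots> = emeasure M S" using M h Sm sets by (simp add: haar_SO_def S'_def)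
    finally have e: "emeasure M (transpose -` S') = emeasure M S" .
    have "ennreal u * emeasure M S \<le> emeasure lborel {n \<in> near_orth. lattice_pts n (abox (\<lambda>i. ?\<kappa> * a i)) K}"
      using haar_SO_pts_le[OF M, of a K] a(2) unfolding nu S_def by blast
    also have "\<dots> \<le> ennreal (C / K ^ ?N)" using C(2)[OF _ a(3) K] a(1) by blast
    finally have 1: "ennreal u * emeasure M S \<le> ennreal (C / K ^ ?N)" .
    have "emeasure M S = ennreal (1 / u) * (ennreal u * emeasure M S)"
      using u by (simp add: mult.assoc[symmetric] ennreal_mult[symmetric])
    also have "\<dots> \<le> ennreal (1 / u) * ennreal (C / K ^ ?N)" using 1 by (intro mult_left_mono) auto
    also have "\<dots> = ennreal (C / u / K ^ ?N)" using u C(1) K by (simp add: ennreal_mult[symmetric] mult.commute)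
    finally have "emeasure M (transpose -` S') \<le> ennreal (C / u / K ^ ?N)" unfolding e .
    moreover have "{g \<in> SO. many_lattice_pts g T K} \<subseteq> transpose -` S'"
      using many_lattice_pts_imp_pts[OF _ hT K] by (auto simp: S'_def S_def)
    ultimately show ?thesis using Bm by blast
  qed
  show ?thesis
  proof (intro exI[of _ "C / u"] conjI allI impI)
    show "0 \<le> C / u" using C(1) u by simp
  qed (rule main)
qed

text \<open>The witness is finite, hence the image of a bounded part of \<open>T\<close>. Having the
  property for all large radii, not just for one, is what the passage to a limit inferior
  needs.\<close>

lemma many_lattice_pts_bounded_part:
  assumes "many_lattice_pts g T K"
  shows "\<exists>j::nat. \<forall>i\<ge>j. many_lattice_pts g (T \<inter> cball 0 (real i)) K"
proof -
  obtain S where S: "S \<subseteq> (\<lambda>v. g *v v) ` T \<inter> int_lattice" "finite S" "K \<le> real (card S)"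
    using assms unfolding many_lattice_pts_def by blast
  from S(1) have "S \<subseteq> (\<lambda>v. g *v v) ` T" by blast
  from finite_subset_image[OF S(2) this] obtain F where F: "F \<subseteq> T" "finite F" "S = (\<lambda>v. g *v v) ` F" by blast
  obtain R where R: "\<And>v. v \<in> F \<Longrightarrow> norm v \<le> R" using finite_imp_bounded[OF F(2)] by (auto simp: bounded_iff)
  obtain j :: nat where j: "R \<le> real j" using real_arch_simple by blast
  have "many_lattice_pts g (T \<inter> cball 0 (real i)) K" if "j \<le> i" for i
  proof -
    have "norm v \<le> real i" if "v \<in> F" for v using R[OF that] j \<open>j \<le> i\<close> by linarith
    then have "F \<subseteq> T \<inter> cball 0 (real i)" using F(1) by auto
    then have "S \<subseteq> (\<lambda>v. g *v v) ` (T \<inter> cball 0 (real i)) \<inter> int_lattice" using S(1) F(3) by blast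
    then show ?thesis using S(2,3) unfolding many_lattice_pts_def by blast
  qed
  then show ?thesis by blast
qed

theorem theorem4p4:
  fixes A :: real
  assumes "A > 0"
  shows "\<exists>C::real. \<forall>(M :: (real^'n^'n) measure) (T :: (real^'n) set) (K :: real).
           haar_SO M \<longrightarrow> convex T \<longrightarrow> emeasure lebesgue T \<le> ennreal A \<longrightarrow> K \<ge> 1 \<longrightarrow>
           (\<exists>B\<in>sets M. {g \<in> SO. many_lattice_pts g T K} \<subseteq> B \<and>
              measure M B \<le> C * K powr (- real CARD('n)))"
proof -
  let ?N = "CARD('n)"
  obtain C where C: "0 \<le> C" "\<And>(M :: (real^'n^'n) measure) T K. haar_SO M \<Longrightarrow> convex T \<Longrightarrow> bounded T \<Longrightarrow>
    emeasure lebesgue T \<le> ennreal A \<Longrightarrow> 1 \<le> K \<Longrightarrow>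
    (\<exists>B\<in>sets M. {g \<in> SO. many_lattice_pts g T K} \<subseteq> B \<and> emeasure M B \<le> ennreal (C / K ^ ?N))"
    using haar_many_lattice_pts_bounded[OF assms, where 'n='n] by auto
  have "\<exists>B\<in>sets M. {g \<in> SO. many_lattice_pts g T K} \<subseteq> B \<and> measure M B \<le> C * K powr (- real ?N)"
    if M: "haar_SO M" and T: "convex T" "emeasure lebesgue T \<le> ennreal A" and K: "1 \<le> K"
    for M :: "(real^'n^'n) measure" and T :: "(real^'n) set" and K :: real
  proof -
    \<comment> \<open>Finite volume does not make a convex set bounded, as flat sets show;
      truncation is harmless because the bound is uniform over all bounded sets.\<close>
    define U where "U j = T \<inter> cball 0 (real j)" for j :: nat
    have U: "convex (U j)" "bounded (U j)" for j
      unfolding U_def using T(1) by (auto intro: convex_Int bounded_Int)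
    have "U j \<in> sets lebesgue" for j using measurable_convex[OF U] by (rule fmeasurableD)
    moreover have "T = (\<Union>j. U j)"
    proof -
      have "v \<in> (\<Union>j. U j)" if "v \<in> T" for v
      proof -
        obtain j :: nat where "norm v \<le> real j" using real_arch_simple by blast
        then show ?thesis using that by (auto simp: U_def)
      qed
      then show ?thesis by (auto simp: U_def)
    qed
    ultimately have Tm: "T \<in> sets lebesgue" by auto
    have UA: "emeasure lebesgue (U j) \<le> ennreal A" for j
      using emeasure_mono[of "U j" T lebesgue] Tm T(2) by (auto simp: U_def intro: order_trans)
    have "\<forall>j. \<exists>B. B \<in> sets M \<and> {g \<in> SO. many_lattice_pts g (U j) K} \<subseteq> B \<and> emeasure M B \<le> ennreal (C / K ^ ?N)"
      using C(2)[OF M U UA K] by blast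
    from choice[OF this] obtain B where B: "\<And>j. B j \<in> sets M" "\<And>j. {g \<in> SO. many_lattice_pts g (U j) K} \<subseteq> B j"
      "\<And>j. emeasure M (B j) \<le> ennreal (C / K ^ ?N)" by blast
    \<comment> \<open>The covering sets \<open>B i\<close> were chosen independently and need not
      increase with \<open>i\<close>. Their tail intersections do increase and are no larger in
      measure, so continuity from below preserves the bound.\<close>
    define D where "D j = (\<Inter>i\<in>{j..}. B i)" for j
    have Dm: "D j \<in> sets M" for j unfolding D_def using B(1) by (intro sets.countable_INT') auto
    have inc: "incseq D" unfolding D_def incseq_def by (auto intro: INT_anti_mono)
    have "emeasure M (\<Union>j. D j) = (SUP j. emeasure M (D j))"
      using Dm inc by (intro SUP_emeasure_incseq[symmetric]) auto
    also have "\<dots> \<le> ennreal (C / K ^ ?N)"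
    proof (rule SUP_least)
      fix j
      have "emeasure M (D j) \<le> emeasure M (B j)" using B(1) by (intro emeasure_mono) (auto simp: D_def)
      then show "emeasure M (D j) \<le> ennreal (C / K ^ ?N)" using B(3) by (rule order_trans)
    qed
    finally have "measure M (\<Union>j. D j) \<le> C / K ^ ?N"
      unfolding measure_def using C(1) K by (simp add: enn2real_leI)
    moreover have "C / K ^ ?N = C * K powr (- real ?N)"
      using K by (simp add: powr_minus powr_realpow divide_inverse)
    moreover have "{g \<in> SO. many_lattice_pts g T K} \<subseteq> (\<Union>j. D j)"
    proof clarify
      fix g :: "real^'n^'n" assume g: "g \<in> SO" "many_lattice_pts g T K"
      then obtain j :: nat where "\<And>i. j \<le> i \<Longrightarrow> many_lattice_pts g (U i) K"
        using many_lattice_pts_bounded_part[OF g(2)] unfolding U_def by blast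
      then have "g \<in> D j" using B(2) g(1) unfolding D_def by blast
      then show "g \<in> (\<Union>j. D j)" by blast
    qed
    moreover have "(\<Union>j. D j) \<in> sets M" using Dm by auto
    ultimately show ?thesis by (intro bexI[of _ "\<Union>j. D j"]) simp_all
  qed
  then show ?thesis by blast
qed

end
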